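(* Let $\mathbb{C}(\tilde E_6)=\{t\in\mathbb{C}: t^3\neq -27\}$ and let $\mathrm{Grp}^k(\tilde E_6)$ be the groupoid of the $\tilde E_6$-family (see context), with $G\subset \mathrm{PGL}_3(\mathbb{C})$ acting on $\mathbb{C}(\tilde E_6)$ through the homomorphism $\pi:G\to H$ (see context). (1) For $k=0$ or $k=1$, the groupoid $\mathrm{Grp}^k(\tilde E_6)$ restricted to the objects $\mathbb{C}(\tilde E_6)\setminus\{0,6,6\rho,6\rho^2\}$ is the action groupoid $\mathrm{Grp}^{\mathrm{ac}}\big(\mathbb{C}(\tilde E_6)\setminus\{0,6,6\rho,6\rho^2\}\,\big|\,G\big)$. (2) For every integer $k\ge 2$ and for $k=\infty$, $\mathrm{Grp}^k(\tilde E_6)$ is the action groupoid $\mathrm{Grp}^{\mathrm{ac}}\big(\mathbb{C}(\tilde E_6)\,\big|\,G\big)$. (In both cases the identification is the identity on objects, and the arrow $g:t\to \pi(g)(t)$ of the action groupoid corresponds to the class of the isomorphism whose linear map $\langle x,y,z\rangle\to\langle x',y',z'\rangle$ on degree-one parts has matrix $g$.) (3) (Failure of a Torelli-type theorem) For $t\in\mathbb{C}$ with $t^3\notin\{0,216,-27\}$, the first Yau algebra $L^1(\tilde E_6;t)$ is, up to isomorphism of Lie algebras, independent of the parameter $t$: all of them are isomorphic to one fixed solvable Lie algebra $\mathfrak g$; and the natural actions of $L^1(\tilde E_6;t)$ on $\mathcal A^1(\tilde E_6;t)$ give rise to a continuous family, parametrized by $t$, of $11$-dimensional representations of the solvable Lie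 algebra $\mathfrak g$.
   Context: Let $\rho$ be a primitive cube root of unity, $\mathcal O=\mathbb{C}[[x,y,z]]$ with maximal ideal $m$, and $x,y,z$ all of weight $1$. For $t\in\mathbb{C}(\tilde E_6)=\{t: t^3\ne -27\}$ put $f_t=x^3+y^3+z^3+t\,xyz$ and let $J(f_t)=\langle\partial_x f_t,\partial_y f_t,\partial_z f_t\rangle$. For an integer $k\ge 0$ let $I_k(t)=\langle f_t, m^kJ(f_t)\rangle$, let $I_\infty(t)=\langle f_t\rangle$, and let $\mathcal A^k(\tilde E_6;t)=\mathcal O/I_k(t)$ for $k\in\mathbb{Z}_{\ge0}\cup\{\infty\}$. The first Yau algebra is the Lie algebra of derivations $L^1(\tilde E_6;t)=\mathrm{Der}(\mathcal A^1(\tilde E_6;t),\mathcal A^1(\tilde E_6;t))$. The groupoid $\mathrm{Grp}^k(\tilde E_6)$ has object set $\mathbb{C}(\tilde E_6)$; morphisms $t\to s$ are the homogeneous (degree-preserving) $\mathbb{C}$-algebra isomorphisms $\mathcal A^k(\tilde E_6;t)\to\mathcal A^k(\tilde E_6;s)$ modulo the scalars $\mathbb{C}^*$ (acting by $x,y,z\mapsto \lambda x,\lambda y,\lambda z$). Writing $x,y,z$ for the coordinates of $\mathcal A^k(\tilde E_6;t)$ and $x',y',z'$ for those of $\mathcal A^k(\tilde E_6;s)$, such a morphism is given by an invertible linear substitution expressing $x,y,z$ as linear forms in $x',y',z'$, up to scalar, carrying $I_k(t)$ onto $I_k(s)$; so it is an element of $\mathrm{PGL}_3(\mathbb{C})$.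 For a group $G$ acting on a set $X$, the action groupoid $\mathrm{Grp}^{\mathrm{ac}}(X|G)$ has objects the elements of $X$, morphisms $x\to y$ the elements $g\in G$ with $gx=y$, and composition given by multiplication in $G$. $G\subset\mathrm{PGL}_3(\mathbb{C})$ is the subgroup generated by $$A_1=\begin{pmatrix}\rho&0&0\\0&1&0\\0&0&1\end{pmatrix},\ A_2=\begin{pmatrix}\rho&\rho^2&1\\\rho^2&\rho&1\\1&1&1\end{pmatrix},\ A_3=\begin{pmatrix}0&1&0\\1&0&0\\0&0&1\end{pmatrix},\ A_4=\begin{pmatrix}1&0&0\\0&0&1\\0&1&0\end{pmatrix}.$$ $H$ is the group of fractional linear transformations generated by $P:t\mapsto \rho t$ and $R:t\mapsto \frac{18-3t}{3+t}$. The group homomorphism $\pi:G\to H$ sends $A_1,A_2,A_3,A_4$ to $P,R,\mathrm{Id},\mathrm{Id}$ respectively. The matrices $A_i$ are symmetric, so for $g=A_i$ the corresponding isomorphism is the substitution $(x,y,z)^T=A_i(x',y',z')^T$. *)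

theory Defs
  imports
    "HOL-Analysis.Analysis"
    "HOL-Algebra.Algebra"
    "HOL-Algebra.Algebraic_Closure_Type"
    "HOL-Computational_Algebra.Formal_Power_Series"
    "HOL-Library.Extended_Nat"
    "HOL-Library.Numeral_Type"
begin

unbundle no fps_syntax

section \<open>Power series in three variables\<close>

text \<open>
  The ring C[[x,y,z]] is the iterated power series ring C[[x]][[y]][[z]]: the innermost variable
  is x and the outermost one is z.
\<close>

type_synonym ps3 = "complex fps fps fps"

definition coeff3 :: "ps3 \<Rightarrow> nat \<Rightarrow> nat \<Rightarrow> nat \<Rightarrow> complex" where
  "coeff3 F i j k = fps_nth (fps_nth (fps_nth F k) j) i"

definition mk_ps3 :: "(nat \<Rightarrow> nat \<Rightarrow> nat \<Rightarrow> complex) \<Rightarrow> ps3" where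
  "mk_ps3 c = Abs_fps (\<lambda>k. Abs_fps (\<lambda>j. Abs_fps (\<lambda>i. c i j k)))"

definition const3 :: "complex \<Rightarrow> ps3" where
  "const3 c = fps_const (fps_const (fps_const c))"

definition varX :: ps3 where "varX = fps_const (fps_const fps_X)"
definition varY :: ps3 where "varY = fps_const fps_X"
definition varZ :: ps3 where "varZ = fps_X"

definition vars :: "ps3 ^ 3" where
  "vars = vector [varX, varY, varZ]"

definition partial_x :: "ps3 \<Rightarrow> ps3" where
  "partial_x F = mk_ps3 (\<lambda>i j k. of_nat (Suc i) * coeff3 F (Suc i) j k)"
definition partial_y :: "ps3 \<Rightarrow> ps3" where
  "partial_y F = mk_ps3 (\<lambda>i j k. of_nat (Suc j) * coeff3 F i (Suc j) k)"
definition partial_z :: "ps3 \<Rightarrow> ps3" where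
  "partial_z F = mk_ps3 (\<lambda>i j k. of_nat (Suc k) * coeff3 F i j (Suc k))"

definition homogeneous3 :: "nat \<Rightarrow> ps3 \<Rightarrow> bool" where
  "homogeneous3 d F \<longleftrightarrow> (\<forall>i j k. coeff3 F i j k \<noteq> 0 \<longrightarrow> i + j + k = d)"

text \<open>The substitution of c x, c y, c z for x, y, z.\<close>

definition scale3 :: "complex \<Rightarrow> ps3 \<Rightarrow> ps3" where
  "scale3 c F = mk_ps3 (\<lambda>i j k. c ^ (i + j + k) * coeff3 F i j k)"

abbreviation complex_field :: "complex ring" where
  "complex_field \<equiv> ring_of_type_algebra"

abbreviation ps3_ring :: "ps3 ring" where
  "ps3_ring \<equiv> ring_of_type_algebra"


section \<open>The family of algebras\<close>

definition objE6 :: "complex set" where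
  "objE6 = {t. t ^ 3 \<noteq> -27}"

definition f_E6 :: "complex \<Rightarrow> ps3" where
  "f_E6 t = varX ^ 3 + varY ^ 3 + varZ ^ 3 + const3 t * varX * varY * varZ"

definition max_ideal :: "ps3 set" where
  "max_ideal = Idl\<^bsub>ps3_ring\<^esub> {varX, varY, varZ}"

definition jacobian_ideal :: "ps3 \<Rightarrow> ps3 set" where
  "jacobian_ideal F = Idl\<^bsub>ps3_ring\<^esub> {partial_x F, partial_y F, partial_z F}"

fun I_E6 :: "enat \<Rightarrow> complex \<Rightarrow> ps3 set" where
  "I_E6 (enat k) t = Idl\<^bsub>ps3_ring\<^esub>
     (insert (f_E6 t) ((ideal_prod ps3_ring max_ideal ^^ k) (jacobian_ideal (f_E6 t))))"
| "I_E6 \<infinity> t = Idl\<^bsub>ps3_ring\<^esub> {f_E6 t}"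

definition class_E6 :: "enat \<Rightarrow> complex \<Rightarrow> ps3 \<Rightarrow> ps3 set" where
  "class_E6 k t F = I_E6 k t +>\<^bsub>ps3_ring\<^esub> F"

text \<open>The quotient ring together with its structure of a complex algebra.\<close>

definition A_E6 :: "enat \<Rightarrow> complex \<Rightarrow> (complex, ps3 set) module" where
  "A_E6 k t = (let Q = ps3_ring Quot I_E6 k t in
     \<lparr> carrier = carrier Q, mult = mult Q, one = one Q, ring.zero = ring.zero Q, add = add Q,
       smult = (\<lambda>c a. class_E6 k t (const3 c) \<otimes>\<^bsub>Q\<^esub> a) \<rparr>)"

definition A_E6_deg :: "enat \<Rightarrow> complex \<Rightarrow> nat \<Rightarrow> ps3 set set" where
  "A_E6_deg k t d = class_E6 k t ` {F. homogeneous3 d F}"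


section \<open>Groupoids\<close>

record ('o, 'm) groupoid =
  objs :: "'o set"
  arrows :: "'o \<Rightarrow> 'o \<Rightarrow> 'm set"
  ident :: "'o \<Rightarrow> 'm"
  comp :: "'o \<Rightarrow> 'o \<Rightarrow> 'o \<Rightarrow> 'm \<Rightarrow> 'm \<Rightarrow> 'm"
    \<comment> \<open>comp C x y z b a is the composite of a from x to y with b from y to z\<close>

definition full_sub :: "('o, 'm) groupoid \<Rightarrow> 'o set \<Rightarrow> ('o, 'm) groupoid" where
  "full_sub C S =
     \<lparr> objs = objs C \<inter> S, arrows = arrows C, ident = ident C, comp = comp C \<rparr>"

definition action_groupoid ::
  "('g, 'e) monoid_scheme \<Rightarrow> ('g \<Rightarrow> 'o \<Rightarrow> 'o) \<Rightarrow> 'o set \<Rightarrow> ('o, 'g) groupoid" where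
  "action_groupoid G act S =
     \<lparr> objs = S,
       arrows = (\<lambda>x y. {g \<in> carrier G. act g x = y}),
       ident = (\<lambda>x. \<one>\<^bsub>G\<^esub>),
       comp = (\<lambda>x y z h g. h \<otimes>\<^bsub>G\<^esub> g) \<rparr>"

text \<open>An isomorphism of groupoids which is the identity on objects and is F on arrows.\<close>

definition groupoid_iso_over_objs ::
  "('o \<Rightarrow> 'o \<Rightarrow> 'm \<Rightarrow> 'n) \<Rightarrow> ('o, 'm) groupoid \<Rightarrow> ('o, 'n) groupoid \<Rightarrow> bool" where
  "groupoid_iso_over_objs F C D \<longleftrightarrow>
     objs C = objs D \<and>
     (\<forall>x \<in> objs C. \<forall>y \<in> objs C. bij_betw (F x y) (arrows C x y) (arrows D x y)) \<and>
     (\<forall>x \<in> objs C. F x x (ident C x) = ident D x) \<and>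
     (\<forall>x \<in> objs C. \<forall>y \<in> objs C. \<forall>z \<in> objs C. \<forall>a \<in> arrows C x y. \<forall>b \<in> arrows C y z.
        F x z (comp C x y z b a) = comp D x y z (F y z b) (F x y a))"


section \<open>The groupoid of the family\<close>

definition graded_iso_E6 :: "enat \<Rightarrow> complex \<Rightarrow> complex \<Rightarrow> (ps3 set \<Rightarrow> ps3 set) set" where
  "graded_iso_E6 k t s =
     {\<phi> \<in> ring_iso (A_E6 k t) (A_E6 k s). \<phi> \<in> extensional (carrier (A_E6 k t)) \<and>
        (\<forall>c. \<forall>a \<in> carrier (A_E6 k t). \<phi> (c \<odot>\<^bsub>A_E6 k t\<^esub> a) = c \<odot>\<^bsub>A_E6 k s\<^esub> \<phi> a) \<and>
        (\<forall>d. \<phi> ` A_E6_deg k t d \<subseteq> A_E6_deg k s d)}"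

text \<open>
  The class of an isomorphism modulo scalars. As the ideal is homogeneous, the image of a coset
  under \<^term>\<open>scale3 c\<close> is again a coset.
\<close>

definition scalar_class ::
  "enat \<Rightarrow> complex \<Rightarrow> (ps3 set \<Rightarrow> ps3 set) \<Rightarrow> (ps3 set \<Rightarrow> ps3 set) set" where
  "scalar_class k t \<phi> =
     {\<lambda>a \<in> carrier (A_E6 k t). \<phi> (scale3 c ` a) | c. c \<noteq> 0}"

definition Grp_E6 :: "enat \<Rightarrow> (complex, (ps3 set \<Rightarrow> ps3 set) set) groupoid" where
  "Grp_E6 k =
     \<lparr> objs = objE6,
       arrows = (\<lambda>t s. scalar_class k t ` graded_iso_E6 k t s),
       ident = (\<lambda>t. scalar_class k t (\<lambda>a \<in> carrier (A_E6 k t). a)),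
       comp = (\<lambda>t s u \<Psi> \<Phi>. {compose (carrier (A_E6 k t)) \<psi> \<phi> | \<psi> \<phi>. \<psi> \<in> \<Psi> \<and> \<phi> \<in> \<Phi>}) \<rparr>"


section \<open>The groups G and H\<close>

definition GL_group :: "(complex ^ 'n ^ 'n) monoid" where
  "GL_group = \<lparr> carrier = {A. invertible A}, mult = (**), one = mat 1 \<rparr>"

definition scalar_mats :: "(complex ^ 'n ^ 'n) set" where
  "scalar_mats = {mat c | c. c \<noteq> 0}"

definition PGL3 :: "(complex ^ 3 ^ 3) set monoid" where
  "PGL3 = GL_group Mod scalar_mats"

definition proj_class :: "complex ^ 3 ^ 3 \<Rightarrow> (complex ^ 3 ^ 3) set" where
  "proj_class A = scalar_mats #>\<^bsub>GL_group\<^esub> A"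

definition mat_A1 :: "complex \<Rightarrow> complex ^ 3 ^ 3" where
  "mat_A1 \<rho> = vector [vector [\<rho>, 0, 0], vector [0, 1, 0], vector [0, 0, 1]]"
definition mat_A2 :: "complex \<Rightarrow> complex ^ 3 ^ 3" where
  "mat_A2 \<rho> = vector [vector [\<rho>, \<rho>\<^sup>2, 1], vector [\<rho>\<^sup>2, \<rho>, 1], vector [1, 1, 1]]"
definition mat_A3 :: "complex ^ 3 ^ 3" where
  "mat_A3 = vector [vector [0, 1, 0], vector [1, 0, 0], vector [0, 0, 1]]"
definition mat_A4 :: "complex ^ 3 ^ 3" where
  "mat_A4 = vector [vector [1, 0, 0], vector [0, 0, 1], vector [0, 1, 0]]"

definition G_E6 :: "complex \<Rightarrow> (complex ^ 3 ^ 3) set monoid" where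
  "G_E6 \<rho> = subgroup_generated PGL3 (proj_class ` {mat_A1 \<rho>, mat_A2 \<rho>, mat_A3, mat_A4})"

text \<open>
  The fractional linear transformations are taken as bijections of the infinite set
  \<^term>\<open>objE6\<close>, which contains no pole of them and on which they are determined.
\<close>

definition moeb_P :: "complex \<Rightarrow> complex \<Rightarrow> complex" where
  "moeb_P \<rho> = restrict (moebius \<rho> 0 0 1) objE6"
definition moeb_R :: "complex \<Rightarrow> complex" where
  "moeb_R = restrict (moebius (-3) 18 1 3) objE6"

definition H_E6 :: "complex \<Rightarrow> (complex \<Rightarrow> complex) monoid" where
  "H_E6 \<rho> = subgroup_generated (BijGroup objE6) {moeb_P \<rho>, moeb_R}"

text \<open>
  The class of the isomorphism whose linear map on degree-one parts has a matrix in the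
  projective class g. The columns of a matrix are the images of x, y, z, so that a composite
  of isomorphisms corresponds to the matrix product in the same order.
\<close>

definition matrix_arrow ::
  "enat \<Rightarrow> complex \<Rightarrow> complex \<Rightarrow> (complex ^ 3 ^ 3) set \<Rightarrow> (ps3 set \<Rightarrow> ps3 set) set" where
  "matrix_arrow k t s g =
     {\<phi> \<in> graded_iso_E6 k t s. \<exists>A \<in> g. \<forall>j.
        \<phi> (class_E6 k t (vars $ j)) = class_E6 k s (\<Sum>i\<in>UNIV. const3 (A $ i $ j) * vars $ i)}"


section \<open>Lie algebras and representations\<close>

record 'b lie = "(complex, 'b) module" +
  lbracket :: "'b \<Rightarrow> 'b \<Rightarrow> 'b"

text \<open>
  The fields \<^const>\<open>mult\<close> and \<^const>\<open>one\<close> of the underlying record play no role.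
\<close>

locale lie_algebra = Module.module complex_field L for L :: "'b lie" (structure) +
  assumes lbracket_closed:
      "\<lbrakk>x \<in> carrier L; y \<in> carrier L\<rbrakk> \<Longrightarrow> lbracket L x y \<in> carrier L"
    and lbracket_add_left:
      "\<lbrakk>x \<in> carrier L; y \<in> carrier L; z \<in> carrier L\<rbrakk>
        \<Longrightarrow> lbracket L (x \<oplus>\<^bsub>L\<^esub> y) z = lbracket L x z \<oplus>\<^bsub>L\<^esub> lbracket L y z"
    and lbracket_add_right:
      "\<lbrakk>x \<in> carrier L; y \<in> carrier L; z \<in> carrier L\<rbrakk>
        \<Longrightarrow> lbracket L x (y \<oplus>\<^bsub>L\<^esub> z) = lbracket L x y \<oplus>\<^bsub>L\<^esub> lbracket L x z"
    and lbracket_smult_left: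
      "\<lbrakk>x \<in> carrier L; y \<in> carrier L\<rbrakk>
        \<Longrightarrow> lbracket L (c \<odot>\<^bsub>L\<^esub> x) y = c \<odot>\<^bsub>L\<^esub> lbracket L x y"
    and lbracket_smult_right:
      "\<lbrakk>x \<in> carrier L; y \<in> carrier L\<rbrakk>
        \<Longrightarrow> lbracket L x (c \<odot>\<^bsub>L\<^esub> y) = c \<odot>\<^bsub>L\<^esub> lbracket L x y"
    and lbracket_self: "x \<in> carrier L \<Longrightarrow> lbracket L x x = \<zero>\<^bsub>L\<^esub>"
    and jacobi:
      "\<lbrakk>x \<in> carrier L; y \<in> carrier L; z \<in> carrier L\<rbrakk>
        \<Longrightarrow> lbracket L x (lbracket L y z) \<oplus>\<^bsub>L\<^esub>
            (lbracket L y (lbracket L z x) \<oplus>\<^bsub>L\<^esub> lbracket L z (lbracket L x y)) = \<zero>\<^bsub>L\<^esub>"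

definition derived_sub :: "'b lie \<Rightarrow> 'b set \<Rightarrow> 'b set" where
  "derived_sub L S =
     \<Inter>{U. submodule U complex_field L \<and> (\<forall>x \<in> S. \<forall>y \<in> S. lbracket L x y \<in> U)}"

definition solvable_lie :: "'b lie \<Rightarrow> bool" where
  "solvable_lie L \<longleftrightarrow> (\<exists>n. (derived_sub L ^^ n) (carrier L) = {\<zero>\<^bsub>L\<^esub>})"

definition lie_iso :: "'a lie \<Rightarrow> 'b lie \<Rightarrow> ('a \<Rightarrow> 'b) set" where
  "lie_iso L M = {\<psi>. bij_betw \<psi> (carrier L) (carrier M) \<and>
     (\<forall>x \<in> carrier L. \<forall>y \<in> carrier L. \<psi> (x \<oplus>\<^bsub>L\<^esub> y) = \<psi> x \<oplus>\<^bsub>M\<^esub> \<psi> y) \<and>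
     (\<forall>c. \<forall>x \<in> carrier L. \<psi> (c \<odot>\<^bsub>L\<^esub> x) = c \<odot>\<^bsub>M\<^esub> \<psi> x) \<and>
     (\<forall>x \<in> carrier L. \<forall>y \<in> carrier L. \<psi> (lbracket L x y) = lbracket M (\<psi> x) (\<psi> y))}"

definition derivations :: "(complex, 'a) module \<Rightarrow> ('a \<Rightarrow> 'a) set" where
  "derivations A = {D \<in> carrier A \<rightarrow>\<^sub>E carrier A.
     (\<forall>a \<in> carrier A. \<forall>b \<in> carrier A. D (a \<oplus>\<^bsub>A\<^esub> b) = D a \<oplus>\<^bsub>A\<^esub> D b) \<and>
     (\<forall>c. \<forall>a \<in> carrier A. D (c \<odot>\<^bsub>A\<^esub> a) = c \<odot>\<^bsub>A\<^esub> D a) \<and>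
     (\<forall>a \<in> carrier A. \<forall>b \<in> carrier A.
        D (a \<otimes>\<^bsub>A\<^esub> b) = (D a \<otimes>\<^bsub>A\<^esub> b) \<oplus>\<^bsub>A\<^esub> (a \<otimes>\<^bsub>A\<^esub> D b))}"

definition Der :: "(complex, 'a) module \<Rightarrow> ('a \<Rightarrow> 'a) lie" where
  "Der A =
     \<lparr> carrier = derivations A,
       mult = (\<lambda>D E. undefined),
       one = undefined,
       ring.zero = (\<lambda>a \<in> carrier A. \<zero>\<^bsub>A\<^esub>),
       add = (\<lambda>D E. \<lambda>a \<in> carrier A. D a \<oplus>\<^bsub>A\<^esub> E a),
       smult = (\<lambda>c D. \<lambda>a \<in> carrier A. c \<odot>\<^bsub>A\<^esub> D a),
       lbracket = (\<lambda>D E. \<lambda>a \<in> carrier A. D (E a) \<ominus>\<^bsub>A\<^esub> E (D a)) \<rparr>"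

definition L1_E6 :: "complex \<Rightarrow> (ps3 set \<Rightarrow> ps3 set) lie" where
  "L1_E6 t = Der (A_E6 1 t)"

definition matrix_rep :: "'b lie \<Rightarrow> ('b \<Rightarrow> complex ^ 'n ^ 'n) \<Rightarrow> bool" where
  "matrix_rep L r \<longleftrightarrow>
     (\<forall>x \<in> carrier L. \<forall>y \<in> carrier L. r (x \<oplus>\<^bsub>L\<^esub> y) = r x + r y) \<and>
     (\<forall>c. \<forall>x \<in> carrier L. r (c \<odot>\<^bsub>L\<^esub> x) = mat c ** r x) \<and>
     (\<forall>x \<in> carrier L. \<forall>y \<in> carrier L. r (lbracket L x y) = r x ** r y - r y ** r x)"

definition rep_equiv ::
  "'b lie \<Rightarrow> ('b \<Rightarrow> complex ^ 'n ^ 'n) \<Rightarrow> ('b \<Rightarrow> complex ^ 'n ^ 'n) \<Rightarrow> bool" where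
  "rep_equiv L r r' \<longleftrightarrow> (\<exists>P. invertible P \<and> (\<forall>x \<in> carrier L. P ** r x = r' x ** P))"

definition coordinates :: "(complex, 'a) module \<Rightarrow> ('a \<Rightarrow> complex ^ 'n) set" where
  "coordinates A = {\<theta>. bij_betw \<theta> (carrier A) UNIV \<and>
     (\<forall>a \<in> carrier A. \<forall>b \<in> carrier A. \<theta> (a \<oplus>\<^bsub>A\<^esub> b) = \<theta> a + \<theta> b) \<and>
     (\<forall>c. \<forall>a \<in> carrier A. \<theta> (c \<odot>\<^bsub>A\<^esub> a) = c *s \<theta> a)}"

text \<open>
  In suitable coordinates on A, the matrices r x describe the natural action of the derivations
  of A on A, pulled back along the isomorphism \<^term>\<open>\<psi>\<close> from L to \<^term>\<open>Der A\<close>.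
\<close>

definition is_natural_rep ::
  "'b lie \<Rightarrow> (complex, 'a) module \<Rightarrow> ('b \<Rightarrow> 'a \<Rightarrow> 'a) \<Rightarrow> ('b \<Rightarrow> complex ^ 'n ^ 'n) \<Rightarrow> bool" where
  "is_natural_rep L A \<psi> r \<longleftrightarrow>
     (\<exists>\<theta> \<in> coordinates A. \<forall>x \<in> carrier L. \<forall>a \<in> carrier A. \<theta> (\<psi> x a) = r x *v \<theta> a)"

end

theory Submission
  imports Defs
begin

text \<open>
  The groupoids. A homogeneous isomorphism between two algebras of the family is induced by a linear
  substitution A (graded_iso_subst_map), so everything is about which A carry I_k(t) onto I_k(s).
  For k \<ge> 2 the cubic part of I_k is spanned by f_t, hence A must carry f_t to a multiple of f_s. For
  k = 0 and k = 1 the ideal only remembers the span of the partial derivatives of f_t. Comparing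
  symmetric trilinear forms shows that A still carries f_t to a multiple of f_s unless s is one of the
  parameters 0, 6, 6 \<rho>, 6 \<rho>^2 of the Fermat cubic (cub_equiv_of_gradient).

  Such a matrix A belongs to the group G (cub_equiv_in_hessian). The Hessian determinant is a covariant
  and maps the pencil spanned by x^3 + y^3 + z^3 and x y z to itself; for t^3 \<noteq> -27 the cubic f_t and its
  Hessian determinant span the pencil, so A preserves the pencil. Hence A carries x y z to one of the four
  triangles in the pencil. The group G permutes the triangles transitively, so one may assume that A
  fixes x y z up to a factor. Then A is a monomial matrix whose nonzero entries have equal cubes, and
  these matrices are products of generators of G. Conversely, each generator carries f_t to a multiple of
  f_s, where s is the image of t under the corresponding transformation; as s is determined by A and t,
  this defines the homomorphism from G to H, and composition of isomorphisms is multiplication of matrices.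

  The Lie algebras. The algebra O / m J has dimension 11, with coordinates given by the coefficients up to
  degree two and a functional lam on the cubic forms. A derivation has no part of negative degree, and
  for t^3 different from 0, 216, -27 its part of degree zero is a multiple of the Euler derivation
  (psi_surj). The parts of degree one and two are arbitrary linear maps from the linear forms to the
  quadratic forms and to the cubic forms. In suitable coordinates t disappears from the commutators
  (g_act_bracket), but not from the action, and the representations for different t are inequivalent
  (g_rep_rigid).
\<close>

text \<open>In the sequel the symbol $ denotes components of vectors only.\<close>

no_notation fps_nth (infixl "$" 75)

section \<open>Power series in three variables and their evaluation on lines\<close>

lemma ps3_eqI: "(\<And>i j k. coeff3 F i j k = coeff3 G i j k) \<Longrightarrow> F = G"
  by (simp add: coeff3_def fps_eq_iff)

lemma coeff3_mk [simp]: "coeff3 (mk_ps3 c) i j k = c i j k"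
  by (simp add: coeff3_def mk_ps3_def)

lemma coeff3_linear [simp]:
  "coeff3 0 i j k = 0"
  "coeff3 (F + G) i j k = coeff3 F i j k + coeff3 G i j k"
  "coeff3 (F - G) i j k = coeff3 F i j k - coeff3 G i j k"
  "coeff3 (- F) i j k = - coeff3 F i j k"
  "coeff3 (const3 c * F) i j k = c * coeff3 F i j k"
  by (simp_all add: coeff3_def const3_def)

lemma coeff3_sum [simp]: "coeff3 (sum f S) i j k = (\<Sum>x\<in>S. coeff3 (f x) i j k)"
  by (induction S rule: infinite_finite_induct) auto

lemma const3_hom [simp]:
  "const3 0 = 0" "const3 1 = 1" "const3 (a + b) = const3 a + const3 b"
  "const3 (a - b) = const3 a - const3 b" "const3 (- a) = - const3 a"
  "const3 (a * b) = const3 a * const3 b"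
  by (simp_all add: const3_def flip: fps_const_add fps_const_sub fps_const_neg fps_const_mult)

lemma const3_numeral: "const3 (numeral n) = numeral n"
  by (simp add: const3_def numeral_fps_const)

lemma coeff3_const3: "coeff3 (const3 c) i j k = (if i = 0 \<and> j = 0 \<and> k = 0 then c else 0)"
  by (simp add: coeff3_def const3_def)

lemma coeff3_one: "coeff3 1 i j k = (if i = 0 \<and> j = 0 \<and> k = 0 then 1 else 0)"
  by (simp add: coeff3_def)

lemma coeff3_var_mult [simp]:
  "coeff3 (varX * F) i j k = (if i = 0 then 0 else coeff3 F (i - 1) j k)"
  "coeff3 (varY * F) i j k = (if j = 0 then 0 else coeff3 F i (j - 1) k)"
  "coeff3 (varZ * F) i j k = (if k = 0 then 0 else coeff3 F i j (k - 1))"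
  by (simp_all add: coeff3_def varX_def varY_def varZ_def)

lemma coeff3_mult:
  "coeff3 (F * G) i j k =
     (\<Sum>c\<le>k. \<Sum>b\<le>j. \<Sum>a\<le>i. coeff3 F a b c * coeff3 G (i - a) (j - b) (k - c))"
  by (simp add: coeff3_def fps_mult_nth fps_sum_nth atMost_atLeast0)

definition tripl :: "nat \<Rightarrow> (nat \<times> nat \<times> nat) set" where
  "tripl d = {(i, j, k). i + j + k = d}"

lemma tripl_eq: "tripl d = (\<lambda>(k, j). (d - k - j, j, k)) ` (SIGMA k:{..d}. {..d - k})"
proof (intro equalityI subsetI)
  fix p assume "p \<in> tripl d"
  then obtain i j k where p: "p = (i, j, k)" "i + j + k = d" by (auto simp: tripl_def)
  then have "p = (\<lambda>(k, j). (d - k - j, j, k)) (k, j)" "(k, j) \<in> (SIGMA k:{..d}. {..d - k})" by auto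
  then show "p \<in> (\<lambda>(k, j). (d - k - j, j, k)) ` (SIGMA k:{..d}. {..d - k})" by blast
qed (auto simp: tripl_def)

lemma finite_tripl [simp]: "finite (tripl d)"
  by (simp add: tripl_eq)

lemma sum_tripl: "(\<Sum>(i, j, k)\<in>tripl d. g i j k) = (\<Sum>k\<le>d. \<Sum>j\<le>d - k. g (d - k - j) j k)"
proof -
  have "inj_on (\<lambda>(k, j). (d - k - j, j, k)) (SIGMA k:{..d}. {..d - k})"
    by (auto simp: inj_on_def)
  then show ?thesis
    by (simp add: tripl_eq sum.reindex sum.Sigma split_def o_def)
qed

text \<open>
  The restriction of a power series to the line through v, that is F(v T) as a series in T. Its
  coefficient of T^d is the value at v of the part of degree d. These maps are ring homomorphisms and
  jointly injective, so properties of substitutions and orders of series can be checked on them.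
\<close>

definition ev :: "complex ^ 3 \<Rightarrow> ps3 \<Rightarrow> complex fps" where
  "ev v F = Abs_fps (\<lambda>d. \<Sum>(i, j, k)\<in>tripl d. coeff3 F i j k * (v$1 ^ i * v$2 ^ j * v$3 ^ k))"

lemma ev_nth: "fps_nth (ev v F) d =
    (\<Sum>(i, j, k)\<in>tripl d. coeff3 F i j k * (v$1 ^ i * v$2 ^ j * v$3 ^ k))"
  by (simp add: ev_def)

lemma ev_add [simp]: "ev v (F + G) = ev v F + ev v G"
  by (rule fps_ext) (simp add: ev_nth split_def algebra_simps sum.distrib)

lemma ev_const_mult [simp]: "ev v (const3 c * F) = fps_const c * ev v F"
  by (rule fps_ext) (simp add: ev_nth split_def sum_distrib_left mult.assoc)

lemma ev_zero [simp]: "ev v 0 = 0"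
  by (rule fps_ext) (simp add: ev_nth split_def)

lemma ev_uminus [simp]: "ev v (- F) = - ev v F"
  by (rule fps_ext) (simp add: ev_nth split_def sum_negf)

lemma ev_diff [simp]: "ev v (F - G) = ev v F - ev v G"
  using ev_add[of v F "- G"] by simp

lemma ev_sum [simp]: "ev v (sum f S) = (\<Sum>x\<in>S. ev v (f x))"
  by (induction S rule: infinite_finite_induct) auto

lemma monomial_split:
  fixes x y z :: complex
  assumes "a \<le> i" "b \<le> j" "c \<le> k"
  shows "x ^ i * y ^ j * z ^ k = (x ^ a * y ^ b * z ^ c) * (x ^ (i - a) * y ^ (j - b) * z ^ (k - c))"
proof -
  have "x ^ i = x ^ a * x ^ (i - a)" "y ^ j = y ^ b * y ^ (j - b)" "z ^ k = z ^ c * z ^ (k - c)"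
    using assms by (simp_all flip: power_add)
  then show ?thesis by (metis (no_types, lifting) mult.assoc mult.commute)
qed

text \<open>
  A monomial of the product together with a splitting of its exponents amounts to a degree e, a triple of
  exponents of degree e and one of the complementary degree.
\<close>

lemma ev_mult [simp]: "ev v (F * G) = ev v F * ev v G"
proof (rule fps_ext)
  fix d
  let ?m = "\<lambda>i j k. v$1 ^ i * v$2 ^ j * v$3 ^ k"
  let ?h = "\<lambda>(i, j, k) (a, b, c). coeff3 F a b c * ?m a b c * (coeff3 G i j k * ?m i j k)"
  let ?A = "SIGMA p:tripl d. {..snd (snd p)} \<times> {..fst (snd p)} \<times> {..fst p}"
  let ?B = "SIGMA e:{..d}. tripl e \<times> tripl (d - e)"
  have split: "coeff3 F a b c * coeff3 G (i - a) (j - b) (k - c) * ?m i j k =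
      coeff3 F a b c * ?m a b c * (coeff3 G (i - a) (j - b) (k - c) * ?m (i - a) (j - b) (k - c))"
    if "a \<le> i" "b \<le> j" "c \<le> k" for a b c i j k
    using monomial_split[OF that, of "v$1" "v$2" "v$3"] by simp
  have "fps_nth (ev v (F * G)) d =
    (\<Sum>p\<in>tripl d. \<Sum>q\<in>{..snd (snd p)} \<times> {..fst (snd p)} \<times> {..fst p}.
      coeff3 F (snd (snd q)) (fst (snd q)) (fst q) *
      coeff3 G (fst p - snd (snd q)) (fst (snd p) - fst (snd q)) (snd (snd p) - fst q) *
      ?m (fst p) (fst (snd p)) (snd (snd p)))"
    unfolding ev_nth coeff3_mult split_def
    by (rule sum.cong) (simp_all add: sum.cartesian_product sum_distrib_right split_def)
  also have "\<dots> = (\<Sum>(p, q)\<in>?A.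
      coeff3 F (snd (snd q)) (fst (snd q)) (fst q) *
      coeff3 G (fst p - snd (snd q)) (fst (snd p) - fst (snd q)) (snd (snd p) - fst q) *
      ?m (fst p) (fst (snd p)) (snd (snd p)))"
    by (rule sum.Sigma) auto
  also have "\<dots> = (\<Sum>(p, q)\<in>?A.
      coeff3 F (snd (snd q)) (fst (snd q)) (fst q) *
      ?m (snd (snd q)) (fst (snd q)) (fst q) *
      (coeff3 G (fst p - snd (snd q)) (fst (snd p) - fst (snd q)) (snd (snd p) - fst q) *
      ?m (fst p - snd (snd q)) (fst (snd p) - fst (snd q)) (snd (snd p) - fst q)))"
    by (rule sum.cong[OF refl])
      (clarify, simp only: prod.case fst_conv snd_conv, rule split, simp_all)
  also have "\<dots> = (\<Sum>(e, q, p)\<in>?B. coeff3 F (fst q) (fst (snd q)) (snd (snd q)) *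
       ?m (fst q) (fst (snd q)) (snd (snd q)) *
       (coeff3 G (fst p) (fst (snd p)) (snd (snd p)) * ?m (fst p) (fst (snd p)) (snd (snd p))))"
    by (rule sum.reindex_bij_witness[where
        j = "\<lambda>((i, j, k), (c, b, a)). (a + b + c, (a, b, c), (i - a, j - b, k - c))" and
        i = "\<lambda>(e, (a, b, c), (i, j, k)). ((a + i, b + j, c + k), (c, b, a))"])
      (auto simp: tripl_def)
  also have "\<dots> = (\<Sum>e\<le>d. \<Sum>(q, p)\<in>tripl e \<times> tripl (d - e). coeff3 F (fst q) (fst (snd q)) (snd (snd q)) *
       ?m (fst q) (fst (snd q)) (snd (snd q)) *
       (coeff3 G (fst p) (fst (snd p)) (snd (snd p)) * ?m (fst p) (fst (snd p)) (snd (snd p))))"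
    by (subst sum.Sigma) auto
  also have "\<dots> = fps_nth (ev v F * ev v G) d"
    by (simp add: fps_mult_nth ev_nth split_def sum_product sum.cartesian_product atMost_atLeast0)
  finally show "fps_nth (ev v (F * G)) d = fps_nth (ev v F * ev v G) d" .
qed

lemma ev_const [simp]: "ev v (const3 c) = fps_const c"
proof (rule fps_ext)
  fix d
  have "fps_nth (ev v (const3 c)) d =
     (\<Sum>p\<in>tripl d. if p = (0, 0, 0) then c else 0)"
    unfolding ev_nth by (rule sum.cong) (auto simp: coeff3_const3 split: if_splits)
  also have "\<dots> = fps_nth (fps_const c) d"
    by (simp add: sum.delta) (simp add: tripl_def)
  finally show "fps_nth (ev v (const3 c)) d = fps_nth (fps_const c) d" .
qed

lemma ev_one [simp]: "ev v 1 = 1"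
  using ev_const[of v 1] by (simp del: ev_const)

lemma ev_power [simp]: "ev v (F ^ n) = ev v F ^ n"
  by (induction n) auto

lemma coeff3_var:
  "coeff3 varX i j k = (if (i, j, k) = (1, 0, 0) then 1 else 0)"
  "coeff3 varY i j k = (if (i, j, k) = (0, 1, 0) then 1 else 0)"
  "coeff3 varZ i j k = (if (i, j, k) = (0, 0, 1) then 1 else 0)"
  using coeff3_var_mult[of 1 i j k] by (auto simp: coeff3_one)

lemma ev_var [simp]:
  "ev v varX = fps_const (v$1) * fps_X"
  "ev v varY = fps_const (v$2) * fps_X"
  "ev v varZ = fps_const (v$3) * fps_X"
proof -
  have "fps_nth (ev v varX) d = (\<Sum>p\<in>tripl d. if p = (1, 0, 0) then v$1 else 0)"
    "fps_nth (ev v varY) d = (\<Sum>p\<in>tripl d. if p = (0, 1, 0) then v$2 else 0)"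
    "fps_nth (ev v varZ) d = (\<Sum>p\<in>tripl d. if p = (0, 0, 1) then v$3 else 0)" for d
    unfolding ev_nth by (rule sum.cong; auto simp: coeff3_var split: if_splits)+
  then show "ev v varX = fps_const (v$1) * fps_X" "ev v varY = fps_const (v$2) * fps_X"
    "ev v varZ = fps_const (v$3) * fps_X"
    by (intro fps_ext; simp add: sum.delta; simp add: tripl_def)+
qed

lemma vars_nth [simp]: "vars $ 1 = varX" "vars $ 2 = varY" "vars $ 3 = varZ"
  by (simp_all add: vars_def)

lemma ev_vars [simp]: "ev v (vars $ j) = fps_const (v $ j) * fps_X"
  using exhaust_3[of j] by auto

text \<open>
  At the points (1, b, c) a form is a polynomial in c whose coefficients are polynomials in b.
\<close>

lemma ev_injective_degree:
  assumes "\<And>v. fps_nth (ev v F) d = fps_nth (ev v G) d" and "i + j + k = d"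
  shows "coeff3 F i j k = coeff3 G i j k"
proof -
  define H where "H = F - G"
  have 0: "(\<Sum>k\<le>d. (\<Sum>j\<le>d - k. coeff3 H (d - k - j) j k * b ^ j) * c ^ k) = 0" for b c
  proof -
    have "fps_nth (ev (vector [1, b, c]) H) d = 0"
      using assms(1)[of "vector [1, b, c]"] by (simp add: H_def)
    then show ?thesis
      by (simp add: ev_nth sum_tripl sum_distrib_right mult.assoc)
  qed
  have "(\<Sum>j\<le>d - k. coeff3 H (d - k - j) j k * b ^ j) = 0" for b
    using polyfun_eq_0[of "\<lambda>k. (\<Sum>j\<le>d - k. coeff3 H (d - k - j) j k * b ^ j)" d] 0 assms(2)
    by auto
  then have "coeff3 H (d - k - j) j k = 0"
    using polyfun_eq_0[of "\<lambda>j. coeff3 H (d - k - j) j k" "d - k"] assms(2) by auto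
  moreover have "d - k - j = i" using assms(2) by auto
  ultimately show ?thesis by (simp add: H_def)
qed

lemma ev_eqI: "(\<And>v. ev v F = ev v G) \<Longrightarrow> F = G"
  by (rule ps3_eqI) (rule ev_injective_degree, auto)

text \<open>
  The powers of the maximal ideal, see max_ideal_eq and ideal_prod_order_ge.
\<close>

definition order_ge :: "nat \<Rightarrow> ps3 set" where
  "order_ge n = {F. \<forall>i j k. i + j + k < n \<longrightarrow> coeff3 F i j k = 0}"

lemma order_ge_iff_ev: "F \<in> order_ge n \<longleftrightarrow> (\<forall>v. \<forall>d<n. fps_nth (ev v F) d = 0)"
proof
  assume "F \<in> order_ge n"
  then show "\<forall>v. \<forall>d<n. fps_nth (ev v F) d = 0"
    unfolding ev_nth order_ge_def by (auto intro!: sum.neutral simp: tripl_def)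
next
  assume *: "\<forall>v. \<forall>d<n. fps_nth (ev v F) d = 0"
  show "F \<in> order_ge n"
    unfolding order_ge_def
  proof (intro CollectI allI impI)
    fix i j k :: nat assume "i + j + k < n"
    with * show "coeff3 F i j k = 0"
      using ev_injective_degree[of F "i + j + k" 0 i j k] by simp
  qed
qed

lemma order_ge_mult: "F \<in> order_ge m \<Longrightarrow> G \<in> order_ge n \<Longrightarrow> F * G \<in> order_ge (m + n)"
  unfolding order_ge_iff_ev
proof (intro allI impI)
  fix v d assume *: "\<forall>v. \<forall>d<m. fps_nth (ev v F) d = 0" "\<forall>v. \<forall>d<n. fps_nth (ev v G) d = 0"
    and "d < m + n"
  then have "i < m \<or> d - i < n" if "i \<le> d" for i using that by linarith
  then have "fps_nth (ev v F) i * fps_nth (ev v G) (d - i) = 0" if "i \<le> d" for i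
    using * that by (metis mult_eq_0_iff)
  then show "fps_nth (ev v (F * G)) d = 0"
    unfolding ev_mult fps_mult_nth by (intro sum.neutral) auto
qed

lemma order_ge_linear:
  "0 \<in> order_ge n"
  "F \<in> order_ge n \<Longrightarrow> G \<in> order_ge n \<Longrightarrow> F + G \<in> order_ge n"
  "F \<in> order_ge n \<Longrightarrow> G \<in> order_ge n \<Longrightarrow> F - G \<in> order_ge n"
  "F \<in> order_ge n \<Longrightarrow> G * F \<in> order_ge n"
  using order_ge_mult[of G 0 F n] by (auto simp: order_ge_def)

lemma order_ge_mono: "m \<le> n \<Longrightarrow> order_ge n \<subseteq> order_ge m"
  by (auto simp: order_ge_def)

lemma vars_in_order_ge: "vars $ j \<in> order_ge 1"
  by (auto simp: order_ge_iff_ev)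

text \<open>
  Each monomial is divided by the first variable that occurs in it.
\<close>

lemma order_ge_Suc_cases:
  assumes "F \<in> order_ge (Suc n)"
  obtains A B C where "A \<in> order_ge n" "B \<in> order_ge n" "C \<in> order_ge n"
    "F = varX * A + varY * B + varZ * C"
proof
  define A where "A = mk_ps3 (\<lambda>i j k. coeff3 F (Suc i) j k)"
  define B where "B = mk_ps3 (\<lambda>i j k. if i = 0 then coeff3 F 0 (Suc j) k else 0)"
  define C where "C = mk_ps3 (\<lambda>i j k. if i = 0 \<and> j = 0 then coeff3 F 0 0 (Suc k) else 0)"
  show "A \<in> order_ge n" "B \<in> order_ge n" "C \<in> order_ge n"
    using assms by (auto simp: order_ge_def A_def B_def C_def)
  have "coeff3 F 0 0 0 = 0" using assms by (auto simp: order_ge_def)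
  then show "F = varX * A + varY * B + varZ * C"
    by (intro ps3_eqI) (auto simp: A_def B_def C_def)
qed

lemma coeff3_monomial_mult:
  "coeff3 (varX ^ a * varY ^ b * varZ ^ c * F) i j k =
     (if a \<le> i \<and> b \<le> j \<and> c \<le> k then coeff3 F (i - a) (j - b) (k - c) else 0)"
proof -
  have X: "coeff3 (varX ^ a * F) i j k = (if a \<le> i then coeff3 F (i - a) j k else 0)" for F i j k
    by (induction a arbitrary: i) (auto simp: mult.assoc)
  have Y: "coeff3 (varY ^ b * F) i j k = (if b \<le> j then coeff3 F i (j - b) k else 0)" for F i j k
    by (induction b arbitrary: j) (auto simp: mult.assoc)
  have Z: "coeff3 (varZ ^ c * F) i j k = (if c \<le> k then coeff3 F i j (k - c) else 0)" for F i j k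
    by (induction c arbitrary: k) (auto simp: mult.assoc)
  show ?thesis by (simp add: mult.assoc X Y Z)
qed

section \<open>Linear substitutions\<close>

lemma coeff3_mult_const3 [simp]: "coeff3 (F * const3 c) i j k = c * coeff3 F i j k"
  using coeff3_linear(5)[of c F] by (simp add: mult.commute)

definition lin_form :: "complex ^ 3 ^ 3 \<Rightarrow> 3 \<Rightarrow> ps3" where
  "lin_form A j = (\<Sum>i\<in>UNIV. const3 (A $ i $ j) * vars $ i)"

text \<open>
  Since a linear substitution preserves degrees, every coefficient of the result is a finite sum. The
  columns of A are the images of x, y, z; on points this is the action on row vectors, see ev_lin_subst.
\<close>

definition lin_subst :: "complex ^ 3 ^ 3 \<Rightarrow> ps3 \<Rightarrow> ps3" where
  "lin_subst A F = mk_ps3 (\<lambda>i j k. \<Sum>(a, b, c)\<in>tripl (i + j + k).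
     coeff3 F a b c * coeff3 (lin_form A 1 ^ a * lin_form A 2 ^ b * lin_form A 3 ^ c) i j k)"

lemma ev_lin_form: "ev v (lin_form A j) = fps_const ((v v* A) $ j) * fps_X"
  by (simp add: lin_form_def vector_matrix_mult_def sum_3 algebra_simps flip: fps_const_add fps_const_mult)

lemma ev_lin_subst [simp]: "ev v (lin_subst A F) = ev (v v* A) F"
proof (rule fps_ext)
  fix d
  let ?w = "v v* A"
  let ?L = "\<lambda>q. lin_form A 1 ^ fst q * lin_form A 2 ^ fst (snd q) * lin_form A 3 ^ snd (snd q)"
  have L: "fps_nth (ev v (?L q)) d = ?w$1 ^ fst q * ?w$2 ^ fst (snd q) * ?w$3 ^ snd (snd q)"
    if qd: "q \<in> tripl d" for q
  proof -
    obtain a b c where q: "q = (a, b, c)" and d: "d = a + b + c"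
      using qd by (auto simp: tripl_def)
    have "ev v (?L q) = fps_const (?w$1 ^ a * ?w$2 ^ b * ?w$3 ^ c) * fps_X ^ d"
      unfolding q d fst_conv snd_conv
      by (simp only: ev_mult ev_power ev_lin_form power_mult_distrib fps_const_power
          fps_const_mult[symmetric] power_add ac_simps)
    then show ?thesis by (simp add: q fps_X_power_iff)
  qed
  have "fps_nth (ev v (lin_subst A F)) d =
    (\<Sum>p\<in>tripl d. \<Sum>q\<in>tripl d. coeff3 F (fst q) (fst (snd q)) (snd (snd q)) *
       (coeff3 (?L q) (fst p) (fst (snd p)) (snd (snd p)) *
       (v$1 ^ fst p * v$2 ^ fst (snd p) * v$3 ^ snd (snd p))))"
    unfolding ev_nth
    by (rule sum.cong) (auto simp: lin_subst_def sum_distrib_right split_def mult.assoc tripl_def)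
  also have "\<dots> = (\<Sum>q\<in>tripl d. \<Sum>p\<in>tripl d. coeff3 F (fst q) (fst (snd q)) (snd (snd q)) *
       (coeff3 (?L q) (fst p) (fst (snd p)) (snd (snd p)) *
       (v$1 ^ fst p * v$2 ^ fst (snd p) * v$3 ^ snd (snd p))))"
    by (rule sum.swap)
  also have "\<dots> = (\<Sum>q\<in>tripl d. coeff3 F (fst q) (fst (snd q)) (snd (snd q)) *
       fps_nth (ev v (?L q)) d)"
    by (simp add: ev_nth[of v _ d] split_def sum_distrib_left del: ev_mult)
  also have "\<dots> = fps_nth (ev ?w F) d"
    unfolding ev_nth[of ?w] split_def by (rule sum.cong) (simp_all only: L)
  finally show "fps_nth (ev v (lin_subst A F)) d = fps_nth (ev ?w F) d" .
qed

lemma lin_subst_hom [simp]: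
  "lin_subst A (F + G) = lin_subst A F + lin_subst A G"
  "lin_subst A (F - G) = lin_subst A F - lin_subst A G"
  "lin_subst A (F * G) = lin_subst A F * lin_subst A G"
  "lin_subst A (const3 c) = const3 c"
  "lin_subst A 0 = 0"
  "lin_subst A 1 = 1"
  by (rule ev_eqI, simp)+

lemma lin_subst_vars [simp]: "lin_subst A (vars $ j) = lin_form A j"
  by (rule ev_eqI) (simp add: ev_lin_form)

lemma lin_subst_lin_subst: "lin_subst B (lin_subst A F) = lin_subst (B ** A) F"
  by (rule ev_eqI) (simp add: vector_matrix_mul_assoc)

lemma vector_matrix_mat: "v v* mat c = c *s (v :: complex ^ 'n)"
  by (vector vector_matrix_mult_def mat_def) (simp add: if_distrib if_distribR sum.delta cong: if_cong)

lemma lin_subst_id [simp]: "lin_subst (mat 1) F = F"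
  by (rule ev_eqI) simp

lemma lin_subst_scale: "lin_subst (mat c) F = scale3 c F"
proof (rule ev_eqI, rule fps_ext)
  fix v d
  show "fps_nth (ev v (lin_subst (mat c) F)) d = fps_nth (ev v (scale3 c F)) d"
    unfolding ev_lin_subst ev_nth
    by (rule sum.cong) (auto simp: vector_matrix_mat scale3_def power_mult_distrib power_add mult_ac)
qed

lemma lin_subst_inverse:
  assumes "A ** B = mat 1"
  shows "lin_subst A (lin_subst B F) = F"
  using assms by (simp add: lin_subst_lin_subst)

lemma lin_subst_order_ge: "F \<in> order_ge n \<Longrightarrow> lin_subst A F \<in> order_ge n"
  by (simp add: order_ge_iff_ev)

section \<open>Ideals of the power series ring\<close>

lemma ps3_ring_simps [simp]:
  "carrier ps3_ring = UNIV" "F \<otimes>\<^bsub>ps3_ring\<^esub> G = F * G" "F \<oplus>\<^bsub>ps3_ring\<^esub> G = F + G"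
  "\<one>\<^bsub>ps3_ring\<^esub> = 1" "\<zero>\<^bsub>ps3_ring\<^esub> = 0"
  by (simp_all add: ring_of_type_algebra_def)

interpretation ps3: cring "ps3_ring"
  by (rule cring_from_type_algebra)

lemma a_inv_ps3 [simp]: "\<ominus>\<^bsub>ps3_ring\<^esub> F = - F"
  using ps3.minus_equality[of "- F" F] by simp

lemma ideal_ps3I:
  assumes "0 \<in> I" "\<And>F G. F \<in> I \<Longrightarrow> G \<in> I \<Longrightarrow> F + G \<in> I" "\<And>F G. F \<in> I \<Longrightarrow> G * F \<in> I"
  shows "ideal I ps3_ring"
proof (rule idealI)
  show "subgroup I (add_monoid ps3_ring)"
  proof (rule ps3.add.subgroupI)
    show "\<ominus>\<^bsub>ps3_ring\<^esub> a \<in> I" if "a \<in> I" for a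
      using assms(3)[OF that, of "-1"] by simp
  qed (use assms in auto)
qed (use assms in \<open>auto simp: mult.commute ps3.ring_axioms\<close>)

lemma ideal_ps3D:
  assumes "ideal I ps3_ring"
  shows "0 \<in> I" "F \<in> I \<Longrightarrow> G \<in> I \<Longrightarrow> F + G \<in> I" "F \<in> I \<Longrightarrow> G * F \<in> I" "F \<in> I \<Longrightarrow> F * G \<in> I"
    "F \<in> I \<Longrightarrow> G \<in> I \<Longrightarrow> F - G \<in> I" "F \<in> I \<Longrightarrow> - F \<in> I"
proof -
  interpret ideal I ps3_ring by fact
  show zero: "0 \<in> I" and add: "F \<in> I \<Longrightarrow> G \<in> I \<Longrightarrow> F + G \<in> I" for F G
    using additive_subgroup.zero_closed[OF is_additive_subgroup]
      additive_subgroup.a_closed[OF is_additive_subgroup] by auto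
  show mult: "F \<in> I \<Longrightarrow> G * F \<in> I" and "F \<in> I \<Longrightarrow> F * G \<in> I" for F G
    using I_l_closed[of F G] I_r_closed[of F G] by auto
  show neg: "F \<in> I \<Longrightarrow> - F \<in> I" for F using mult[of F "-1"] by simp
  show "F \<in> I \<Longrightarrow> G \<in> I \<Longrightarrow> F - G \<in> I" using add[of F "- G"] neg[of G] by simp
qed

lemma ideal_ps3_sum:
  "ideal I ps3_ring \<Longrightarrow> (\<And>x. x \<in> S \<Longrightarrow> f x \<in> I) \<Longrightarrow> sum f S \<in> I"
  by (induction S rule: infinite_finite_induct) (auto intro: ideal_ps3D)

lemma Idl_ideal: "ideal (Idl\<^bsub>ps3_ring\<^esub> S) ps3_ring"
  by (rule ps3.genideal_ideal) simp

lemma Idl_self: "S \<subseteq> Idl\<^bsub>ps3_ring\<^esub> S"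
  by (rule ps3.genideal_self) simp

lemma Idl_minimal: "ideal I ps3_ring \<Longrightarrow> S \<subseteq> I \<Longrightarrow> Idl\<^bsub>ps3_ring\<^esub> S \<subseteq> I"
  by (rule ps3.genideal_minimal)

lemma Idl_of_ideal: "ideal I ps3_ring \<Longrightarrow> Idl\<^bsub>ps3_ring\<^esub> I = I"
  using Idl_minimal[of I I] Idl_self[of I] by auto

lemma ideal_order_ge: "ideal (order_ge n) ps3_ring"
  by (rule ideal_ps3I) (auto intro: order_ge_linear)

lemma ideal_lin_subst_preimage:
  assumes "ideal I ps3_ring"
  shows "ideal {F. lin_subst A F \<in> I} ps3_ring"
  by (rule ideal_ps3I) (auto intro: ideal_ps3D[OF assms])

abbreviation monom3 :: "nat \<Rightarrow> nat \<Rightarrow> nat \<Rightarrow> ps3" where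
  "monom3 a b c \<equiv> varX ^ a * varY ^ b * varZ ^ c"

lemma coeff3_monom3:
  "coeff3 (monom3 a b c) i j k = (if i = a \<and> j = b \<and> k = c then 1 else 0)"
  using coeff3_monomial_mult[of a b c 1 i j k] by (auto simp: coeff3_one)

text \<open>
  The factor H is there for the induction: in each step a variable moves from F to H.
\<close>

lemma order_ge_mult_in_ideal:
  assumes "ideal I ps3_ring"
  shows "F \<in> order_ge n \<Longrightarrow> (\<And>a b c. a + b + c = n \<Longrightarrow> H * monom3 a b c \<in> I) \<Longrightarrow> H * F \<in> I"
proof (induction n arbitrary: F H)
  case 0
  then show ?case using ideal_ps3D(4)[OF assms] by simp
next
  case (Suc n)
  obtain A B C where *: "A \<in> order_ge n" "B \<in> order_ge n" "C \<in> order_ge n"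
    "F = varX * A + varY * B + varZ * C"
    using order_ge_Suc_cases[OF Suc.prems(1)] .
  have "H * varX * A \<in> I"
  proof (rule Suc.IH[OF *(1)])
    show "H * varX * monom3 a b c \<in> I" if "a + b + c = n" for a b c
      using Suc.prems(2)[of "Suc a" b c] that by (simp add: mult_ac)
  qed
  moreover have "H * varY * B \<in> I"
  proof (rule Suc.IH[OF *(2)])
    show "H * varY * monom3 a b c \<in> I" if "a + b + c = n" for a b c
      using Suc.prems(2)[of a "Suc b" c] that by (simp add: mult_ac)
  qed
  moreover have "H * varZ * C \<in> I"
  proof (rule Suc.IH[OF *(3)])
    show "H * varZ * monom3 a b c \<in> I" if "a + b + c = n" for a b c
      using Suc.prems(2)[of a b "Suc c"] that by (simp add: mult_ac)
  qed
  ultimately show ?case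
    by (simp add: *(4) distrib_left mult.assoc[symmetric] ideal_ps3D(2)[OF assms])
qed

lemma order_ge_subset_ideal:
  assumes "ideal I ps3_ring" "\<And>a b c. a + b + c = n \<Longrightarrow> monom3 a b c \<in> I"
  shows "order_ge n \<subseteq> I"
  using order_ge_mult_in_ideal[OF assms(1), of _ n 1] assms(2) by auto

lemma max_ideal_eq: "max_ideal = order_ge 1"
proof
  show "max_ideal \<subseteq> order_ge 1"
    unfolding max_ideal_def using vars_in_order_ge[of 1] vars_in_order_ge[of 2] vars_in_order_ge[of 3]
    by (intro Idl_minimal ideal_order_ge) auto
  have *: "{varX, varY, varZ} \<subseteq> max_ideal" unfolding max_ideal_def by (rule Idl_self)
  show "order_ge 1 \<subseteq> max_ideal"
  proof (rule order_ge_subset_ideal)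
    show "ideal max_ideal ps3_ring" unfolding max_ideal_def by (rule Idl_ideal)
    fix a b c :: nat assume "a + b + c = 1"
    then have "(a, b, c) \<in> {(1, 0, 0), (0, 1, 0), (0, 0, 1)}" by auto
    with * show "monom3 a b c \<in> max_ideal" by auto
  qed
qed

lemma ideal_prod_order_ge: "ideal_prod ps3_ring (order_ge 1) (order_ge n) = order_ge (Suc n)"
proof
  show "ideal_prod ps3_ring (order_ge 1) (order_ge n) \<subseteq> order_ge (Suc n)"
  proof
    fix F assume "F \<in> ideal_prod ps3_ring (order_ge 1) (order_ge n)"
    then show "F \<in> order_ge (Suc n)"
    proof induction
      case (prod i j) then show ?case using order_ge_mult[of i 1 j n] by simp
    qed (simp add: order_ge_linear)
  qed
  show "order_ge (Suc n) \<subseteq> ideal_prod ps3_ring (order_ge 1) (order_ge n)"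
  proof
    fix F assume "F \<in> order_ge (Suc n)"
    then obtain A B C where *: "A \<in> order_ge n" "B \<in> order_ge n" "C \<in> order_ge n"
      "F = varX * A + varY * B + varZ * C"
      by (rule order_ge_Suc_cases)
    have "vars $ i * G \<in> ideal_prod ps3_ring (order_ge 1) (order_ge n)" if "G \<in> order_ge n" for i G
      using ideal_prod.prod[of "vars $ i" "order_ge 1" G "order_ge n" ps3_ring] that vars_in_order_ge
      by simp
    from this[of A 1] this[of B 2] this[of C 3] *
    show "F \<in> ideal_prod ps3_ring (order_ge 1) (order_ge n)"
      using ideal_prod.sum[of _ ps3_ring "order_ge 1" "order_ge n"] by simp
  qed
qed

section \<open>The ideals of the family\<close>

definition grad :: "complex \<Rightarrow> ps3 ^ 3" where
  "grad t = vector [3 * varX\<^sup>2 + const3 t * varY * varZ, 3 * varY\<^sup>2 + const3 t * varX * varZ,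
     3 * varZ\<^sup>2 + const3 t * varX * varY]"

lemma grad_nth [simp]:
  "grad t $ 1 = 3 * varX\<^sup>2 + const3 t * varY * varZ"
  "grad t $ 2 = 3 * varY\<^sup>2 + const3 t * varX * varZ"
  "grad t $ 3 = 3 * varZ\<^sup>2 + const3 t * varX * varY"
  by (simp_all add: grad_def)

lemma f_E6_monom3:
  "f_E6 t = monom3 3 0 0 + monom3 0 3 0 + monom3 0 0 3 + const3 t * monom3 1 1 1"
  by (simp add: f_E6_def mult.assoc)

lemma grad_monom3:
  "grad t $ 1 = const3 3 * monom3 2 0 0 + const3 t * monom3 0 1 1"
  "grad t $ 2 = const3 3 * monom3 0 2 0 + const3 t * monom3 1 0 1"
  "grad t $ 3 = const3 3 * monom3 0 0 2 + const3 t * monom3 1 1 0"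
  by (simp_all add: const3_numeral mult.assoc)

lemma partials_f_E6:
  "partial_x (f_E6 t) = grad t $ 1" "partial_y (f_E6 t) = grad t $ 2" "partial_z (f_E6 t) = grad t $ 3"
  by (rule ps3_eqI; simp only: grad_monom3 f_E6_monom3 partial_x_def partial_y_def partial_z_def
      coeff3_mk coeff3_linear coeff3_monom3; auto)+

lemma jacobian_ideal_f_E6: "jacobian_ideal (f_E6 t) = Idl\<^bsub>ps3_ring\<^esub> (range (($) (grad t)))"
  by (simp add: jacobian_ideal_def partials_f_E6 UNIV_3 del: grad_nth)

text \<open>
  For t^3 \<noteq> -27 the cubic forms modulo the Jacobian ideal have dimension one, and lam t spans the dual
  space. The components of eta t q are the values of lam t on x q, y q, z q (compare lam_mult); on quadratic
  forms they vanish exactly on the span of the partial derivatives (sub_gradient_order_ge_3).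
\<close>

definition eta :: "complex \<Rightarrow> ps3 \<Rightarrow> complex ^ 3" where
  "eta t F = vector [3 * coeff3 F 0 1 1 - t * coeff3 F 2 0 0, 3 * coeff3 F 1 0 1 - t * coeff3 F 0 2 0,
     3 * coeff3 F 1 1 0 - t * coeff3 F 0 0 2]"

lemma eta_nth [simp]:
  "eta t F $ 1 = 3 * coeff3 F 0 1 1 - t * coeff3 F 2 0 0"
  "eta t F $ 2 = 3 * coeff3 F 1 0 1 - t * coeff3 F 0 2 0"
  "eta t F $ 3 = 3 * coeff3 F 1 1 0 - t * coeff3 F 0 0 2"
  by (simp_all add: eta_def)

definition lam :: "complex \<Rightarrow> ps3 \<Rightarrow> complex" where
  "lam t F = 3 * coeff3 F 1 1 1 - t * (coeff3 F 3 0 0 + coeff3 F 0 3 0 + coeff3 F 0 0 3)"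

lemma coeff3_mult_le1:
  "coeff3 (F * G) 0 0 0 = coeff3 F 0 0 0 * coeff3 G 0 0 0"
  "coeff3 (F * G) 1 0 0 = coeff3 F 0 0 0 * coeff3 G 1 0 0 + coeff3 F 1 0 0 * coeff3 G 0 0 0"
  "coeff3 (F * G) 0 1 0 = coeff3 F 0 0 0 * coeff3 G 0 1 0 + coeff3 F 0 1 0 * coeff3 G 0 0 0"
  "coeff3 (F * G) 0 0 1 = coeff3 F 0 0 0 * coeff3 G 0 0 1 + coeff3 F 0 0 1 * coeff3 G 0 0 0"
  by (simp_all add: coeff3_mult)

lemma coeff3_mult_square:
  "coeff3 (F * G) 2 0 0 = coeff3 F 0 0 0 * coeff3 G 2 0 0 + coeff3 F 2 0 0 * coeff3 G 0 0 0 +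
     coeff3 F 1 0 0 * coeff3 G 1 0 0"
  "coeff3 (F * G) 0 2 0 = coeff3 F 0 0 0 * coeff3 G 0 2 0 + coeff3 F 0 2 0 * coeff3 G 0 0 0 +
     coeff3 F 0 1 0 * coeff3 G 0 1 0"
  "coeff3 (F * G) 0 0 2 = coeff3 F 0 0 0 * coeff3 G 0 0 2 + coeff3 F 0 0 2 * coeff3 G 0 0 0 +
     coeff3 F 0 0 1 * coeff3 G 0 0 1"
  by (simp_all add: coeff3_mult numeral_2_eq_2)

lemma eta_mult:
  "eta t (F * G) $ 1 = coeff3 F 0 0 0 * eta t G $ 1 + coeff3 G 0 0 0 * eta t F $ 1 +
     3 * (coeff3 F 0 1 0 * coeff3 G 0 0 1 + coeff3 F 0 0 1 * coeff3 G 0 1 0) -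
     t * (coeff3 F 1 0 0 * coeff3 G 1 0 0)"
  "eta t (F * G) $ 2 = coeff3 F 0 0 0 * eta t G $ 2 + coeff3 G 0 0 0 * eta t F $ 2 +
     3 * (coeff3 F 1 0 0 * coeff3 G 0 0 1 + coeff3 F 0 0 1 * coeff3 G 1 0 0) -
     t * (coeff3 F 0 1 0 * coeff3 G 0 1 0)"
  "eta t (F * G) $ 3 = coeff3 F 0 0 0 * eta t G $ 3 + coeff3 G 0 0 0 * eta t F $ 3 +
     3 * (coeff3 F 1 0 0 * coeff3 G 0 1 0 + coeff3 F 0 1 0 * coeff3 G 1 0 0) -
     t * (coeff3 F 0 0 1 * coeff3 G 0 0 1)"
  by (simp_all add: coeff3_mult numeral_2_eq_2 algebra_simps)

lemma lam_mult:
  "lam t (F * G) = coeff3 F 0 0 0 * lam t G + coeff3 G 0 0 0 * lam t F +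
     (coeff3 F 1 0 0 * eta t G $ 1 + coeff3 F 0 1 0 * eta t G $ 2 + coeff3 F 0 0 1 * eta t G $ 3) +
     (coeff3 G 1 0 0 * eta t F $ 1 + coeff3 G 0 1 0 * eta t F $ 2 + coeff3 G 0 0 1 * eta t F $ 3)"
  by (simp add: coeff3_mult lam_def numeral_2_eq_2 numeral_3_eq_3 algebra_simps)

lemma eta_lam_linear [simp]:
  "eta t 0 = 0" "eta t (F + G) = eta t F + eta t G" "eta t (const3 c * F) = c *s eta t F"
  "lam t 0 = 0" "lam t (F + G) = lam t F + lam t G" "lam t (const3 c * F) = c * lam t F"
  by (simp_all add: vec_eq_iff forall_3 lam_def algebra_simps)

text \<open>
  Descriptions of the ideals J and m J by linear conditions on coefficients, see jacobian_ideal_eq and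
  ideal_prod_jac_set.
\<close>

definition jac_set :: "complex \<Rightarrow> ps3 set" where
  "jac_set t = {F \<in> order_ge 2. eta t F = 0 \<and> lam t F = 0}"

definition mjac_set :: "complex \<Rightarrow> ps3 set" where
  "mjac_set t = {F \<in> order_ge 3. lam t F = 0}"

lemma order_ge_coeff3: "F \<in> order_ge n \<Longrightarrow> i + j + k < n \<Longrightarrow> coeff3 F i j k = 0"
  by (simp add: order_ge_def)

lemma ideal_jac_set: "ideal (jac_set t) ps3_ring"
proof (rule ideal_ps3I)
  fix F G assume "F \<in> jac_set t"
  then show "G * F \<in> jac_set t"
    unfolding jac_set_def
    by (auto simp: order_ge_linear lam_mult vec_eq_iff forall_3 eta_mult order_ge_coeff3[of F 2]
        simp del: eta_nth)
qed (auto simp: jac_set_def order_ge_linear)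

lemma ideal_mjac_set: "ideal (mjac_set t) ps3_ring"
proof (rule ideal_ps3I)
  fix F G assume "F \<in> mjac_set t"
  then show "G * F \<in> mjac_set t"
    unfolding mjac_set_def
    by (auto simp: order_ge_linear lam_mult order_ge_coeff3[of F 3])
qed (auto simp: mjac_set_def order_ge_linear)

text \<open>
  Modulo the ideal 3 x^2 y = - t y^2 z, 3 y^2 z = - t z^2 x and 3 z^2 x = - t x^2 y. Together these give
  (27 + t^3) x^2 y = 0.
\<close>

lemma cube_relation:
  assumes "ideal K ps3_ring" "t \<in> objE6"
    and "y * (3 * x\<^sup>2 + const3 t * y * z) \<in> K" "z * (3 * y\<^sup>2 + const3 t * x * z) \<in> K"
      "x * (3 * z\<^sup>2 + const3 t * x * y) \<in> K"
  shows "x\<^sup>2 * y \<in> K"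
proof -
  let ?c = "const3 t" and ?e = "27 + t ^ 3"
  have e: "?e \<noteq> 0" using assms(2) by (auto simp: objE6_def add_eq_0_iff)
  have "9 * (y * (3 * x\<^sup>2 + ?c * y * z)) - 3 * ?c * (z * (3 * y\<^sup>2 + ?c * x * z)) +
      ?c\<^sup>2 * (x * (3 * z\<^sup>2 + ?c * x * y)) \<in> K" (is "?F \<in> K")
    by (intro ideal_ps3D(2,5)[OF assms(1)]; rule ideal_ps3D(3)[OF assms(1)]; rule assms)
  moreover have "?F = (27 + ?c ^ 3) * (x\<^sup>2 * y)"
    by Groebner_Basis.algebra
  moreover have "27 + ?c ^ 3 = const3 ?e" by (simp add: power3_eq_cube const3_numeral)
  ultimately have "const3 (1 / ?e) * (const3 ?e * (x\<^sup>2 * y)) \<in> K"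
    by (intro ideal_ps3D(3)[OF assms(1), of "const3 ?e * (x\<^sup>2 * y)"]) (simp only:)
  moreover have "const3 (1 / ?e) * const3 ?e = 1"
    using e by (simp del: const3_hom(3) flip: const3_hom(6))
  ultimately show ?thesis by (simp only: mult.assoc[symmetric] mult_1_left)
qed

lemma exponents_sum_4:
  fixes a b c :: nat
  assumes "a + b + c = 4"
  shows "(a, b, c) \<in> {(4,0,0), (0,4,0), (0,0,4), (3,1,0), (3,0,1), (2,2,0), (2,1,1), (2,0,2),
    (1,3,0), (0,3,1), (0,2,2), (1,2,1), (1,0,3), (0,1,3), (1,1,2)}"
proof -
  have "a \<in> {0, 1, 2, 3, 4}" "b \<in> {0, 1, 2, 3, 4}" "c = 4 - a - b" using assms by auto
  then show ?thesis using assms by (elim insertE emptyE) simp_all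
qed

lemma exponents_sum_3:
  fixes a b c :: nat
  assumes "a + b + c = 3"
  shows "(a, b, c) \<in> {(3,0,0), (0,3,0), (0,0,3), (2,1,0), (2,0,1), (1,2,0), (0,2,1),
    (1,0,2), (0,1,2), (1,1,1)}"
proof -
  have "a \<in> {0, 1, 2, 3}" "b \<in> {0, 1, 2, 3}" "c = 3 - a - b" using assms by auto
  then show ?thesis using assms by (elim insertE emptyE) simp_all
qed

lemma exponents_sum_2:
  fixes a b c :: nat
  assumes "a + b + c = 2"
  shows "(a, b, c) \<in> {(2,0,0), (0,2,0), (0,0,2), (1,1,0), (1,0,1), (0,1,1)}"
proof -
  have "a \<in> {0, 1, 2}" "b \<in> {0, 1, 2}" "c = 2 - a - b" using assms by auto
  then show ?thesis using assms by (elim insertE emptyE) simp_all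
qed

text \<open>
  A monomial of degree four is divisible by the square of a variable times another variable, unless it is
  a fourth power; a fourth power is reduced to the other monomials by a partial derivative.
\<close>

lemma quartics_in_ideal:
  assumes K: "ideal K ps3_ring"
    and S: "\<And>l. vars $ l * (varX\<^sup>2 * varY) \<in> K" "\<And>l. vars $ l * (varX\<^sup>2 * varZ) \<in> K"
      "\<And>l. vars $ l * (varY\<^sup>2 * varX) \<in> K" "\<And>l. vars $ l * (varY\<^sup>2 * varZ) \<in> K"
      "\<And>l. vars $ l * (varZ\<^sup>2 * varX) \<in> K" "\<And>l. vars $ l * (varZ\<^sup>2 * varY) \<in> K"
    and T: "\<And>i. vars $ i * (vars $ i * grad t $ i) \<in> K"
  shows "order_ge 4 \<subseteq> K"
proof (rule order_ge_subset_ideal[OF K])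
  have third: "G \<in> K" if "3 * G \<in> K" for G
  proof -
    have "const3 (1/3) * (const3 3 * G) \<in> K"
      using ideal_ps3D(3)[OF K that] by (simp add: const3_numeral)
    moreover have "const3 (1/3) * (const3 3 * G) = G"
      by (simp flip: mult.assoc const3_hom(6))
    ultimately show ?thesis by simp
  qed
  have X: "varX ^ 4 \<in> K"
  proof (rule third)
    have "varX * (varX * grad t $ 1) - const3 t * (varZ * (varX\<^sup>2 * varY)) \<in> K"
      using T[of 1] ideal_ps3D(3)[OF K S(1)[of 3]] by (intro ideal_ps3D(5)[OF K]) (simp_all del: grad_nth)
    then show "3 * varX ^ 4 \<in> K" by (simp add: algebra_simps power2_eq_square power4_eq_xxxx)
  qed
  have Y: "varY ^ 4 \<in> K"
  proof (rule third)
    have "varY * (varY * grad t $ 2) - const3 t * (varZ * (varY\<^sup>2 * varX)) \<in> K"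
      using T[of 2] ideal_ps3D(3)[OF K S(3)[of 3]] by (intro ideal_ps3D(5)[OF K]) (simp_all del: grad_nth)
    then show "3 * varY ^ 4 \<in> K" by (simp add: algebra_simps power2_eq_square power4_eq_xxxx)
  qed
  have Z: "varZ ^ 4 \<in> K"
  proof (rule third)
    have "varZ * (varZ * grad t $ 3) - const3 t * (varY * (varZ\<^sup>2 * varX)) \<in> K"
      using T[of 3] ideal_ps3D(3)[OF K S(5)[of 2]] by (intro ideal_ps3D(5)[OF K]) (simp_all del: grad_nth)
    then show "3 * varZ ^ 4 \<in> K" by (simp add: algebra_simps power2_eq_square power4_eq_xxxx)
  qed
  fix a b c :: nat assume "a + b + c = 4"
  then have "(a, b, c) \<in> {(4,0,0), (0,4,0), (0,0,4), (3,1,0), (3,0,1), (2,2,0), (2,1,1), (2,0,2),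
    (1,3,0), (0,3,1), (0,2,2), (1,2,1), (1,0,3), (0,1,3), (1,1,2)}"
    by (rule exponents_sum_4)
  moreover have "monom3 4 0 0 \<in> K" "monom3 0 4 0 \<in> K" "monom3 0 0 4 \<in> K"
    using X Y Z by simp_all
  moreover have "monom3 3 1 0 \<in> K" "monom3 2 2 0 \<in> K" "monom3 2 1 1 \<in> K"
    using S(1)[of 1] S(1)[of 2] S(1)[of 3]
    by (simp_all add: power2_eq_square power3_eq_cube mult_ac)
  moreover have "monom3 3 0 1 \<in> K" "monom3 2 0 2 \<in> K"
    using S(2)[of 1] S(2)[of 3] by (simp_all add: power2_eq_square power3_eq_cube mult_ac)
  moreover have "monom3 1 3 0 \<in> K" "monom3 1 2 1 \<in> K"
    using S(3)[of 2] S(3)[of 3] by (simp_all add: power2_eq_square power3_eq_cube mult_ac)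
  moreover have "monom3 0 3 1 \<in> K" "monom3 0 2 2 \<in> K"
    using S(4)[of 2] S(4)[of 3] by (simp_all add: power2_eq_square power3_eq_cube mult_ac)
  moreover have "monom3 1 0 3 \<in> K" "monom3 1 1 2 \<in> K"
    using S(5)[of 3] S(5)[of 2] by (simp_all add: power2_eq_square power3_eq_cube mult_ac)
  moreover have "monom3 0 1 3 \<in> K"
    using S(6)[of 3] by (simp_all add: power2_eq_square power3_eq_cube mult_ac)
  ultimately show "monom3 a b c \<in> K"
    by (elim insertE emptyE) (simp_all only: prod.inject)
qed

text \<open>
  A cubic form in the kernel of lam t is a combination of the monomials of type x^2 y and of the products
  x (3 x^2 + t y z), because the coefficients of the cubes determine the coefficient of x y z.
\<close>

lemma mjac_set_subset_ideal:
  assumes K: "ideal K ps3_ring" and t: "t \<in> objE6"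
    and gen: "\<And>i j. vars $ i * (grad t $ j) \<in> K"
  shows "mjac_set t \<subseteq> K"
proof
  note D = ideal_ps3D[OF K]
  have S: "varX\<^sup>2 * varY \<in> K" "varX\<^sup>2 * varZ \<in> K" "varY\<^sup>2 * varX \<in> K" "varY\<^sup>2 * varZ \<in> K"
    "varZ\<^sup>2 * varX \<in> K" "varZ\<^sup>2 * varY \<in> K"
    using cube_relation[OF K t, of varX varY varZ] cube_relation[OF K t, of varX varZ varY]
      cube_relation[OF K t, of varY varX varZ] cube_relation[OF K t, of varY varZ varX]
      cube_relation[OF K t, of varZ varX varY] cube_relation[OF K t, of varZ varY varX]
      gen[of 1 1] gen[of 1 2] gen[of 1 3] gen[of 2 1] gen[of 2 2] gen[of 2 3] gen[of 3 1] gen[of 3 2]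
      gen[of 3 3]
    by (simp_all add: mult_ac)
  have Q: "order_ge 4 \<subseteq> K"
    by (rule quartics_in_ideal[OF K]) (use S gen in \<open>auto intro: D(3)\<close>)
  fix F assume F: "F \<in> mjac_set t"
  let ?G = "const3 (coeff3 F 2 1 0) * (varX\<^sup>2 * varY) + const3 (coeff3 F 2 0 1) * (varX\<^sup>2 * varZ) +
    const3 (coeff3 F 1 2 0) * (varY\<^sup>2 * varX) + const3 (coeff3 F 0 2 1) * (varY\<^sup>2 * varZ) +
    const3 (coeff3 F 1 0 2) * (varZ\<^sup>2 * varX) + const3 (coeff3 F 0 1 2) * (varZ\<^sup>2 * varY) +
    const3 (coeff3 F 3 0 0 / 3) * (varX * grad t $ 1) + const3 (coeff3 F 0 3 0 / 3) * (varY * grad t $ 2) +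
    const3 (coeff3 F 0 0 3 / 3) * (varZ * grad t $ 3)"
  have G: "?G \<in> K"
    using S gen[of 1 1] gen[of 2 2] gen[of 3 3] by - (intro D(2); rule D(3); simp del: grad_nth)
  have *: "varX\<^sup>2 * varY = monom3 2 1 0" "varX\<^sup>2 * varZ = monom3 2 0 1" "varY\<^sup>2 * varX = monom3 1 2 0"
    "varY\<^sup>2 * varZ = monom3 0 2 1" "varZ\<^sup>2 * varX = monom3 1 0 2" "varZ\<^sup>2 * varY = monom3 0 1 2"
    "varX * grad t $ 1 = const3 3 * monom3 3 0 0 + const3 t * monom3 1 1 1"
    "varY * grad t $ 2 = const3 3 * monom3 0 3 0 + const3 t * monom3 1 1 1"
    "varZ * grad t $ 3 = const3 3 * monom3 0 0 3 + const3 t * monom3 1 1 1"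
    by (simp_all add: const3_numeral power2_eq_square power3_eq_cube algebra_simps)
  have "3 * coeff3 F 1 1 1 = 3 * (coeff3 F 3 0 0 / 3 * t + coeff3 F 0 3 0 / 3 * t + coeff3 F 0 0 3 / 3 * t)"
    using F by (simp add: mjac_set_def lam_def distrib_left mult.commute)
  then have l: "coeff3 F 1 1 1 = coeff3 F 3 0 0 / 3 * t + coeff3 F 0 3 0 / 3 * t + coeff3 F 0 0 3 / 3 * t"
    by (simp only: mult_cancel_left) simp
  have "F - ?G \<in> order_ge 4"
    unfolding order_ge_def
  proof (intro CollectI allI impI)
    fix i j k :: nat assume ijk: "i + j + k < 4"
    show "coeff3 (F - ?G) i j k = 0"
    proof (cases "i + j + k < 3")
      case True
      then have m0: "coeff3 (monom3 a b c) i j k = 0" if "a + b + c = 3" for a b c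
        using that by (auto simp only: coeff3_monom3 split: if_split)
      have m: "coeff3 (monom3 2 1 0) i j k = 0" "coeff3 (monom3 2 0 1) i j k = 0" "coeff3 (monom3 1 2 0) i j k = 0" "coeff3 (monom3 0 2 1) i j k = 0" "coeff3 (monom3 1 0 2) i j k = 0" "coeff3 (monom3 0 1 2) i j k = 0" "coeff3 (monom3 3 0 0) i j k = 0" "coeff3 (monom3 0 3 0) i j k = 0" "coeff3 (monom3 0 0 3) i j k = 0" "coeff3 (monom3 1 1 1) i j k = 0"
        by (rule m0, simp)+
      have "coeff3 F i j k = 0"
        using F True by (auto simp: mjac_set_def order_ge_coeff3)
      then show ?thesis
        unfolding * by (simp only: coeff3_linear m) simp
    next
      case False
      with ijk have "(i, j, k) \<in> {(3,0,0), (0,3,0), (0,0,3), (2,1,0), (2,0,1), (1,2,0), (0,2,1),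
        (1,0,2), (0,1,2), (1,1,1)}" by (intro exponents_sum_3) simp
      then show ?thesis
        unfolding * using l
        by (elim insertE emptyE; clarify; simp only: coeff3_linear coeff3_monom3; simp)
    qed
  qed
  then have "F - ?G \<in> K" using Q by blast
  then have "F - ?G + ?G \<in> K" using G by (rule D(2))
  then show "F \<in> K" by simp
qed

text \<open>
  The members of the Hesse pencil as functions on points.
\<close>

definition cubic :: "complex \<Rightarrow> complex \<Rightarrow> complex ^ 3 \<Rightarrow> complex" where
  "cubic a b v = a * (v$1 ^ 3 + v$2 ^ 3 + v$3 ^ 3) + b * (v$1 * v$2 * v$3)"

definition cubic_grad :: "complex \<Rightarrow> complex ^ 3 \<Rightarrow> complex ^ 3" where
  "cubic_grad t v = vector [3 * v$1 ^ 2 + t * v$2 * v$3, 3 * v$2 ^ 2 + t * v$1 * v$3,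
     3 * v$3 ^ 2 + t * v$1 * v$2]"

lemma ev_f_E6: "ev v (f_E6 t) = fps_const (cubic 1 t v) * fps_X ^ 3"
  unfolding f_E6_def cubic_def
  by (simp add: power3_eq_cube algebra_simps flip: fps_const_mult fps_const_add)

lemma ev_grad: "ev v (grad t $ j) = fps_const (cubic_grad t v $ j) * fps_X\<^sup>2"
proof -
  have "ev v 3 = fps_const 3" using ev_const[of v 3] by (simp add: const3_numeral)
  then show ?thesis
    using exhaust_3[of j]
    by (auto simp: cubic_grad_def power2_eq_square algebra_simps
        simp flip: fps_const_mult fps_const_add)
qed

lemma grad_in_jac_set: "grad t $ j \<in> jac_set t"
proof -
  have "grad t $ j \<in> order_ge 2"
    by (auto simp: order_ge_iff_ev ev_grad fps_X_power_iff simp del: grad_nth)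
  moreover have "eta t (grad t $ j) = 0" "lam t (grad t $ j) = 0"
    using exhaust_3[of j]
    by (elim disjE; clarify; simp only: vec_eq_iff forall_3 eta_nth lam_def grad_monom3 coeff3_linear
        coeff3_monom3; simp)+
  ultimately show ?thesis by (simp add: jac_set_def del: grad_nth)
qed

lemma sub_gradient_order_ge_3:
  assumes F2: "F \<in> order_ge 2" and eta: "eta t F = 0"
  shows "F - (const3 (coeff3 F 2 0 0 / 3) * grad t $ 1 + const3 (coeff3 F 0 2 0 / 3) * grad t $ 2 +
      const3 (coeff3 F 0 0 2 / 3) * grad t $ 3) \<in> order_ge 3"
    (is "F - ?G \<in> _")
  unfolding order_ge_def
proof (intro CollectI allI impI)
  fix i j k :: nat assume ijk: "i + j + k < 3"
  show "coeff3 (F - ?G) i j k = 0"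
  proof (cases "i + j + k < 2")
    case True
    then have m0: "coeff3 (monom3 a b c) i j k = 0" if "a + b + c = 2" for a b c
      using that by (auto simp only: coeff3_monom3 split: if_split)
    have m: "coeff3 (monom3 2 0 0) i j k = 0" "coeff3 (monom3 0 2 0) i j k = 0" "coeff3 (monom3 0 0 2) i j k = 0" "coeff3 (monom3 1 1 0) i j k = 0" "coeff3 (monom3 1 0 1) i j k = 0" "coeff3 (monom3 0 1 1) i j k = 0"
      by (rule m0, simp)+
    have "coeff3 F i j k = 0"
      using F2 True by (auto simp: order_ge_coeff3)
    then show ?thesis
      unfolding grad_monom3 by (simp only: coeff3_linear m) simp
  next
    case False
    with ijk have "(i, j, k) \<in> {(2,0,0), (0,2,0), (0,0,2), (1,1,0), (1,0,1), (0,1,1)}"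
      by (intro exponents_sum_2) simp
    moreover have "3 * coeff3 F 0 1 1 = t * coeff3 F 2 0 0" "3 * coeff3 F 1 0 1 = t * coeff3 F 0 2 0"
      "3 * coeff3 F 1 1 0 = t * coeff3 F 0 0 2"
      using eta by (simp_all add: vec_eq_iff forall_3)
    ultimately show ?thesis
      unfolding grad_monom3
      by (elim insertE emptyE; clarify; simp only: coeff3_linear coeff3_monom3; simp add: mult.commute)
  qed
qed

lemma jacobian_ideal_eq:
  assumes t: "t \<in> objE6"
  shows "jacobian_ideal (f_E6 t) = jac_set t"
proof
  show "jacobian_ideal (f_E6 t) \<subseteq> jac_set t"
    unfolding jacobian_ideal_f_E6 by (rule Idl_minimal[OF ideal_jac_set]) (auto simp: grad_in_jac_set simp del: grad_nth)
  define K where "K = jacobian_ideal (f_E6 t)"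
  have K: "ideal K ps3_ring" unfolding K_def jacobian_ideal_f_E6 by (rule Idl_ideal)
  have g: "grad t $ j \<in> K" for j
    unfolding K_def jacobian_ideal_f_E6 by (rule subsetD[OF Idl_self rangeI])
  have M: "mjac_set t \<subseteq> K"
    by (rule mjac_set_subset_ideal[OF K t]) (use g in \<open>auto intro: ideal_ps3D(3)[OF K]\<close>)
  show "jac_set t \<subseteq> K"
  proof
    fix F assume F: "F \<in> jac_set t"
    let ?G = "const3 (coeff3 F 2 0 0 / 3) * grad t $ 1 + const3 (coeff3 F 0 2 0 / 3) * grad t $ 2 +
      const3 (coeff3 F 0 0 2 / 3) * grad t $ 3"
    have G: "?G \<in> K" by (intro ideal_ps3D(2)[OF K]; rule ideal_ps3D(3)[OF K]; rule g)
    have "F - ?G \<in> order_ge 3"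
      using sub_gradient_order_ge_3[of F t] F by (simp add: jac_set_def del: grad_nth)
    moreover have "lam t ?G = 0"
      using grad_in_jac_set[of t] by (simp add: jac_set_def del: grad_nth)
    then have "lam t (F - ?G) = 0"
      using F eta_lam_linear(5)[of t "F - ?G" ?G] by (simp add: jac_set_def del: grad_nth)
    ultimately have "F - ?G \<in> K" using M by (auto simp: mjac_set_def)
    then have "F - ?G + ?G \<in> K" using G by (rule ideal_ps3D(2)[OF K])
    then show "F \<in> K" by simp
  qed
qed

lemma vars_mult_order_ge: "F \<in> order_ge 1 \<Longrightarrow> G \<in> order_ge 2 \<Longrightarrow> F * G \<in> order_ge 3"
  "F \<in> order_ge 1 \<Longrightarrow> G \<in> order_ge 3 \<Longrightarrow> F * G \<in> order_ge 4"
  using order_ge_mult[of F 1 G 2] order_ge_mult[of F 1 G 3] by (simp_all only: one_plus_numeral semiring_norm)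

lemma ideal_prod_ideal: "ideal I ps3_ring \<Longrightarrow> ideal J ps3_ring \<Longrightarrow> ideal (ideal_prod ps3_ring I J) ps3_ring"
  by (rule ps3.ideal_prod_is_ideal)

lemma ideal_prod_jac_set:
  assumes t: "t \<in> objE6"
  shows "ideal_prod ps3_ring (order_ge 1) (jac_set t) = mjac_set t"
proof
  show "ideal_prod ps3_ring (order_ge 1) (jac_set t) \<subseteq> mjac_set t"
  proof
    fix F assume "F \<in> ideal_prod ps3_ring (order_ge 1) (jac_set t)"
    then show "F \<in> mjac_set t"
    proof induction
      case (prod i j)
      then show ?case
        using vars_mult_order_ge(1)[of i j] order_ge_coeff3[of i 1] order_ge_coeff3[of j 2]
        by (auto simp: mjac_set_def jac_set_def lam_mult simp del: eta_nth)
    qed (auto intro: ideal_ps3D[OF ideal_mjac_set])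
  qed
  show "mjac_set t \<subseteq> ideal_prod ps3_ring (order_ge 1) (jac_set t)"
  proof (rule mjac_set_subset_ideal[OF _ t])
    show "vars $ i * (grad t $ j) \<in> ideal_prod ps3_ring (order_ge 1) (jac_set t)" for i j
      using ideal_prod.prod[OF vars_in_order_ge grad_in_jac_set, of ps3_ring] by simp
  qed (intro ideal_prod_ideal ideal_order_ge ideal_jac_set)
qed

text \<open>
  Together with ideal_prod_order_ge this shows that m^k J consists of all series of order at least
  k + 2 when k \<ge> 2.
\<close>

lemma ideal_prod_mjac_set: "ideal_prod ps3_ring (order_ge 1) (mjac_set t) = order_ge 4"
proof
  show "ideal_prod ps3_ring (order_ge 1) (mjac_set t) \<subseteq> order_ge 4"
  proof
    fix F assume "F \<in> ideal_prod ps3_ring (order_ge 1) (mjac_set t)"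
    then show "F \<in> order_ge 4"
    proof induction
      case (prod i j)
      then show ?case
        using vars_mult_order_ge(2)[of i j] by (auto simp: mjac_set_def)
    qed (auto intro: order_ge_linear)
  qed
  have *: "vars $ i * G \<in> ideal_prod ps3_ring (order_ge 1) (mjac_set t)" if "G \<in> mjac_set t" for i G
    using ideal_prod.prod[OF vars_in_order_ge that, of ps3_ring] by simp
  have "monom3 a b c \<in> mjac_set t" if "a + b + c = 3" "(a, b, c) \<notin> {(3,0,0), (0,3,0), (0,0,3), (1,1,1)}"
    for a b c
    using that by (auto simp: mjac_set_def lam_def coeff3_monom3 order_ge_def)
  from this[of 2 1 0] this[of 2 0 1] this[of 1 2 0] this[of 0 2 1] this[of 1 0 2] this[of 0 1 2]
  have m: "varX\<^sup>2 * varY \<in> mjac_set t" "varX\<^sup>2 * varZ \<in> mjac_set t" "varY\<^sup>2 * varX \<in> mjac_set t"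
    "varY\<^sup>2 * varZ \<in> mjac_set t" "varZ\<^sup>2 * varX \<in> mjac_set t" "varZ\<^sup>2 * varY \<in> mjac_set t"
    by (simp_all add: mult.commute)
  have g: "vars $ i * (grad t $ j) \<in> mjac_set t" for i j
    using grad_in_jac_set[of t j] vars_mult_order_ge(1)[OF vars_in_order_ge[of i], of "grad t $ j"]
      order_ge_coeff3[OF vars_in_order_ge[of i]] order_ge_coeff3[of "grad t $ j" 2]
    by (simp add: jac_set_def mjac_set_def lam_mult del: eta_nth grad_nth)
  show "order_ge 4 \<subseteq> ideal_prod ps3_ring (order_ge 1) (mjac_set t)"
    by (rule quartics_in_ideal[where t = t]) (intro ideal_prod_ideal ideal_order_ge ideal_mjac_set * m g)+
qed

text \<open>
  The ideal generated by f_t and the n-th power of m, see Idl_insert_order_ge.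
\<close>

definition fin_ideal :: "nat \<Rightarrow> complex \<Rightarrow> ps3 set" where
  "fin_ideal n t = {F. \<exists>h. F - h * f_E6 t \<in> order_ge n}"

lemma f_E6_in_mjac_set: "f_E6 t \<in> mjac_set t"
  unfolding mjac_set_def lam_def order_ge_iff_ev
  by (auto simp: ev_f_E6 fps_X_power_iff)
    (simp only: f_E6_monom3 coeff3_linear coeff3_monom3, simp)

lemma mjac_subset_jac: "mjac_set t \<subseteq> jac_set t"
  using order_ge_mono[of 2 3] by (auto simp: mjac_set_def jac_set_def vec_eq_iff forall_3 order_ge_coeff3)

lemma I_E6_0: "t \<in> objE6 \<Longrightarrow> I_E6 0 t = jac_set t"
  using subsetD[OF mjac_subset_jac f_E6_in_mjac_set]
  by (simp add: zero_enat_def jacobian_ideal_eq insert_absorb Idl_of_ideal[OF ideal_jac_set])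

lemma I_E6_1: "t \<in> objE6 \<Longrightarrow> I_E6 1 t = mjac_set t"
  by (simp add: one_enat_def jacobian_ideal_eq max_ideal_eq ideal_prod_jac_set[simplified] insert_absorb
      f_E6_in_mjac_set Idl_of_ideal[OF ideal_mjac_set])

lemma ideal_fin_ideal: "ideal (fin_ideal n t) ps3_ring"
proof (rule ideal_ps3I)
  show "0 \<in> fin_ideal n t"
    unfolding fin_ideal_def by (auto intro!: exI[of _ 0] order_ge_linear)
next
  fix F G assume "F \<in> fin_ideal n t" "G \<in> fin_ideal n t"
  then obtain h h' where "F - h * f_E6 t \<in> order_ge n" "G - h' * f_E6 t \<in> order_ge n"
    unfolding fin_ideal_def by auto
  from order_ge_linear(2)[OF this] show "F + G \<in> fin_ideal n t"
    unfolding fin_ideal_def by (auto intro!: exI[of _ "h + h'"] simp: algebra_simps)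
next
  fix F G assume "F \<in> fin_ideal n t"
  then obtain h where "F - h * f_E6 t \<in> order_ge n" unfolding fin_ideal_def by auto
  from order_ge_linear(4)[OF this, of G] show "G * F \<in> fin_ideal n t"
    unfolding fin_ideal_def by (auto intro!: exI[of _ "G * h"] simp: algebra_simps)
qed

lemma Idl_insert_order_ge: "Idl\<^bsub>ps3_ring\<^esub> (insert (f_E6 t) (order_ge n)) = fin_ideal n t"
proof
  show "Idl\<^bsub>ps3_ring\<^esub> (insert (f_E6 t) (order_ge n)) \<subseteq> fin_ideal n t"
  proof (rule Idl_minimal[OF ideal_fin_ideal])
    show "insert (f_E6 t) (order_ge n) \<subseteq> fin_ideal n t"
      unfolding fin_ideal_def
      using exI[of "\<lambda>h. f_E6 t - h * f_E6 t \<in> order_ge n" 1] exI[of "\<lambda>h. F - h * f_E6 t \<in> order_ge n" 0 for F]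
      by (auto simp: order_ge_linear)
  qed
  show "fin_ideal n t \<subseteq> Idl\<^bsub>ps3_ring\<^esub> (insert (f_E6 t) (order_ge n))" (is "_ \<subseteq> ?I")
  proof
    fix F assume "F \<in> fin_ideal n t"
    then obtain h where h: "F - h * f_E6 t \<in> order_ge n" unfolding fin_ideal_def by auto
    have I: "ideal ?I ps3_ring" by (rule Idl_ideal)
    have "F - h * f_E6 t \<in> ?I" "f_E6 t \<in> ?I" using Idl_self h by blast+
    then have "F - h * f_E6 t + h * f_E6 t \<in> ?I" by (intro ideal_ps3D(2)[OF I]) (auto intro: ideal_ps3D(3)[OF I])
    then show "F \<in> ?I" by simp
  qed
qed

lemma I_E6_ge_2:
  assumes t: "t \<in> objE6"
  shows "I_E6 (enat (Suc (Suc k))) t = fin_ideal (k + 4) t"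
proof -
  have "(ideal_prod ps3_ring (order_ge 1) ^^ Suc (Suc k)) (jac_set t) = order_ge (k + 4)"
  proof (induction k)
    case 0
    then show ?case by (simp add: ideal_prod_jac_set[OF t, simplified] ideal_prod_mjac_set[simplified])
  next
    case (Suc k)
    then show ?case using ideal_prod_order_ge[of "k + 4"] by simp
  qed
  then show ?thesis
    by (simp add: max_ideal_eq jacobian_ideal_eq[OF t] Idl_insert_order_ge del: funpow.simps)
qed

lemma I_E6_infinity: "I_E6 \<infinity> t = {F. \<exists>h. F = h * f_E6 t}"
proof -
  have "cgenideal ps3_ring (f_E6 t) = Idl\<^bsub>ps3_ring\<^esub> {f_E6 t}"
    by (rule ps3.cgenideal_eq_genideal) simp
  then show ?thesis by (auto simp: cgenideal_def)
qed

section \<open>Uniform properties of the ideals\<close>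

lemma enat_cases_012:
  obtains "k = (0::enat)" | "k = 1" | n where "k = enat (Suc (Suc n))" | "k = \<infinity>"
proof (cases k)
  case (enat n)
  then show ?thesis
    using that by (cases n rule: nat.exhaust; cases "n - 1") (auto simp: zero_enat_def one_enat_def)
qed (use that in auto)

lemma ideal_I_E6: "ideal (I_E6 k t) ps3_ring"
  by (cases k) (simp_all add: Idl_ideal)

declare I_E6.simps [simp del]

lemmas I_E6_D = ideal_ps3D[OF ideal_I_E6]

lemma f_E6_order_ge: "f_E6 t \<in> order_ge 3"
  using f_E6_in_mjac_set by (auto simp: mjac_set_def)

lemma fin_ideal_subset: "n \<ge> 3 \<Longrightarrow> fin_ideal n t \<subseteq> order_ge 3"
proof
  fix F assume "n \<ge> 3" "F \<in> fin_ideal n t"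
  then obtain h where "F - h * f_E6 t \<in> order_ge 3"
    using order_ge_mono[of 3 n] by (auto simp: fin_ideal_def)
  then have "F - h * f_E6 t + h * f_E6 t \<in> order_ge 3"
    using order_ge_linear(2,4) f_E6_order_ge by blast
  then show "F \<in> order_ge 3" by simp
qed

lemma I_E6_order_ge:
  assumes "t \<in> objE6"
  shows "I_E6 k t \<subseteq> order_ge 2"
proof (cases k rule: enat_cases_012)
  case 1
  then show ?thesis using assms by (auto simp: I_E6_0 jac_set_def)
next
  case 2
  then show ?thesis using assms order_ge_mono[of 2 3] by (auto simp: I_E6_1 mjac_set_def)
next
  case (3 n)
  then show ?thesis
    using I_E6_ge_2[OF assms, of n] fin_ideal_subset[of "n + 4" t] order_ge_mono[of 2 3] by auto
next
  case 4
  then show ?thesis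
    using order_ge_linear(4)[OF f_E6_order_ge] order_ge_mono[of 2 3] by (auto simp: I_E6_infinity)
qed

lemma coeff3_mult_f_E6:
  "coeff3 (G * f_E6 t) i j k = (if 3 \<le> i then coeff3 G (i - 3) j k else 0) +
    (if 3 \<le> j then coeff3 G i (j - 3) k else 0) + (if 3 \<le> k then coeff3 G i j (k - 3) else 0) +
    t * (if 1 \<le> i \<and> 1 \<le> j \<and> 1 \<le> k then coeff3 G (i - 1) (j - 1) (k - 1) else 0)"
proof -
  have "G * f_E6 t = monom3 3 0 0 * G + monom3 0 3 0 * G + monom3 0 0 3 * G + const3 t * (monom3 1 1 1 * G)"
    unfolding f_E6_monom3 by (simp only: algebra_simps)
  then show ?thesis
    by (simp only: coeff3_linear coeff3_monomial_mult) simp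
qed

text \<open>
  The ideals are closed for the m-adic topology. If k is finite, then the ideal contains a power of m. In
  the principal ideal of f_t the approximate quotients by f_t are glued degree by degree: as f_t is a
  cubic form, the coefficients of h f_t in degree d only involve the coefficients of h in degree d - 3.
\<close>

lemma I_E6_closed:
  assumes t: "t \<in> objE6" and F: "\<And>n. \<exists>G\<in>I_E6 k t. F - G \<in> order_ge n"
  shows "F \<in> I_E6 k t"
proof -
  have fin: ?thesis if "order_ge n \<subseteq> I_E6 k t" for n
  proof -
    from F[of n] obtain G where "G \<in> I_E6 k t" "F - G \<in> order_ge n" by auto
    with that have "F - G + G \<in> I_E6 k t" using I_E6_D(2) by blast
    then show ?thesis by simp
  qed
  show ?thesis
  proof (cases k rule: enat_cases_012)
    case 1
    have "order_ge 4 \<subseteq> I_E6 k t"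
      unfolding 1 I_E6_0[OF t] using order_ge_mono[of 2 4]
      by (auto simp: jac_set_def lam_def vec_eq_iff forall_3 order_ge_coeff3[of _ 4])
    then show ?thesis by (rule fin)
  next
    case 2
    have "order_ge 4 \<subseteq> I_E6 k t"
      unfolding 2 I_E6_1[OF t] using order_ge_mono[of 3 4]
      by (auto simp: mjac_set_def lam_def order_ge_coeff3[of _ 4])
    then show ?thesis by (rule fin)
  next
    case (3 n)
    have "order_ge (n + 4) \<subseteq> I_E6 k t"
      unfolding 3 I_E6_ge_2[OF t] fin_ideal_def by (auto intro!: exI[of _ 0])
    then show ?thesis by (rule fin)
  next
    case 4
    have "\<exists>h. F - h * f_E6 t \<in> order_ge n" for n
      using F[of n] unfolding 4 I_E6_infinity by blast
    then obtain h where h: "\<And>n. F - h n * f_E6 t \<in> order_ge n" by metis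
    \<comment> \<open>a coefficient of h in degree e contributes to degree e + 3, which is correct up to order e + 4\<close>
    define H where "H = mk_ps3 (\<lambda>i j k. coeff3 (h (i + j + k + 4)) i j k)"
    have "F = H * f_E6 t"
    proof (rule ps3_eqI)
      fix i j k
      have "coeff3 F i j k = coeff3 (h (i + j + k + 1) * f_E6 t) i j k"
        using order_ge_coeff3[OF h[of "i + j + k + 1"], of i j k] by simp
      also have "\<dots> = coeff3 (H * f_E6 t) i j k"
        unfolding coeff3_mult_f_E6 H_def coeff3_mk
        by (intro arg_cong2[where f = "(+)"] arg_cong2[where f = "(*)"] if_cong refl;
            rule arg_cong[where f = "\<lambda>n. coeff3 (h n) _ _ _"]; simp)
      finally show "coeff3 F i j k = coeff3 (H * f_E6 t) i j k" .
    qed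
    then show ?thesis unfolding 4 I_E6_infinity by blast
  qed
qed

section \<open>The quotient algebras\<close>

lemma class_E6_set: "class_E6 k t F = {G. G - F \<in> I_E6 k t}"
proof -
  have "(\<exists>h\<in>I_E6 k t. G = h + F) \<longleftrightarrow> G - F \<in> I_E6 k t" for G
    by (auto intro!: bexI[of _ "G - F"])
  then show ?thesis
    by (auto simp: class_E6_def a_r_coset_def r_coset_def)
qed

lemma class_E6_eq_iff: "class_E6 k t F = class_E6 k t G \<longleftrightarrow> F - G \<in> I_E6 k t"
proof
  assume "class_E6 k t F = class_E6 k t G"
  moreover have "F \<in> class_E6 k t F" by (simp add: class_E6_set I_E6_D(1))
  ultimately show "F - G \<in> I_E6 k t" by (simp add: class_E6_set)
next
  assume *: "F - G \<in> I_E6 k t"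
  have "H - F \<in> I_E6 k t \<longleftrightarrow> H - G \<in> I_E6 k t" for H
    using I_E6_D(2)[OF * , of "H - F"] I_E6_D(5)[OF _ *, of "H - G"] by auto
  then show "class_E6 k t F = class_E6 k t G" by (auto simp: class_E6_set)
qed

lemma A_E6_simps [simp]:
  "carrier (A_E6 k t) = range (class_E6 k t)"
  "class_E6 k t F \<otimes>\<^bsub>A_E6 k t\<^esub> class_E6 k t G = class_E6 k t (F * G)"
  "class_E6 k t F \<oplus>\<^bsub>A_E6 k t\<^esub> class_E6 k t G = class_E6 k t (F + G)"
  "\<one>\<^bsub>A_E6 k t\<^esub> = class_E6 k t 1"
  "\<zero>\<^bsub>A_E6 k t\<^esub> = class_E6 k t 0"
  "c \<odot>\<^bsub>A_E6 k t\<^esub> class_E6 k t F = class_E6 k t (const3 c * F)"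
proof -
  interpret I: ideal "I_E6 k t" ps3_ring by (rule ideal_I_E6)
  show "carrier (A_E6 k t) = range (class_E6 k t)"
    by (auto simp: A_E6_def FactRing_def A_RCOSETS_def RCOSETS_def class_E6_def a_r_coset_def)
  show mult: "class_E6 k t F \<otimes>\<^bsub>A_E6 k t\<^esub> class_E6 k t G = class_E6 k t (F * G)" for F G
    using I.rcoset_mult_add[of F G] by (simp add: A_E6_def FactRing_def class_E6_def)
  show "class_E6 k t F \<oplus>\<^bsub>A_E6 k t\<^esub> class_E6 k t G = class_E6 k t (F + G)"
    using I.a_rcos_sum[of F G] by (simp add: A_E6_def FactRing_def class_E6_def)
  show "\<one>\<^bsub>A_E6 k t\<^esub> = class_E6 k t 1"
    by (simp add: A_E6_def FactRing_def class_E6_def)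
  show "\<zero>\<^bsub>A_E6 k t\<^esub> = class_E6 k t 0"
    by (simp add: A_E6_def FactRing_def class_E6_set)
  show "c \<odot>\<^bsub>A_E6 k t\<^esub> class_E6 k t F = class_E6 k t (const3 c * F)"
    using mult[of "const3 c" F] by (simp add: A_E6_def Let_def)
qed

lemma abelian_group_A_E6: "abelian_group (A_E6 k t)"
proof (rule abelian_groupI)
  fix a assume "a \<in> carrier (A_E6 k t)"
  then obtain F where "a = class_E6 k t F" by auto
  then show "\<exists>b\<in>carrier (A_E6 k t). b \<oplus>\<^bsub>A_E6 k t\<^esub> a = \<zero>\<^bsub>A_E6 k t\<^esub>"
    by (intro bexI[of _ "class_E6 k t (- F)"]) simp_all
qed (auto simp: algebra_simps)

lemma A_E6_minus [simp]: "class_E6 k t F \<ominus>\<^bsub>A_E6 k t\<^esub> class_E6 k t G = class_E6 k t (F - G)"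
proof -
  interpret abelian_group "A_E6 k t" by (rule abelian_group_A_E6)
  have "\<ominus>\<^bsub>A_E6 k t\<^esub> class_E6 k t G = class_E6 k t (- G)"
    by (rule minus_equality) auto
  then show ?thesis by (simp add: a_minus_def)
qed

section \<open>Graded isomorphisms are linear substitutions\<close>

definition admissible :: "enat \<Rightarrow> complex \<Rightarrow> complex \<Rightarrow> complex ^ 3 ^ 3 \<Rightarrow> bool" where
  "admissible k t s A \<longleftrightarrow> invertible A \<and> (\<forall>F. F \<in> I_E6 k t \<longleftrightarrow> lin_subst A F \<in> I_E6 k s)"

text \<open>
  The map induced on cosets; by subst_map_class it does not depend on the chosen representatives if A is
  admissible.
\<close>

definition subst_map ::
  "enat \<Rightarrow> complex \<Rightarrow> complex \<Rightarrow> complex ^ 3 ^ 3 \<Rightarrow> ps3 set \<Rightarrow> ps3 set" where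
  "subst_map k t s A =
     (\<lambda>a\<in>carrier (A_E6 k t). class_E6 k s (lin_subst A (SOME F. class_E6 k t F = a)))"

lemma subst_map_class:
  assumes "admissible k t s A"
  shows "subst_map k t s A (class_E6 k t F) = class_E6 k s (lin_subst A F)"
proof -
  define G where "G = (SOME G. class_E6 k t G = class_E6 k t F)"
  have "class_E6 k t G = class_E6 k t F" unfolding G_def by (rule someI[of _ F]) simp
  then have "G - F \<in> I_E6 k t" by (simp add: class_E6_eq_iff)
  then have "lin_subst A (G - F) \<in> I_E6 k s" using assms by (simp add: admissible_def)
  then have "class_E6 k s (lin_subst A G) = class_E6 k s (lin_subst A F)" by (simp add: class_E6_eq_iff)
  then show ?thesis by (simp add: subst_map_def G_def)
qed

lemma homogeneous3_iff_ev: "homogeneous3 d F \<longleftrightarrow> (\<forall>v e. e \<noteq> d \<longrightarrow> fps_nth (ev v F) e = 0)"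
proof
  assume "homogeneous3 d F"
  then show "\<forall>v e. e \<noteq> d \<longrightarrow> fps_nth (ev v F) e = 0"
    unfolding ev_nth homogeneous3_def
    by (intro allI impI sum.neutral) (fastforce simp: tripl_def split_def)
next
  assume *: "\<forall>v e. e \<noteq> d \<longrightarrow> fps_nth (ev v F) e = 0"
  show "homogeneous3 d F"
    unfolding homogeneous3_def
  proof (intro allI impI)
    fix i j k show "coeff3 F i j k \<noteq> 0 \<Longrightarrow> i + j + k = d"
      using * ev_injective_degree[of F "i + j + k" 0 i j k] by fastforce
  qed
qed

lemma subst_map_graded_iso:
  assumes A: "admissible k t s A"
  shows "subst_map k t s A \<in> graded_iso_E6 k t s"
proof -
  note S = subst_map_class[OF A]
  from A obtain B where B: "A ** B = mat 1" by (auto simp: admissible_def invertible_def)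
  have "subst_map k t s A \<in> ring_hom (A_E6 k t) (A_E6 k s)"
    by (rule ring_hom_memI) (auto simp: S)
  moreover have "bij_betw (subst_map k t s A) (carrier (A_E6 k t)) (carrier (A_E6 k s))"
    unfolding bij_betw_def
  proof
    have inj: "class_E6 k t F = class_E6 k t G"
      if "class_E6 k s (lin_subst A F) = class_E6 k s (lin_subst A G)" for F G
      using that A by (simp add: class_E6_eq_iff admissible_def flip: lin_subst_hom(2))
    show "inj_on (subst_map k t s A) (carrier (A_E6 k t))"
    proof (rule inj_onI)
      fix a b assume "a \<in> carrier (A_E6 k t)" "b \<in> carrier (A_E6 k t)"
        and eq: "subst_map k t s A a = subst_map k t s A b"
      then obtain F G where "a = class_E6 k t F" "b = class_E6 k t G" by auto
      then show "a = b" using eq inj[of F G] by (simp add: S)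
    qed
    have "class_E6 k s F = subst_map k t s A (class_E6 k t (lin_subst B F))" for F
      by (simp add: S lin_subst_inverse[OF B])
    then have "range (class_E6 k s) \<subseteq> subst_map k t s A ` range (class_E6 k t)" by blast
    then show "subst_map k t s A ` carrier (A_E6 k t) = carrier (A_E6 k s)"
      by (auto simp: S)
  qed
  moreover have "subst_map k t s A ` A_E6_deg k t d \<subseteq> A_E6_deg k s d" for d
    by (auto simp: A_E6_deg_def S homogeneous3_iff_ev)
  moreover have "subst_map k t s A (c \<odot>\<^bsub>A_E6 k t\<^esub> a) = c \<odot>\<^bsub>A_E6 k s\<^esub> subst_map k t s A a"
    if "a \<in> carrier (A_E6 k t)" for c a
    using that by (auto simp: S)
  moreover have "subst_map k t s A \<in> extensional (carrier (A_E6 k t))"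
    by (simp add: subst_map_def)
  ultimately show ?thesis
    unfolding graded_iso_E6_def ring_iso_def by blast
qed

text \<open>
  A property that holds for all polynomials holds for approximations of each power series.
\<close>

lemma polynomial_approx:
  assumes const: "\<And>c. P (const3 c)" and add: "\<And>F G. P F \<Longrightarrow> P G \<Longrightarrow> P (F + G)"
    and var: "\<And>j F. P F \<Longrightarrow> P (vars $ j * F)"
  shows "\<exists>T. P T \<and> F - T \<in> order_ge n"
proof (induction n arbitrary: F)
  case 0
  show ?case using const[of 0] by (auto simp: order_ge_def)
next
  case (Suc n)
  have "F - const3 (coeff3 F 0 0 0) \<in> order_ge (Suc 0)"
    by (auto simp: order_ge_def coeff3_const3)
  then obtain A B C where F: "F - const3 (coeff3 F 0 0 0) = varX * A + varY * B + varZ * C"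
    by (rule order_ge_Suc_cases)
  from Suc.IH[of A] Suc.IH[of B] Suc.IH[of C] obtain A' B' C' where
    P: "P A'" "P B'" "P C'" and o: "A - A' \<in> order_ge n" "B - B' \<in> order_ge n" "C - C' \<in> order_ge n"
    by blast
  let ?T = "const3 (coeff3 F 0 0 0) + vars $ 1 * A' + vars $ 2 * B' + vars $ 3 * C'"
  have "P ?T" by (intro add const var P)
  moreover have "F - ?T = vars $ 1 * (A - A') + vars $ 2 * (B - B') + vars $ 3 * (C - C')"
    using F by (simp add: algebra_simps)
  then have "F - ?T \<in> order_ge (Suc n)"
    using order_ge_mult[OF vars_in_order_ge o(1), of 1] order_ge_mult[OF vars_in_order_ge o(2), of 2]
      order_ge_mult[OF vars_in_order_ge o(3), of 3] by (simp add: order_ge_linear)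
  ultimately show ?case by blast
qed

lemma homogeneous3_1_lin_form:
  assumes "homogeneous3 1 L"
  obtains a :: "complex ^ 3" where "L = (\<Sum>i\<in>UNIV. const3 (a $ i) * vars $ i)"
proof
  let ?a = "vector [coeff3 L 1 0 0, coeff3 L 0 1 0, coeff3 L 0 0 1] :: complex ^ 3"
  show "L = (\<Sum>i\<in>UNIV. const3 (?a $ i) * vars $ i)"
  proof (rule ps3_eqI)
    fix i j k
    show "coeff3 L i j k = coeff3 (\<Sum>i\<in>UNIV. const3 (?a $ i) * vars $ i) i j k"
    proof (cases "i + j + k = 1")
      case True
      then have "(i, j, k) \<in> {(1,0,0), (0,1,0), (0,0,1)}" by auto
      then show ?thesis by (auto simp: sum_3 coeff3_var)
    next
      case False
      then have "coeff3 L i j k = 0" using assms unfolding homogeneous3_def by blast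
      then show ?thesis using False by (auto simp: sum_3 coeff3_var)
    qed
  qed
qed

text \<open>
  By homogeneity the images of x, y, z are linear forms, whose coefficients form the matrix A. On
  polynomials the isomorphism is the substitution of A. It maps elements of order n to elements of order n,
  so it differs from the substitution by elements of arbitrarily high order, and both agree by I_E6_closed.
  The matrix is invertible because a linear form in the kernel of the substitution would lie in the ideal,
  which has order two.
\<close>

lemma graded_iso_subst_map:
  assumes t: "t \<in> objE6" and s: "s \<in> objE6" and \<phi>: "\<phi> \<in> graded_iso_E6 k t s"
  obtains A where "admissible k t s A" "\<phi> = subst_map k t s A"
proof -
  have hom: "\<phi> \<in> ring_hom (A_E6 k t) (A_E6 k s)"
    and bij: "bij_betw \<phi> (carrier (A_E6 k t)) (carrier (A_E6 k s))"
    and ext: "\<phi> \<in> extensional (carrier (A_E6 k t))"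
    and smult: "\<And>c F. \<phi> (class_E6 k t (const3 c * F)) = c \<odot>\<^bsub>A_E6 k s\<^esub> \<phi> (class_E6 k t F)"
    and deg: "\<And>d. \<phi> ` A_E6_deg k t d \<subseteq> A_E6_deg k s d"
    using \<phi> by (auto simp: graded_iso_E6_def ring_iso_def simp flip: A_E6_simps(6))
  have add: "\<phi> (class_E6 k t (F + G)) = \<phi> (class_E6 k t F) \<oplus>\<^bsub>A_E6 k s\<^esub> \<phi> (class_E6 k t G)"
    and mult: "\<phi> (class_E6 k t (F * G)) = \<phi> (class_E6 k t F) \<otimes>\<^bsub>A_E6 k s\<^esub> \<phi> (class_E6 k t G)" for F G
    using ring_hom_add[OF hom, of "class_E6 k t F" "class_E6 k t G"]
      ring_hom_mult[OF hom, of "class_E6 k t F" "class_E6 k t G"] by simp_all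
  have one: "\<phi> (class_E6 k t 1) = class_E6 k s 1" using ring_hom_one[OF hom] by simp
  have surj: "\<exists>H. \<phi> (class_E6 k t F) = class_E6 k s H" for F
    using ring_hom_closed[OF hom, of "class_E6 k t F"] by auto
  have "\<exists>a :: complex ^ 3. \<phi> (class_E6 k t (vars $ j)) = class_E6 k s (\<Sum>i\<in>UNIV. const3 (a $ i) * vars $ i)" for j
  proof -
    have "homogeneous3 1 (vars $ j)"
      using exhaust_3[of j] by (auto simp: homogeneous3_def coeff3_var split: if_splits)
    then have "\<phi> (class_E6 k t (vars $ j)) \<in> A_E6_deg k s 1"
      using deg[of 1] unfolding A_E6_deg_def by blast
    then obtain L where "homogeneous3 1 L" "\<phi> (class_E6 k t (vars $ j)) = class_E6 k s L"
      unfolding A_E6_deg_def by blast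
    then show ?thesis by (metis homogeneous3_1_lin_form)
  qed
  then obtain a :: "3 \<Rightarrow> complex ^ 3" where a:
    "\<And>j. \<phi> (class_E6 k t (vars $ j)) = class_E6 k s (\<Sum>i\<in>UNIV. const3 (a j $ i) * vars $ i)"
    by metis
  define A :: "complex ^ 3 ^ 3" where "A = (\<chi> i j. a j $ i)"
  have vars: "\<phi> (class_E6 k t (vars $ j)) = class_E6 k s (lin_form A j)" for j
    by (simp add: a lin_form_def A_def)
  let ?P = "\<lambda>F. \<phi> (class_E6 k t F) = class_E6 k s (lin_subst A F)"
  have const: "?P (const3 c)" for c
    using smult[of c 1] by (simp add: one)
  have ord: "F \<in> order_ge n \<Longrightarrow> \<exists>H\<in>order_ge n. \<phi> (class_E6 k t F) = class_E6 k s H" for F n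
  proof (induction n arbitrary: F)
    case 0
    then show ?case using surj[of F] by (auto simp: order_ge_def)
  next
    case (Suc n)
    then obtain F1 F2 F3 where F: "F1 \<in> order_ge n" "F2 \<in> order_ge n" "F3 \<in> order_ge n"
      "F = vars $ 1 * F1 + vars $ 2 * F2 + vars $ 3 * F3"
      using order_ge_Suc_cases by (metis vars_nth)
    with Suc.IH obtain H1 H2 H3 where H: "H1 \<in> order_ge n" "H2 \<in> order_ge n" "H3 \<in> order_ge n"
      "\<phi> (class_E6 k t F1) = class_E6 k s H1" "\<phi> (class_E6 k t F2) = class_E6 k s H2"
      "\<phi> (class_E6 k t F3) = class_E6 k s H3" by metis
    have l: "lin_form A j \<in> order_ge 1" for j
      using lin_subst_order_ge[OF vars_in_order_ge[of j], of A] by simp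
    have "lin_form A 1 * H1 + lin_form A 2 * H2 + lin_form A 3 * H3 \<in> order_ge (Suc n)"
      using order_ge_mult[OF l H(1), of 1] order_ge_mult[OF l H(2), of 2] order_ge_mult[OF l H(3), of 3]
      by (simp add: order_ge_linear)
    moreover have "\<phi> (class_E6 k t F) = class_E6 k s (lin_form A 1 * H1 + lin_form A 2 * H2 + lin_form A 3 * H3)"
      by (simp add: F(4) add mult vars H del: vars_nth)
    ultimately show ?case by blast
  qed
  have P: "?P F" for F
  proof -
    obtain G where G: "\<phi> (class_E6 k t F) = class_E6 k s G" using surj by blast
    have "G - lin_subst A F \<in> I_E6 k s"
    proof (rule I_E6_closed[OF s])
      fix n
      have "\<exists>T. ?P T \<and> F - T \<in> order_ge n"
        by (rule polynomial_approx) (simp_all add: const add mult vars del: vars_nth)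
      then obtain T where T: "?P T" "F - T \<in> order_ge n" by blast
      from ord[OF T(2)] obtain H where H: "H \<in> order_ge n" "\<phi> (class_E6 k t (F - T)) = class_E6 k s H"
        by blast
      have "class_E6 k s G = class_E6 k s (lin_subst A T + H)"
        using add[of T "F - T"] by (simp add: G T(1) H(2))
      then have "G - (lin_subst A T + H) \<in> I_E6 k s" by (simp add: class_E6_eq_iff)
      moreover have "G - lin_subst A F - (G - (lin_subst A T + H)) = H - lin_subst A (F - T)" by simp
      then have "G - lin_subst A F - (G - (lin_subst A T + H)) \<in> order_ge n"
        using order_ge_linear(3)[OF H(1) lin_subst_order_ge[OF T(2)]] by metis
      ultimately show "\<exists>G'\<in>I_E6 k s. G - lin_subst A F - G' \<in> order_ge n" by blast
    qed
    then show ?thesis by (simp add: G class_E6_eq_iff)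
  qed
  have inj: "class_E6 k t F = class_E6 k t G" if "\<phi> (class_E6 k t F) = \<phi> (class_E6 k t G)" for F G
    using bij that by (auto simp: bij_betw_def inj_on_def)
  have iff: "F \<in> I_E6 k t \<longleftrightarrow> lin_subst A F \<in> I_E6 k s" for F
  proof -
    have "F \<in> I_E6 k t \<longleftrightarrow> class_E6 k t F = class_E6 k t 0" by (simp add: class_E6_eq_iff)
    also have "\<dots> \<longleftrightarrow> \<phi> (class_E6 k t F) = \<phi> (class_E6 k t 0)" using inj[of F 0] by auto
    also have "\<dots> \<longleftrightarrow> lin_subst A F \<in> I_E6 k s" by (simp add: P class_E6_eq_iff)
    finally show ?thesis .
  qed
  have "x = 0" if x: "A *v x = 0" for x
  proof -
    let ?l = "\<Sum>j\<in>UNIV. const3 (x $ j) * vars $ j"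
    have "lin_subst A ?l = 0"
    proof (rule ev_eqI)
      fix v
      have "(\<Sum>j\<in>UNIV. x $ j * (v v* A) $ j) = (\<Sum>i\<in>UNIV. v $ i * (A *v x) $ i)"
        by (simp add: vector_matrix_mult_def matrix_vector_mult_def sum_3 algebra_simps)
      then have "(\<Sum>j\<in>UNIV. x $ j * (v v* A) $ j) = 0" by (simp add: x)
      moreover have "ev v (lin_subst A ?l) = fps_const (\<Sum>j\<in>UNIV. x $ j * (v v* A) $ j) * fps_X"
        by (simp add: sum_3 algebra_simps flip: fps_const_mult fps_const_add)
      ultimately show "ev v (lin_subst A ?l) = ev v 0" by simp
    qed
    then have "?l \<in> I_E6 k t" by (simp add: iff I_E6_D(1))
    then have "?l \<in> order_ge 2" using I_E6_order_ge[OF t] by blast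
    then have "coeff3 ?l 1 0 0 = 0" "coeff3 ?l 0 1 0 = 0" "coeff3 ?l 0 0 1 = 0"
      by (intro order_ge_coeff3[of _ 2]; simp)+
    then show "x = 0" by (simp add: vec_eq_iff forall_3 sum_3 coeff3_var)
  qed
  then obtain B where "B ** A = mat 1" using matrix_left_invertible_ker[of A] by blast
  then have "invertible A" using matrix_left_right_inverse[of B A] by (auto simp: invertible_def)
  with iff have "admissible k t s A" by (simp add: admissible_def)
  moreover have "\<phi> = subst_map k t s A"
  proof
    fix a show "\<phi> a = subst_map k t s A a"
    proof (cases "a \<in> carrier (A_E6 k t)")
      case True
      then show ?thesis using P subst_map_class[OF \<open>admissible k t s A\<close>] by auto
    next
      case False
      then show ?thesis using ext by (simp add: subst_map_def extensional_def)
    qed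
  qed
  ultimately show ?thesis using that by blast
qed

lemma subst_map_inj:
  assumes "s \<in> objE6" and A: "admissible k t s A"
    and "\<And>j. subst_map k t s A (class_E6 k t (vars $ j)) = class_E6 k s (lin_form B j)"
  shows "A = B"
proof -
  have "lin_form A j - lin_form B j \<in> order_ge 2" for j
    using assms(3)[of j] I_E6_order_ge[OF assms(1), of k]
    by (auto simp: subst_map_class[OF A] class_E6_eq_iff)
  then have "coeff3 (lin_form A j - lin_form B j) 1 0 0 = 0"
    "coeff3 (lin_form A j - lin_form B j) 0 1 0 = 0" "coeff3 (lin_form A j - lin_form B j) 0 0 1 = 0" for j
    by (intro order_ge_coeff3[of _ 2]; simp)+
  then have "A $ 1 $ j = B $ 1 $ j" "A $ 2 $ j = B $ 2 $ j" "A $ 3 $ j = B $ 3 $ j" for j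
    by (simp_all add: lin_form_def sum_3 coeff3_var)
  then show ?thesis by (simp add: vec_eq_iff forall_3)
qed

lemma subst_map_compose:
  assumes "admissible k t s A" "admissible k s u B" "admissible k t u (B ** A)"
  shows "compose (carrier (A_E6 k t)) (subst_map k s u B) (subst_map k t s A) = subst_map k t u (B ** A)"
proof
  fix a show "compose (carrier (A_E6 k t)) (subst_map k s u B) (subst_map k t s A) a = subst_map k t u (B ** A) a"
  proof (cases "a \<in> carrier (A_E6 k t)")
    case True
    then obtain F where "a = class_E6 k t F" by auto
    then show ?thesis
      using subst_map_class[OF assms(1)] subst_map_class[OF assms(2)] subst_map_class[OF assms(3)]
      by (simp add: compose_def lin_subst_lin_subst)
  next
    case False
    then show ?thesis by (simp add: compose_def subst_map_def)
  qed
qed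

section \<open>Linear substitutions in the Hesse pencil\<close>

lemma cubic_scale: "c * cubic a b v = cubic (c * a) (c * b) v"
  by (simp add: cubic_def algebra_simps)

lemma cubic_add: "cubic a b v + cubic a' b' v = cubic (a + a') (b + b') v"
  by (simp add: cubic_def algebra_simps)

lemma cubic_eqD:
  assumes "\<And>v. cubic a b v = cubic a' b' v"
  shows "a = a'" "b = b'"
proof -
  show "a = a'" using assms[of "vector [1, 0, 0]"] by (simp add: cubic_def)
  then show "b = b'" using assms[of "vector [1, 1, 1]"] by (simp add: cubic_def)
qed

definition cubic_tri :: "complex \<Rightarrow> complex \<Rightarrow> complex ^ 3 \<Rightarrow> complex ^ 3 \<Rightarrow> complex ^ 3 \<Rightarrow> complex" where
  "cubic_tri a b u v w = 6 * a * (u$1 * v$1 * w$1 + u$2 * v$2 * w$2 + u$3 * v$3 * w$3) +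
     b * (u$1 * v$2 * w$3 + u$1 * v$3 * w$2 + u$2 * v$1 * w$3 + u$2 * v$3 * w$1 +
          u$3 * v$1 * w$2 + u$3 * v$2 * w$1)"

text \<open>
  Polarization: a symmetric trilinear form is determined by its values on the diagonal.
\<close>

lemma symmetric_triadditive_eq_0:
  fixes B :: "'a::ab_group_add \<Rightarrow> 'a \<Rightarrow> 'a \<Rightarrow> complex"
  assumes add: "\<And>u u' v w. B (u + u') v w = B u v w + B u' v w"
    and sym1: "\<And>u v w. B u v w = B v u w" and sym2: "\<And>u v w. B u v w = B u w v"
    and diag: "\<And>v. B v v v = 0"
  shows "B u v w = 0"
proof -
  have add2: "B u (v + v') w = B u v w + B u v' w" for u v v' w
    using add[of v v' u w] sym1 by metis
  have add3: "B u v (w + w') = B u v w + B u v w'" for u v w w'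
    using add2[of u w w' v] sym2 by metis
  have neg: "B u v (- w) = - B u v w" for u v w
    using add3[of u v w "- w"] add3[of u v 0 0] by (simp add: eq_neg_iff_add_eq_0 add.commute)
  have neg1: "B (- u) v w = - B u v w" for u v w
    using neg[of w v u] sym1 sym2 by metis
  have sum0: "B u u v + B u v v = 0" for u v
  proof -
    have "0 = B (u + v) (u + v) (u + v)" by (simp add: diag)
    also have "\<dots> = B u u v + B u v u + B v u u + (B u v v + B v u v + B v v u)"
      by (simp only: add add2 add3) (simp add: diag algebra_simps)
    also have "B u v u = B u u v" by (rule sym2)
    also have "B v u u = B u u v" using sym1 sym2 by metis
    also have "B v u v = B u v v" by (rule sym1)
    also have "B v v u = B u v v" using sym1 sym2 by metis
    finally have "3 * (B u u v + B u v v) = 0" by (simp add: algebra_simps)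
    then show ?thesis unfolding mult_eq_0_iff by simp
  qed
  have "B u u v = 0" for u v
  proof -
    have "B u (- v) (- v) = B u v v" by (metis neg sym2 minus_minus)
    then have "- B u u v + B u v v = 0" using sum0[of u "- v"] by (simp add: neg)
    with sum0[of u v] have "2 * B u u v = 0" by (simp add: add_eq_0_iff)
    then show ?thesis by simp
  qed
  from this[of "u + v" w] this[of u w] this[of v w] have "B u v w + B v u w = 0"
    by (simp add: add add2 algebra_simps)
  then have "2 * B u v w = 0" using sym1[of v u w] by simp
  then show ?thesis by simp
qed

lemma cubic_tri_diag: "cubic_tri a b v v v = 6 * cubic a b v"
  by (simp add: cubic_tri_def cubic_def power3_eq_cube algebra_simps)

lemma cubic_tri_add: "cubic_tri a b (u + u') v w = cubic_tri a b u v w + cubic_tri a b u' v w"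
  by (simp add: cubic_tri_def algebra_simps)

lemma cubic_tri_sym: "cubic_tri a b u v w = cubic_tri a b v u w" "cubic_tri a b u v w = cubic_tri a b u w v"
  by (simp_all add: cubic_tri_def algebra_simps)

lemma cubic_tri_subst:
  assumes "\<And>v. cubic a b (v v* A) = cubic a' b' v"
  shows "cubic_tri a b (u v* A) (v v* A) (w v* A) = cubic_tri a' b' u v w"
proof -
  have "cubic_tri a b (u v* A) (v v* A) (w v* A) - cubic_tri a' b' u v w = 0"
    by (rule symmetric_triadditive_eq_0[where
          B = "\<lambda>u v w. cubic_tri a b (u v* A) (v v* A) (w v* A) - cubic_tri a' b' u v w"])
      (simp_all add: vector_matrix_left_distrib cubic_tri_add cubic_tri_diag assms,
       (metis cubic_tri_sym)+)
  then show ?thesis by simp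
qed

definition hessian :: "complex \<Rightarrow> complex \<Rightarrow> complex ^ 3 \<Rightarrow> complex ^ 3 ^ 3" where
  "hessian a b v = vector [vector [6 * a * v$1, b * v$3, b * v$2],
     vector [b * v$3, 6 * a * v$2, b * v$1], vector [b * v$2, b * v$1, 6 * a * v$3]]"

lemma det_hessian: "det (hessian a b v) = cubic (- 6 * a * b\<^sup>2) (216 * a ^ 3 + 2 * b ^ 3) v"
  by (simp add: det_3 hessian_def cubic_def power2_eq_square power3_eq_cube algebra_simps)

lemma hessian_subst:
  assumes "\<And>v. cubic a b (v v* A) = cubic a' b' v"
  shows "A ** hessian a b (v v* A) ** transpose A = hessian a' b' v"
proof -
  have H: "cubic_tri a b v u w = (\<Sum>l\<in>UNIV. (\<Sum>k\<in>UNIV. u$k * hessian a b v $ k $ l) * w$l)" for a b u v w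
    by (simp add: sum_3 hessian_def cubic_tri_def algebra_simps)
  have row: "axis i 1 v* A = A $ i" for i
    using exhaust_3[of i] by (auto simp: vec_eq_iff forall_3 vector_matrix_mult_def sum_3 axis_def)
  have "(A ** hessian a b (v v* A) ** transpose A) $ i $ j =
      cubic_tri a b (v v* A) (axis i 1 v* A) (axis j 1 v* A)" for i j
    by (simp add: H row matrix_matrix_mult_def transpose_def)
  moreover have "cubic_tri a' b' v (axis i 1) (axis j 1) = hessian a' b' v $ i $ j" for i j
    unfolding H using exhaust_3[of i] exhaust_3[of j] by (auto simp: sum_3 axis_def)
  ultimately show ?thesis by (simp add: vec_eq_iff cubic_tri_subst[OF assms])
qed

text \<open>
  The Hessian determinant is a covariant of cubic forms, and by det_hessian it maps the pencil to itself.
\<close>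

lemma hessian_covariant:
  assumes "\<And>v. cubic a b (v v* A) = cubic a' b' v"
  shows "det A ^ 2 * cubic (- 6 * a * b\<^sup>2) (216 * a ^ 3 + 2 * b ^ 3) (v v* A) =
    cubic (- 6 * a' * b'\<^sup>2) (216 * a' ^ 3 + 2 * b' ^ 3) v"
  using arg_cong[OF hessian_subst[OF assms, of v], of det]
  by (simp add: det_mul det_transpose det_hessian power2_eq_square mult_ac)

definition pencil_map :: "complex ^ 3 ^ 3 \<Rightarrow> bool" where
  "pencil_map A \<longleftrightarrow> (\<forall>a b. \<exists>a' b'. \<forall>v. cubic a b (v v* A) = cubic a' b' v)"

lemma pencil_mapI:
  assumes "\<And>v. cubic a b (v v* A) = cubic a0 b0 v" "\<And>v. cubic c d (v v* A) = cubic c0 d0 v"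
    and "a * d \<noteq> b * c"
  shows "pencil_map A"
  unfolding pencil_map_def
proof (intro allI)
  fix x y
  define p where "p = (x * d - y * c) / (a * d - b * c)"
  define q where "q = (a * y - b * x) / (a * d - b * c)"
  have e: "a * d - b * c \<noteq> 0" using assms(3) by simp
  have "p * a + q * c = (x * (a * d - b * c)) / (a * d - b * c)"
    "p * b + q * d = (y * (a * d - b * c)) / (a * d - b * c)"
    unfolding p_def q_def times_divide_eq_left add_divide_distrib[symmetric]
    by (simp_all add: algebra_simps)
  then have "p * a + q * c = x" "p * b + q * d = y" using e by simp_all
  then have "cubic x y (v v* A) = p * cubic a b (v v* A) + q * cubic c d (v v* A)" for v
    by (simp only: cubic_scale cubic_add)
  then have "cubic x y (v v* A) = cubic (p * a0 + q * c0) (p * b0 + q * d0) v" for v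
    by (simp only: assms cubic_scale cubic_add)
  then show "\<exists>a' b'. \<forall>v. cubic x y (v v* A) = cubic a' b' v" by blast
qed

definition cub_equiv :: "complex ^ 3 ^ 3 \<Rightarrow> complex \<Rightarrow> complex \<Rightarrow> bool" where
  "cub_equiv A t s \<longleftrightarrow> (\<exists>c. c \<noteq> 0 \<and> (\<forall>v. cubic 1 t (v v* A) = c * cubic 1 s v))"

text \<open>
  The matrix A carries f_t and its Hessian determinant into the pencil. They are linearly independent since
  t^3 \<noteq> -27.
\<close>

lemma cub_equiv_pencil_map:
  assumes A: "invertible A" and t: "t \<in> objE6" and eq: "cub_equiv A t s"
  shows "pencil_map A"
proof -
  obtain c where c: "\<And>v. cubic 1 t (v v* A) = cubic c (c * s) v"
    using eq by (auto simp: cub_equiv_def cubic_scale)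
  have d: "det A ^ 2 \<noteq> 0" using A by (simp add: invertible_det_nz)
  have h: "cubic (det A ^ 2 * (- 6 * t\<^sup>2)) (det A ^ 2 * (216 + 2 * t ^ 3)) (v v* A) =
      cubic (- 6 * c * (c * s)\<^sup>2) (216 * c ^ 3 + 2 * (c * s) ^ 3) v" for v
    using hessian_covariant[OF c, of v] by (simp add: cubic_scale)
  have "216 + 8 * t ^ 3 \<noteq> 0"
  proof
    assume "216 + 8 * t ^ 3 = 0"
    then have "8 * (t ^ 3 + 27) = 0" by (simp add: algebra_simps)
    then have "t ^ 3 + 27 = 0" unfolding mult_eq_0_iff by simp
    then have "t ^ 3 = -27" by (simp only: add_eq_0_iff2)
    then show False using t by (simp add: objE6_def)
  qed
  then have "det A ^ 2 * (216 + 8 * t ^ 3) \<noteq> 0" using d by simp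
  moreover have "1 * (det A ^ 2 * (216 + 2 * t ^ 3)) - t * (det A ^ 2 * (- 6 * t\<^sup>2)) =
      det A ^ 2 * (216 + 8 * t ^ 3)"
    by (simp add: algebra_simps power2_eq_square power3_eq_cube)
  ultimately have "1 * (det A ^ 2 * (216 + 2 * t ^ 3)) \<noteq> t * (det A ^ 2 * (- 6 * t\<^sup>2))"
    by (metis eq_iff_diff_eq_0)
  with c h show ?thesis by (rule pencil_mapI)
qed

text \<open>
  The Hessian determinant of x y z is 2 x y z. By covariance the image of x y z is proportional to its own
  Hessian determinant.
\<close>

lemma triangle_in_pencil:
  assumes A: "invertible A" and eq: "\<And>v. cubic 0 1 (v v* A) = cubic p q v" and p: "p \<noteq> 0"
  shows "q ^ 3 = - 27 * p ^ 3"
proof -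
  have "cubic (2 * det A ^ 2 * p) (2 * det A ^ 2 * q) v =
      cubic (- 6 * p * q\<^sup>2) (216 * p ^ 3 + 2 * q ^ 3) v" for v
  proof -
    have "cubic (2 * det A ^ 2 * p) (2 * det A ^ 2 * q) v = 2 * det A ^ 2 * cubic 0 1 (v v* A)"
      by (simp only: eq cubic_scale)
    also have "\<dots> = det A ^ 2 * cubic 0 2 (v v* A)" by (simp add: cubic_def)
    also have "\<dots> = cubic (- 6 * p * q\<^sup>2) (216 * p ^ 3 + 2 * q ^ 3) v"
      using hessian_covariant[OF eq, of v] by simp
    finally show ?thesis .
  qed
  note eqs = cubic_eqD[OF this]
  from eqs(1) have "p * (2 * det A ^ 2) = p * (- 6 * q\<^sup>2)" by (simp only: mult_ac)
  then have "2 * det A ^ 2 = - 6 * q\<^sup>2" by (rule mult_left_cancel[OF p, THEN iffD1])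
  with eqs(2) have "- 6 * q\<^sup>2 * q = 216 * p ^ 3 + 2 * q ^ 3" by simp
  then have "8 * (q ^ 3 + 27 * p ^ 3) = 0"
    by (simp add: power2_eq_square power3_eq_cube algebra_simps)
  then have "q ^ 3 + 27 * p ^ 3 = 0" unfolding mult_eq_0_iff by simp
  then have "q ^ 3 = - (27 * p ^ 3)" by (simp only: add_eq_0_iff2)
  then show ?thesis by simp
qed

lemma triple_product_zero_entries:
  fixes a b c a' b' c' :: complex
  assumes "\<And>x y. (a * x + a' * y) * (b * x + b' * y) * (c * x + c' * y) = 0"
  shows "a * b * c = 0" "a * b * c' + a * b' * c + a' * b * c = 0"
proof -
  show 1: "a * b * c = 0" using assms[of 1 0] by simp
  have 2: "a' * b' * c' = 0" using assms[of 0 1] by simp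
  define m where "m = a * b * c' + a * b' * c + a' * b * c"
  define n where "n = a' * b' * c + a' * b * c' + a * b' * c'"
  have "a * b * c + m + n + a' * b' * c' = 0"
    using assms[of 1 1] unfolding m_def n_def by (simp add: algebra_simps)
  moreover have "a * b * c - m + n - a' * b' * c' = 0"
    using assms[of 1 "-1"] unfolding m_def n_def by (simp add: algebra_simps)
  ultimately have "m + n = 0" "- m + n = 0" unfolding 1 2 by simp_all
  then have "2 * m = 0" by Groebner_Basis.algebra
  then have "m = 0" by simp
  then show "a * b * c' + a * b' * c + a' * b * c = 0" by (simp add: m_def)
qed

lemma vector_matrix_3: "(v v* A) $ j = v$1 * A$1$j + v$2 * A$2$j + v$3 * A$3$j"
  for A :: "complex ^ 3 ^ 3"
  by (simp add: vector_matrix_mult_def sum_3)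

text \<open>
  The columns of A are linear forms with product q x y z, and row i contains their coefficients of the i-th
  variable. As this product contains no cube and no square of a variable, two of these three coefficients
  vanish; otherwise a whole column would be zero.
\<close>

lemma triangle_map_rows:
  assumes d: "det A \<noteq> 0" and P: "\<And>v. cubic 0 1 (v v* A) = q * cubic 0 1 v"
  shows "(A$i$1 = 0 \<and> A$i$2 = 0) \<or> (A$i$1 = 0 \<and> A$i$3 = 0) \<or> (A$i$2 = 0 \<and> A$i$3 = 0)"
proof -
  have two: "A$i$1 * A$i$2 * A$k$3 + A$i$1 * A$k$2 * A$i$3 + A$k$1 * A$i$2 * A$i$3 = 0" if "k \<noteq> i" for k
  proof -
    have "(A$i$1 * x + A$k$1 * y) * (A$i$2 * x + A$k$2 * y) * (A$i$3 * x + A$k$3 * y) = 0" for x y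
    proof -
      have "cubic 0 1 ((\<chi> l. if l = i then x else if l = k then y else 0) v* A) =
          (A$i$1 * x + A$k$1 * y) * (A$i$2 * x + A$k$2 * y) * (A$i$3 * x + A$k$3 * y)"
        using exhaust_3[of i] exhaust_3[of k] that
        by (auto simp: cubic_def vector_matrix_3 algebra_simps)
      moreover have "cubic 0 1 (\<chi> l. if l = i then x else if l = k then y else 0) = 0"
        using exhaust_3[of i] exhaust_3[of k] that by (auto simp: cubic_def)
      ultimately show ?thesis using P by simp
    qed
    from triple_product_zero_entries[OF this] show ?thesis by blast
  qed
  have col: "\<exists>k. A$k$j \<noteq> 0" for j
  proof (rule ccontr)
    assume "\<not> ?thesis"
    then have "A$k$j = 0" for k by blast
    then have "det A = 0" using exhaust_3[of j] by (auto simp: det_3)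
    with d show False by simp
  qed
  obtain k1 k2 k3 where k: "A$k1$1 \<noteq> 0" "A$k2$2 \<noteq> 0" "A$k3$3 \<noteq> 0" using col by metis
  have "A$i$1 * A$i$2 * A$i$3 = 0"
  proof -
    have "cubic 0 1 (axis i 1 v* A) = A$i$1 * A$i$2 * A$i$3"
      using exhaust_3[of i] by (auto simp: cubic_def vector_matrix_3 axis_def)
    moreover have "cubic 0 1 (axis i 1) = 0"
      using exhaust_3[of i] by (auto simp: cubic_def axis_def)
    ultimately show ?thesis using P by simp
  qed
  then consider "A$i$1 = 0" | "A$i$2 = 0" | "A$i$3 = 0" by auto
  then show ?thesis
  proof cases
    case 1
    with k(1) have "k1 \<noteq> i" by auto
    from two[OF this] 1 k(1) show ?thesis by auto
  next
    case 2
    with k(2) have "k2 \<noteq> i" by auto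
    from two[OF this] 2 k(2) show ?thesis by auto
  next
    case 3
    with k(3) have "k3 \<noteq> i" by auto
    from two[OF this] 3 k(3) show ?thesis by auto
  qed
qed

section \<open>The projective linear group\<close>

lemma mat_mult_nth: "(mat c ** A) $ i $ j = c * A $ i $ j" "(A ** mat c) $ i $ j = c * A $ i $ j"
  for A :: "complex ^ 'n ^ 'n"
  by (simp_all add: matrix_matrix_mult_def mat_def if_distrib if_distribR sum.delta sum.delta' mult.commute
      cong: if_cong)

lemma mat_mult_commute: "mat c ** A = A ** mat c" for A :: "complex ^ 'n ^ 'n"
  by (simp add: vec_eq_iff mat_mult_nth)

lemma mat_mult_mat: "mat c ** mat d = (mat (c * d) :: complex ^ 'n ^ 'n)"
  by (simp add: vec_eq_iff mat_mult_nth) (simp add: mat_def)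

lemma invertible_mat: "c \<noteq> 0 \<Longrightarrow> invertible (mat c :: complex ^ 'n ^ 'n)"
  using mat_mult_mat[of c "1 / c"] by (auto simp: invertible_right_inverse)

lemma GL_group_simps [simp]:
  "carrier GL_group = {A. invertible A}" "A \<otimes>\<^bsub>GL_group\<^esub> B = A ** B" "\<one>\<^bsub>GL_group\<^esub> = mat 1"
  by (simp_all add: GL_group_def)

lemma group_GL_group: "group (GL_group :: (complex ^ 'n ^ 'n) monoid)"
proof (rule groupI)
  fix A :: "complex ^ 'n ^ 'n" assume "A \<in> carrier GL_group"
  then obtain B where "A ** B = mat 1" "B ** A = mat 1" by (auto simp: invertible_def)
  then show "\<exists>B\<in>carrier GL_group. B \<otimes>\<^bsub>GL_group\<^esub> A = \<one>\<^bsub>GL_group\<^esub>"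
    by (auto simp: invertible_def)
qed (auto simp: invertible_mult matrix_mul_assoc invertible_mat)

interpretation GL: group GL_group by (rule group_GL_group)

lemma normal_scalar_mats: "scalar_mats \<lhd> (GL_group :: (complex ^ 'n ^ 'n) monoid)"
proof (rule GL.normalI)
  show "subgroup scalar_mats (GL_group :: (complex ^ 'n ^ 'n) monoid)"
  proof (rule GL.subgroupI)
    show "inv\<^bsub>GL_group\<^esub> A \<in> scalar_mats" if A: "A \<in> scalar_mats" for A :: "complex ^ 'n ^ 'n"
    proof -
      from A obtain c where c: "A = mat c" "c \<noteq> 0" by (auto simp: scalar_mats_def)
      then have "inv\<^bsub>GL_group\<^esub> A = mat (1 / c)"
        by (intro GL.inv_equality) (simp_all add: mat_mult_mat invertible_mat)
      then show ?thesis using c(2) by (auto simp: scalar_mats_def intro!: exI[of _ "1 / c"])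
    qed
  next
    fix A B :: "complex ^ 'n ^ 'n" assume "A \<in> scalar_mats" "B \<in> scalar_mats"
    then show "A \<otimes>\<^bsub>GL_group\<^esub> B \<in> scalar_mats"
      by (auto simp: scalar_mats_def mat_mult_mat)
  qed (auto simp: scalar_mats_def invertible_mat)
  show "\<forall>A\<in>carrier (GL_group :: (complex ^ 'n ^ 'n) monoid). scalar_mats #>\<^bsub>GL_group\<^esub> A = A <#\<^bsub>GL_group\<^esub> scalar_mats"
    by (auto simp: r_coset_def l_coset_def scalar_mats_def mat_mult_commute)
qed

lemma proj_class_eq: "proj_class A = {mat c ** A | c. c \<noteq> 0}"
  by (auto simp: proj_class_def r_coset_def scalar_mats_def)

lemma group_PGL3: "group PGL3"
  unfolding PGL3_def by (rule normal.factorgroup_is_group[OF normal_scalar_mats])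

lemma carrier_PGL3: "carrier PGL3 = proj_class ` {A. invertible A}"
  by (auto simp: PGL3_def FactGroup_def RCOSETS_def proj_class_def)

lemma mult_PGL3:
  "invertible A \<Longrightarrow> invertible B \<Longrightarrow> proj_class A \<otimes>\<^bsub>PGL3\<^esub> proj_class B = proj_class (A ** B)"
  using normal.rcos_sum[OF normal_scalar_mats, of A B] by (simp add: PGL3_def FactGroup_def proj_class_def)

lemma one_PGL3: "\<one>\<^bsub>PGL3\<^esub> = proj_class (mat 1)"
  by (auto simp: PGL3_def FactGroup_def proj_class_eq scalar_mats_def)

lemma inv_PGL3:
  assumes "A ** B = mat 1"
  shows "inv\<^bsub>PGL3\<^esub> (proj_class A) = proj_class B"
proof -
  have "B ** A = mat 1" using assms by (simp add: matrix_left_right_inverse)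
  then have "invertible A" "invertible B" using assms by (auto simp: invertible_def)
  with \<open>B ** A = mat 1\<close> show ?thesis
    by (intro group.inv_equality[OF group_PGL3]) (auto simp: mult_PGL3 one_PGL3 carrier_PGL3)
qed

lemma proj_class_self: "A \<in> proj_class A"
  by (auto simp: proj_class_eq intro!: exI[of _ 1])

lemma proj_class_eqI: "B \<in> proj_class A \<Longrightarrow> proj_class B = proj_class A"
proof -
  assume "B \<in> proj_class A"
  then obtain c where c: "B = mat c ** A" "c \<noteq> 0" by (auto simp: proj_class_eq)
  show ?thesis
  proof (intro equalityI subsetI)
    fix Y assume "Y \<in> proj_class B"
    then obtain d where "Y = mat d ** B" "d \<noteq> 0" by (auto simp: proj_class_eq)
    then have "Y = mat (d * c) ** A" "d * c \<noteq> 0" by (simp_all add: c matrix_mul_assoc mat_mult_mat)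
    then show "Y \<in> proj_class A" by (auto simp: proj_class_eq)
  next
    fix Y assume "Y \<in> proj_class A"
    then obtain d where "Y = mat d ** A" "d \<noteq> 0" by (auto simp: proj_class_eq)
    then have "Y = mat (d / c) ** B" "d / c \<noteq> 0" using c(2) by (simp_all add: c matrix_mul_assoc mat_mult_mat)
    then show "Y \<in> proj_class B" unfolding proj_class_eq by blast
  qed
qed

section \<open>The Hessian group\<close>

definition diag3 :: "complex \<Rightarrow> complex \<Rightarrow> complex \<Rightarrow> complex ^ 3 ^ 3" where
  "diag3 a b c = vector [vector [a, 0, 0], vector [0, b, 0], vector [0, 0, c]]"

lemma matrix_eq_3: "A = B \<longleftrightarrow> A$1$1 = B$1$1 \<and> A$1$2 = B$1$2 \<and> A$1$3 = B$1$3 \<and>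
   A$2$1 = B$2$1 \<and> A$2$2 = B$2$2 \<and> A$2$3 = B$2$3 \<and> A$3$1 = B$3$1 \<and> A$3$2 = B$3$2 \<and> A$3$3 = B$3$3"
  for A B :: "complex ^ 3 ^ 3"
  by (auto simp: vec_eq_iff forall_3)

locale cube_root_of_unity =
  fixes \<rho> :: complex
  assumes rho_cube: "\<rho> ^ 3 = 1" and rho_ne_1: "\<rho> \<noteq> 1"
begin

lemma rho_sum: "\<rho>\<^sup>2 + \<rho> + 1 = 0"
proof -
  have "(\<rho> - 1) * (\<rho>\<^sup>2 + \<rho> + 1) = 0"
    using rho_cube by (simp add: power2_eq_square power3_eq_cube algebra_simps)
  then show ?thesis using rho_ne_1 by simp
qed

lemma rho_square: "\<rho>\<^sup>2 = - \<rho> - 1"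
  using rho_sum by Groebner_Basis.algebra

lemma rho_ne_0: "\<rho> \<noteq> 0"
  using rho_cube by auto

lemma cube_roots:
  assumes "x ^ 3 = 1"
  shows "x = 1 \<or> x = \<rho> \<or> x = \<rho>\<^sup>2"
proof -
  have "(x - 1) * ((x - \<rho>) * (x - \<rho>\<^sup>2)) = x ^ 3 - 1"
    using rho_sum by Groebner_Basis.algebra
  then show ?thesis using assms by auto
qed

lemma cube_roots_scaled:
  fixes a b :: complex
  assumes "a ^ 3 = b ^ 3"
  shows "a = b \<or> a = \<rho> * b \<or> a = \<rho>\<^sup>2 * b"
proof (cases "b = 0")
  case True
  then show ?thesis using assms by simp
next
  case False
  then have "(a / b) ^ 3 = 1" using assms by (simp add: power_divide)
  from cube_roots[OF this] False show ?thesis by (auto simp: field_simps)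
qed

abbreviation "gens \<equiv> {mat_A1 \<rho>, mat_A2 \<rho>, mat_A3, mat_A4}"

lemma cubic_A1: "cubic a b (v v* mat_A1 \<rho>) = cubic a (\<rho> * b) v"
  using rho_cube by (simp add: cubic_def mat_A1_def vector_matrix_3 power_mult_distrib)

lemma cubic_A34: "cubic a b (v v* mat_A3) = cubic a b v" "cubic a b (v v* mat_A4) = cubic a b v"
  by (simp_all add: cubic_def mat_A3_def mat_A4_def vector_matrix_3)

text \<open>
  On the pencil the matrix A2 exchanges the triangle x y z with the triangle x^3 + y^3 + z^3 - 3 x y z.
\<close>

lemma cubic_A2: "cubic a b (v v* mat_A2 \<rho>) = cubic (3 * a + b) (18 * a - 3 * b) v"
proof -
  have v: "(v v* mat_A2 \<rho>) $ 1 = \<rho> * v$1 + \<rho>\<^sup>2 * v$2 + v$3"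
    "(v v* mat_A2 \<rho>) $ 2 = \<rho>\<^sup>2 * v$1 + \<rho> * v$2 + v$3" "(v v* mat_A2 \<rho>) $ 3 = v$1 + v$2 + v$3"
    by (simp_all add: mat_A2_def vector_matrix_3 mult.commute)
  have c: "(\<rho> * x + \<rho>\<^sup>2 * y + z) ^ 3 + (\<rho>\<^sup>2 * x + \<rho> * y + z) ^ 3 + (x + y + z) ^ 3 =
      3 * (x ^ 3 + y ^ 3 + z ^ 3) + 18 * (x * y * z)" for x y z
    unfolding rho_square using rho_sum by Groebner_Basis.algebra
  have p: "(\<rho> * x + \<rho>\<^sup>2 * y + z) * (\<rho>\<^sup>2 * x + \<rho> * y + z) * (x + y + z) =
      (x ^ 3 + y ^ 3 + z ^ 3) - 3 * (x * y * z)" for x y z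
    unfolding rho_square using rho_sum by Groebner_Basis.algebra
  show ?thesis
    unfolding cubic_def v c p by (simp add: algebra_simps)
qed

lemma det_gens: "A \<in> gens \<Longrightarrow> det A \<noteq> 0"
proof -
  have "det (mat_A2 \<rho>) = 3 * \<rho>\<^sup>2 - 3 * \<rho>"
  proof -
    have "det (mat_A2 \<rho>) = \<rho> * \<rho> + \<rho>\<^sup>2 + \<rho>\<^sup>2 - \<rho> - \<rho>\<^sup>2 * \<rho>\<^sup>2 - \<rho>"
      by (simp add: det_3 mat_A2_def)
    also have "\<dots> = 3 * \<rho>\<^sup>2 - 3 * \<rho>" using rho_cube by Groebner_Basis.algebra
    finally show ?thesis .
  qed
  moreover have "3 * \<rho>\<^sup>2 - 3 * \<rho> = 3 * \<rho> * (\<rho> - 1)" by (simp add: power2_eq_square algebra_simps)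
  ultimately have "det (mat_A2 \<rho>) \<noteq> 0" using rho_ne_0 rho_ne_1 by simp
  moreover have "det (mat_A1 \<rho>) = \<rho>" "det mat_A3 = -1" "det mat_A4 = -1"
    by (simp_all add: det_3 mat_A1_def mat_A3_def mat_A4_def)
  ultimately show "A \<in> gens \<Longrightarrow> det A \<noteq> 0" using rho_ne_0 by auto
qed

lemma invertible_gens: "A \<in> gens \<Longrightarrow> invertible A"
  using det_gens by (simp add: invertible_det_nz)

definition in_hessian :: "complex ^ 3 ^ 3 \<Rightarrow> bool" where
  "in_hessian A \<longleftrightarrow> invertible A \<and> proj_class A \<in> carrier (G_E6 \<rho>)"

lemma carrier_G: "carrier (G_E6 \<rho>) = generate PGL3 (proj_class ` gens)"
proof -
  have "proj_class ` gens \<subseteq> carrier PGL3" using invertible_gens by (auto simp: carrier_PGL3)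
  then show ?thesis by (simp add: G_E6_def carrier_subgroup_generated inf_absorb2)
qed

lemma in_hessian_mult: "in_hessian A \<Longrightarrow> in_hessian B \<Longrightarrow> in_hessian (A ** B)"
  by (auto simp: in_hessian_def carrier_G invertible_mult simp flip: mult_PGL3 intro: generate.eng)

lemma in_hessian_gens: "A \<in> gens \<Longrightarrow> in_hessian A"
  using invertible_gens[of A] by (auto simp: in_hessian_def carrier_G intro!: generate.incl)

lemma in_hessian_scalar: "c \<noteq> 0 \<Longrightarrow> in_hessian (mat c)"
proof -
  assume "c \<noteq> 0"
  then have "mat c \<in> proj_class (mat 1 :: complex ^ 3 ^ 3)" by (auto simp: proj_class_eq)
  then have "proj_class (mat c :: complex ^ 3 ^ 3) = \<one>\<^bsub>PGL3\<^esub>" by (simp add: one_PGL3 proj_class_eqI)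
  then show ?thesis using \<open>c \<noteq> 0\<close> by (simp add: in_hessian_def invertible_mat carrier_G generate.one)
qed

lemma in_hessian_cancel:
  assumes "in_hessian A" "in_hessian (A ** B)" "invertible B"
  shows "in_hessian B"
proof -
  from assms(1) obtain C where C: "A ** C = mat 1" "C ** A = mat 1" by (auto simp: in_hessian_def invertible_def)
  have "proj_class ` gens \<subseteq> carrier PGL3" using invertible_gens by (auto simp: carrier_PGL3)
  then have "inv\<^bsub>PGL3\<^esub> (proj_class A) \<in> carrier (G_E6 \<rho>)"
    using assms(1) group.generate_m_inv_closed[OF group_PGL3]
    by (auto simp: in_hessian_def carrier_G)
  then have "in_hessian C"
    using C by (auto simp: inv_PGL3[OF C(1)] in_hessian_def invertible_def)
  then have "in_hessian (C ** (A ** B))" using assms(2) by (rule in_hessian_mult)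
  then show ?thesis by (simp add: matrix_mul_assoc C)
qed

lemma in_hessian_diag3:
  assumes "c \<noteq> 0" "a ^ 3 = c ^ 3" "b ^ 3 = c ^ 3"
  shows "in_hessian (diag3 a b c)"
proof -
  have one: "in_hessian (mat 1)" by (rule in_hessian_scalar) simp
  have A1: "mat_A1 \<rho> = diag3 \<rho> 1 1" by (simp add: mat_A1_def diag3_def)
  have mult: "diag3 a b c ** diag3 a' b' c' = diag3 (a * a') (b * b') (c * c')" for a b c a' b' c'
    by (simp add: matrix_eq_3 diag3_def matrix_matrix_mult_def sum_3)
  have A31: "mat_A3 ** diag3 a 1 1 ** mat_A3 = diag3 1 a 1" for a
    by (simp add: matrix_eq_3 diag3_def mat_A3_def matrix_matrix_mult_def sum_3)
  have x: "in_hessian (diag3 x 1 1)" if "x = 1 \<or> x = \<rho> \<or> x = \<rho>\<^sup>2" for x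
  proof -
    have "in_hessian (diag3 \<rho> 1 1)" using in_hessian_gens[of "mat_A1 \<rho>"] by (simp add: A1)
    moreover from in_hessian_mult[OF this this] have "in_hessian (diag3 (\<rho>\<^sup>2) 1 1)"
      by (simp add: mult power2_eq_square)
    moreover have "diag3 1 1 1 = mat 1" by (simp add: matrix_eq_3 diag3_def mat_def)
    then have "in_hessian (diag3 1 1 1)" using one by simp
    ultimately show ?thesis using that by auto
  qed
  have "in_hessian (diag3 1 x 1)" if "x = 1 \<or> x = \<rho> \<or> x = \<rho>\<^sup>2" for x
    using in_hessian_mult[OF in_hessian_mult[OF _ x[OF that]], of mat_A3 mat_A3]
    by (simp add: A31 in_hessian_gens)
  moreover have "a / c = 1 \<or> a / c = \<rho> \<or> a / c = \<rho>\<^sup>2" "b / c = 1 \<or> b / c = \<rho> \<or> b / c = \<rho>\<^sup>2"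
    by (intro cube_roots; use assms in \<open>simp add: power_divide\<close>)+
  ultimately have "in_hessian (mat c ** (diag3 (a / c) 1 1 ** diag3 1 (b / c) 1))"
    by (intro in_hessian_mult in_hessian_scalar assms x) auto
  moreover have "mat c ** (diag3 (a / c) 1 1 ** diag3 1 (b / c) 1) = diag3 a b c"
    using assms(1) by (simp add: mult matrix_eq_3 mat_mult_nth) (simp add: diag3_def)
  ultimately show ?thesis by simp
qed

text \<open>
  By triangle_map_rows the matrix is the product of a diagonal matrix and a permutation matrix. Since it
  carries x^3 + y^3 + z^3 into the pencil, its nonzero entries have equal cubes.
\<close>

lemma in_hessian_monomial:
  assumes d: "det A \<noteq> 0" and P: "\<And>v. cubic 0 1 (v v* A) = q * cubic 0 1 v"
    and S: "\<And>v. cubic 1 0 (v v* A) = cubic a b v"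
  shows "in_hessian A"
proof -
  have cubes: "A$i$1 ^ 3 + A$i$2 ^ 3 + A$i$3 ^ 3 = a" for i
  proof -
    have "cubic 1 0 (axis i 1 v* A) = cubic a b (axis i 1)" by (rule S)
    then show ?thesis
      using exhaust_3[of i] by (auto simp: cubic_def vector_matrix_3 axis_def)
  qed
  have perm: "in_hessian (mat 1)" "in_hessian mat_A3" "in_hessian mat_A4" "in_hessian (mat_A3 ** mat_A4)"
    "in_hessian (mat_A4 ** mat_A3)" "in_hessian (mat_A3 ** mat_A4 ** mat_A3)"
    by (intro in_hessian_mult in_hessian_scalar in_hessian_gens; simp)+
  have step: "in_hessian A" if "in_hessian Q" "A = diag3 x y z ** Q" "z \<noteq> 0" "x ^ 3 = z ^ 3" "y ^ 3 = z ^ 3"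
    for Q x y z
    using in_hessian_mult[OF in_hessian_diag3[OF that(3-5)] that(1)] that(2) by simp
  have rows: "(A$i$2 = 0 \<and> A$i$3 = 0 \<and> A$i$1 ^ 3 = a) \<or> (A$i$1 = 0 \<and> A$i$3 = 0 \<and> A$i$2 ^ 3 = a) \<or>
      (A$i$1 = 0 \<and> A$i$2 = 0 \<and> A$i$3 ^ 3 = a)" for i
    using triangle_map_rows[OF d P, of i] cubes[of i] by auto
  have a: "a \<noteq> 0"
  proof
    assume "a = 0"
    then have "A $ 1 $ 1 = 0 \<and> A $ 1 $ 2 = 0 \<and> A $ 1 $ 3 = 0" using rows[of 1] by auto
    then have "det A = 0" by (simp add: det_3)
    with d show False by simp
  qed
  note M = matrix_eq_3 diag3_def mat_A3_def mat_A4_def mat_def matrix_matrix_mult_def sum_3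
  have "\<not> (A$1$1 * A$2$2 * A$3$3 = 0 \<and>
      A$1$1 * A$2$3 * A$3$2 = 0 \<and>
      A$1$2 * A$2$1 * A$3$3 = 0 \<and>
      A$1$2 * A$2$3 * A$3$1 = 0 \<and>
      A$1$3 * A$2$1 * A$3$2 = 0 \<and>
      A$1$3 * A$2$2 * A$3$1 = 0)"
  proof (rule notI, elim conjE)
    assume z: "A$1$1 * A$2$2 * A$3$3 = 0" "A$1$1 * A$2$3 * A$3$2 = 0" "A$1$2 * A$2$1 * A$3$3 = 0" "A$1$2 * A$2$3 * A$3$1 = 0" "A$1$3 * A$2$1 * A$3$2 = 0" "A$1$3 * A$2$2 * A$3$1 = 0"
    have "det A = 0" unfolding det_3 z by simp
    with d show False by simp
  qed
  then consider "A$1$1 * A$2$2 * A$3$3 \<noteq> 0" | "A$1$1 * A$2$3 * A$3$2 \<noteq> 0" | "A$1$2 * A$2$1 * A$3$3 \<noteq> 0" | "A$1$2 * A$2$3 * A$3$1 \<noteq> 0" | "A$1$3 * A$2$1 * A$3$2 \<noteq> 0" | "A$1$3 * A$2$2 * A$3$1 \<noteq> 0" by blast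
  then show ?thesis
  proof cases
    case 1
    then have "A$1$1 \<noteq> 0" "A$2$2 \<noteq> 0" "A$3$3 \<noteq> 0" by auto
    with rows[of 1] rows[of 2] rows[of 3] show ?thesis
      by (intro step[OF perm(1), of "A$1$1" "A$2$2" "A$3$3"]) (auto simp: M)
  next
    case 2
    then have "A$1$1 \<noteq> 0" "A$2$3 \<noteq> 0" "A$3$2 \<noteq> 0" by auto
    with rows[of 1] rows[of 2] rows[of 3] show ?thesis
      by (intro step[OF perm(3), of "A$1$1" "A$2$3" "A$3$2"]) (auto simp: M)
  next
    case 3
    then have "A$1$2 \<noteq> 0" "A$2$1 \<noteq> 0" "A$3$3 \<noteq> 0" by auto
    with rows[of 1] rows[of 2] rows[of 3] show ?thesis
      by (intro step[OF perm(2), of "A$1$2" "A$2$1" "A$3$3"]) (auto simp: M)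
  next
    case 4
    then have "A$1$2 \<noteq> 0" "A$2$3 \<noteq> 0" "A$3$1 \<noteq> 0" by auto
    with rows[of 1] rows[of 2] rows[of 3] show ?thesis
      by (intro step[OF perm(5), of "A$1$2" "A$2$3" "A$3$1"]) (auto simp: M)
  next
    case 5
    then have "A$1$3 \<noteq> 0" "A$2$1 \<noteq> 0" "A$3$2 \<noteq> 0" by auto
    with rows[of 1] rows[of 2] rows[of 3] show ?thesis
      by (intro step[OF perm(4), of "A$1$3" "A$2$1" "A$3$2"]) (auto simp: M)
  next
    case 6
    then have "A$1$3 \<noteq> 0" "A$2$2 \<noteq> 0" "A$3$1 \<noteq> 0" by auto
    with rows[of 1] rows[of 2] rows[of 3] show ?thesis
      by (intro step[OF perm(6), of "A$1$3" "A$2$2" "A$3$1"]) (auto simp: M)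
  qed
qed

end

section \<open>Admissible matrices\<close>

lemma admissibleI:
  assumes AB: "A ** B = mat 1"
    and AI: "\<And>F. F \<in> I_E6 k t \<Longrightarrow> lin_subst A F \<in> I_E6 k s"
    and BI: "\<And>F. F \<in> I_E6 k s \<Longrightarrow> lin_subst B F \<in> I_E6 k t"
  shows "admissible k t s A"
proof -
  have BA: "B ** A = mat 1" using AB by (simp add: matrix_left_right_inverse)
  have "F \<in> I_E6 k t" if "lin_subst A F \<in> I_E6 k s" for F
    using BI[OF that] by (simp add: lin_subst_inverse[OF BA])
  with AB AI show ?thesis by (auto simp: admissible_def invertible_right_inverse)
qed

lemma cub_equivE:
  assumes "cub_equiv A t s"
  obtains c where "c \<noteq> 0" "\<And>v. cubic 1 t (v v* A) = cubic c (c * s) v"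
  using assms by (auto simp: cub_equiv_def cubic_scale)

lemma cub_equiv_inverse:
  assumes "A ** B = mat 1" "cub_equiv A t s"
  shows "cub_equiv B s t"
proof -
  obtain c where c: "c \<noteq> 0" "\<And>v. cubic 1 t (v v* A) = c * cubic 1 s v"
    using assms(2) by (auto simp: cub_equiv_def)
  have "B ** A = mat 1" using assms(1) by (simp add: matrix_left_right_inverse)
  then have "cubic 1 t v = c * cubic 1 s (v v* B)" for v
    using c(2)[of "v v* B"] by (simp add: vector_matrix_mul_assoc)
  then have "cubic 1 s (v v* B) = (1 / c) * cubic 1 t v" for v using c(1) by simp
  then show ?thesis using c(1) unfolding cub_equiv_def by (intro exI[of _ "1 / c"]) simp
qed

lemma cubic_nonzero_subst:
  assumes "invertible A"
  shows "\<exists>v. cubic 1 t (v v* A) \<noteq> 0"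
proof -
  obtain B where "B ** A = mat 1" using assms by (auto simp: invertible_def)
  then have "(axis 1 1 v* B) v* A = axis 1 1" by (simp add: vector_matrix_mul_assoc)
  moreover have "cubic 1 t (axis 1 1) \<noteq> 0" by (simp add: cubic_def axis_def)
  ultimately show ?thesis by metis
qed

lemma cub_equiv_lin_subst_f:
  assumes "cub_equiv A t s"
  obtains c where "lin_subst A (f_E6 t) = const3 c * f_E6 s"
proof -
  obtain c where "\<And>v. cubic 1 t (v v* A) = c * cubic 1 s v"
    using assms by (auto simp: cub_equiv_def)
  then have "lin_subst A (f_E6 t) = const3 c * f_E6 s"
    by (intro ev_eqI) (simp add: ev_f_E6 mult.assoc flip: fps_const_mult)
  then show ?thesis by (rule that)
qed

lemma enat_ge_2_cases:
  assumes "k \<ge> (2::enat)"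
  obtains n where "k = enat (Suc (Suc n))" | "k = \<infinity>"
  using assms
proof (cases k rule: enat_cases_012)
  case 1
  then show ?thesis using assms by simp
next
  case 2
  then show ?thesis using assms by (simp add: one_enat_def numeral_eq_enat)
qed (use that in auto)

lemma lin_subst_I_E6_ge_2:
  assumes k: "k \<ge> 2" and t: "t \<in> objE6" and s: "s \<in> objE6" and A: "cub_equiv A t s"
    and F: "F \<in> I_E6 k t"
  shows "lin_subst A F \<in> I_E6 k s"
proof -
  obtain c where f: "lin_subst A (f_E6 t) = const3 c * f_E6 s"
    using cub_equiv_lin_subst_f[OF A] .
  from k show ?thesis
  proof (cases rule: enat_ge_2_cases)
    case (1 n)
    then obtain h where "F - h * f_E6 t \<in> order_ge (n + 4)"
      using F by (auto simp: I_E6_ge_2[OF t] fin_ideal_def)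
    from lin_subst_order_ge[OF this, of A]
    have "lin_subst A F - (lin_subst A h * const3 c) * f_E6 s \<in> order_ge (n + 4)"
      by (simp add: f mult.assoc)
    then show ?thesis unfolding 1 I_E6_ge_2[OF s] fin_ideal_def by blast
  next
    case 2
    then obtain h where "F = h * f_E6 t" using F by (auto simp: I_E6_infinity)
    then have "lin_subst A F = (lin_subst A h * const3 c) * f_E6 s" by (simp add: f mult.assoc)
    then show ?thesis unfolding 2 I_E6_infinity by blast
  qed
qed

lemma I_E6_ge_2_subset:
  assumes k: "k \<ge> 2" and s: "s \<in> objE6" and F: "F \<in> I_E6 k s"
  shows "\<exists>h. F - h * f_E6 s \<in> order_ge 4"
  using k
proof (cases rule: enat_ge_2_cases)
  case (1 n)
  then show ?thesis using F order_ge_mono[of 4 "n + 4"] by (auto simp: I_E6_ge_2[OF s] fin_ideal_def)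
next
  case 2
  then obtain h where "F - h * f_E6 s = 0" using F by (auto simp: I_E6_infinity)
  then show ?thesis using order_ge_linear(1) by metis
qed

lemma admissible_iff_ge_2:
  assumes k: "k \<ge> 2" and t: "t \<in> objE6" and s: "s \<in> objE6"
  shows "admissible k t s A \<longleftrightarrow> invertible A \<and> cub_equiv A t s"
proof
  assume A: "admissible k t s A"
  have "f_E6 t \<in> I_E6 k t" using k
  proof (cases rule: enat_ge_2_cases)
    case (1 n)
    have "f_E6 t - 1 * f_E6 t \<in> order_ge (n + 4)" by (simp add: order_ge_linear)
    then show ?thesis unfolding 1 I_E6_ge_2[OF t] fin_ideal_def by blast
  next
    case 2
    have "f_E6 t = 1 * f_E6 t" by simp
    then show ?thesis unfolding 2 I_E6_infinity by blast
  qed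
  then have "lin_subst A (f_E6 t) \<in> I_E6 k s" using A by (auto simp: admissible_def)
  from I_E6_ge_2_subset[OF k s this] obtain h where h: "lin_subst A (f_E6 t) - h * f_E6 s \<in> order_ge 4"
    by blast
  have "cubic 1 t (v v* A) = coeff3 h 0 0 0 * cubic 1 s v" for v
  proof -
    have "fps_nth (ev v (lin_subst A (f_E6 t) - h * f_E6 s)) 3 = 0"
      using h by (auto simp: order_ge_iff_ev)
    moreover have "fps_nth (ev v h) 0 = coeff3 h 0 0 0"
      by (simp add: ev_nth sum_tripl)
    ultimately show ?thesis
      by (simp add: ev_f_E6 fps_mult_nth fps_X_power_iff numeral_3_eq_3)
  qed
  moreover from this have "coeff3 h 0 0 0 \<noteq> 0"
    using cubic_nonzero_subst[of A t] A by (auto simp: admissible_def)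
  ultimately show "invertible A \<and> cub_equiv A t s"
    using A unfolding cub_equiv_def admissible_def by blast
next
  assume A: "invertible A \<and> cub_equiv A t s"
  then obtain B where B: "A ** B = mat 1" by (auto simp: invertible_def)
  have "cub_equiv B s t" using A B cub_equiv_inverse by blast
  with A show "admissible k t s A"
    using lin_subst_I_E6_ge_2[OF k t s] lin_subst_I_E6_ge_2[OF k s t] B by (blast intro: admissibleI)
qed

lemma cubic_tri_grad: "cubic_tri 1 t v v w = 2 * (\<Sum>j\<in>UNIV. w $ j * cubic_grad t v $ j)"
  by (simp add: cubic_tri_def cubic_grad_def sum_3 power2_eq_square algebra_simps)

lemma lin_subst_grad_in_jac_set:
  assumes B: "B ** A = mat 1" and A: "cub_equiv A t s"
  shows "lin_subst A (grad t $ j) \<in> jac_set s"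
proof -
  obtain c where "c \<noteq> 0" and c: "\<And>v. cubic 1 t (v v* A) = cubic c (c * s) v"
    using A by (rule cub_equivE) (rule that)
  have "cubic_grad t (v v* A) $ j = (\<Sum>l\<in>UNIV. (c * (axis j 1 v* B) $ l) * cubic_grad s v $ l)" for v
  proof -
    have "cubic_tri 1 t (v v* A) (v v* A) ((axis j 1 v* B) v* A) = cubic_tri c (c * s) v v (axis j 1 v* B)"
      by (rule cubic_tri_subst) (rule c)
    also have "\<dots> = c * cubic_tri 1 s v v (axis j 1 v* B)"
      by (simp add: cubic_tri_def algebra_simps)
    finally have "2 * (\<Sum>l\<in>UNIV. axis j 1 $ l * cubic_grad t (v v* A) $ l) =
        2 * (c * (\<Sum>l\<in>UNIV. (axis j 1 v* B) $ l * cubic_grad s v $ l))"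
      by (simp add: cubic_tri_grad vector_matrix_mul_assoc B)
    then have "(\<Sum>l\<in>UNIV. axis j 1 $ l * cubic_grad t (v v* A) $ l) =
        (\<Sum>l\<in>UNIV. (c * (axis j 1 v* B) $ l) * cubic_grad s v $ l)"
      unfolding mult_cancel_left by (simp add: sum_distrib_left mult.assoc)
    moreover have "(\<Sum>l\<in>UNIV. axis j 1 $ l * cubic_grad t (v v* A) $ l) = cubic_grad t (v v* A) $ j"
      using exhaust_3[of j] by (auto simp: sum_3 axis_def)
    ultimately show ?thesis by simp
  qed
  then have "lin_subst A (grad t $ j) = (\<Sum>l\<in>UNIV. const3 (c * (axis j 1 v* B) $ l) * (grad s $ l))"
    by (intro ev_eqI) (simp add: ev_grad sum_3 distrib_right del: grad_nth const3_hom
        flip: fps_const_add fps_const_mult)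
  also have "\<dots> \<in> jac_set s"
    by (intro ideal_ps3_sum[OF ideal_jac_set] ideal_ps3D(3)[OF ideal_jac_set] grad_in_jac_set)
  finally show ?thesis .
qed

lemma lin_subst_jac_set:
  assumes t: "t \<in> objE6" and B: "B ** A = mat 1" and A: "cub_equiv A t s" and F: "F \<in> jac_set t"
  shows "lin_subst A F \<in> jac_set s"
proof -
  have "Idl\<^bsub>ps3_ring\<^esub> (range (($) (grad t))) \<subseteq> {F. lin_subst A F \<in> jac_set s}"
    by (intro Idl_minimal ideal_lin_subst_preimage ideal_jac_set)
      (use lin_subst_grad_in_jac_set[OF B A] in \<open>auto simp del: grad_nth\<close>)
  then show ?thesis using F by (auto simp: jacobian_ideal_f_E6 simp flip: jacobian_ideal_eq[OF t])
qed

lemma lin_subst_mjac_set: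
  assumes t: "t \<in> objE6" and s: "s \<in> objE6" and B: "B ** A = mat 1" and A: "cub_equiv A t s"
    and F: "F \<in> mjac_set t"
  shows "lin_subst A F \<in> mjac_set s"
proof -
  have "F \<in> ideal_prod ps3_ring (order_ge 1) (jac_set t)" using F by (simp only: ideal_prod_jac_set[OF t])
  then show ?thesis
  proof induction
    case (prod i j)
    have "lin_subst A i * lin_subst A j \<in> ideal_prod ps3_ring (order_ge 1) (jac_set s)"
      using ideal_prod.prod[OF lin_subst_order_ge[OF prod(1), of A] lin_subst_jac_set[OF t B A prod(2)],
          of ps3_ring] by simp
    then show ?case by (simp only: ideal_prod_jac_set[OF s] lin_subst_hom ps3_ring_simps)
  next
    case (sum F G)
    then show ?case using ideal_ps3D(2)[OF ideal_mjac_set] by simp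
  qed
qed

lemma quadric_in_gradient_span:
  assumes "F \<in> order_ge 2" "eta s F = 0"
  shows "\<exists>x :: complex ^ 3. \<forall>v. fps_nth (ev v F) 2 = (\<Sum>l\<in>UNIV. x $ l * cubic_grad s v $ l)"
proof (intro exI allI)
  let ?x = "vector [coeff3 F 2 0 0 / 3, coeff3 F 0 2 0 / 3, coeff3 F 0 0 2 / 3] :: complex ^ 3"
  fix v
  have "fps_nth (ev v (F - (const3 (coeff3 F 2 0 0 / 3) * grad s $ 1 +
      const3 (coeff3 F 0 2 0 / 3) * grad s $ 2 + const3 (coeff3 F 0 0 2 / 3) * grad s $ 3))) 2 = 0"
    using sub_gradient_order_ge_3[OF assms] unfolding order_ge_iff_ev by simp
  then show "fps_nth (ev v F) 2 = (\<Sum>l\<in>UNIV. ?x $ l * cubic_grad s v $ l)"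
    by (simp add: ev_grad sum_3 del: grad_nth)
qed

text \<open>
  Evaluated on basis vectors, the symmetry says that the diagonal entries of N agree up to the factor s
  and that the other entries satisfy cyclic systems 6 p = s q, 6 q = s r, 6 r = s p. The excluded values of s
  are those where f_s is equivalent to the Fermat cubic; all diagonal matrices preserve the span of its
  partial derivatives.
\<close>

lemma symmetric_multiplier_scalar:
  assumes s: "s \<noteq> 0" "s ^ 3 \<noteq> 216"
    and sym: "\<And>u v w. cubic_tri 1 s u v (w v* N) = cubic_tri 1 s w v (u v* N)"
  shows "\<exists>c. N = mat c"
proof -
  have N: "cubic_tri 1 s (axis i 1) (axis k 1) (N $ j) = cubic_tri 1 s (axis j 1) (axis k 1) (N $ i)" for i j k
  proof -
    have row: "axis i 1 v* N = N $ i" for i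
      using exhaust_3[of i] by (auto simp: vec_eq_iff forall_3 vector_matrix_3 axis_def)
    show ?thesis using sym[of "axis i 1" "axis k 1" "axis j 1"] by (simp add: row)
  qed
  note M = cubic_tri_def axis_def
  have diag: "N$1$1 = N$2$2" "N$2$2 = N$3$3"
    using N[of 2 3 1] N[of 3 1 2] s by (simp_all add: M)
  have e: "6 * N$2$1 = s * N$1$3" "6 * N$1$3 = s * N$3$2" "6 * N$3$2 = s * N$2$1"
    "6 * N$3$1 = s * N$1$2" "6 * N$1$2 = s * N$2$3" "6 * N$2$3 = s * N$3$1"
    using N[of 1 1 2] N[of 3 3 1] N[of 2 2 3] N[of 1 1 3] N[of 2 2 1] N[of 3 3 2] by (simp_all add: M)
  have z: "x = 0 \<and> y = 0 \<and> z = 0" if "6 * x = s * y" "6 * y = s * z" "6 * z = s * x" for x y z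
  proof -
    have "s ^ 3 * x = 216 * x" using that by Groebner_Basis.algebra
    then have "x = 0" using s by auto
    then show ?thesis using that s by auto
  qed
  from z[OF e(1,2,3)] z[OF e(4,5,6)] diag have "N = mat (N$1$1)"
    by (simp add: matrix_eq_3 mat_def)
  then show ?thesis ..
qed

text \<open>
  The hypothesis means that the partial derivatives of f_t are carried into the span of those of f_s. In
  terms of the trilinear forms T_t and T_s of the two cubics this becomes
  T_t(u A, v A, w A) = T_s(u, v, w N) for a matrix N. The left side is symmetric in u, v, w, so N is scalar.
\<close>

lemma cub_equiv_of_gradient:
  assumes s: "s \<noteq> 0" "s ^ 3 \<noteq> 216" and A: "invertible A"
    and grads: "\<And>j. \<exists>x :: complex ^ 3. \<forall>v. cubic_grad t (v v* A) $ j = (\<Sum>l\<in>UNIV. x $ l * cubic_grad s v $ l)"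
  shows "cub_equiv A t s"
proof -
  obtain x :: "3 \<Rightarrow> complex ^ 3" where
    x: "\<And>j v. cubic_grad t (v v* A) $ j = (\<Sum>l\<in>UNIV. x j $ l * cubic_grad s v $ l)"
    using grads by metis
  define N where "N = A ** (\<chi> j l. x j $ l)"
  have diag: "cubic_tri 1 t (v v* A) (v v* A) (w v* A) = cubic_tri 1 s v v (w v* N)" for v w
  proof -
    have "cubic_tri 1 t (v v* A) (v v* A) (w v* A) =
        2 * (\<Sum>j\<in>UNIV. (w v* A) $ j * (\<Sum>l\<in>UNIV. x j $ l * cubic_grad s v $ l))"
      by (simp only: cubic_tri_grad x)
    also have "\<dots> = 2 * (\<Sum>l\<in>UNIV. ((w v* A) v* (\<chi> j l. x j $ l)) $ l * cubic_grad s v $ l)"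
      by (simp add: sum_3 vector_matrix_3[of "w v* A"] algebra_simps)
    also have "\<dots> = cubic_tri 1 s v v (w v* N)"
      by (simp only: cubic_tri_grad N_def vector_matrix_mul_assoc)
    finally show ?thesis .
  qed
  have full: "cubic_tri 1 t (u v* A) (v v* A) (w v* A) = cubic_tri 1 s u v (w v* N)" for u v w
  proof -
    have expand: "cubic_tri 1 r (u + v) (u + v) w = cubic_tri 1 r u u w + cubic_tri 1 r v v w + 2 * cubic_tri 1 r u v w"
      for r u v w by (simp add: cubic_tri_def algebra_simps)
    have "2 * cubic_tri 1 t (u v* A) (v v* A) (w v* A) = 2 * cubic_tri 1 s u v (w v* N)"
      using diag[of "u + v" w] by (simp add: vector_matrix_left_distrib expand diag)
    then show ?thesis by simp
  qed
  have "cubic_tri 1 s u v (w v* N) = cubic_tri 1 s w v (u v* N)" for u v w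
    by (metis full cubic_tri_sym)
  from symmetric_multiplier_scalar[OF s this] obtain c where "N = mat c" by blast
  then have "6 * cubic 1 t (v v* A) = 6 * (c * cubic 1 s v)" for v
    using diag[of v v] by (simp add: cubic_tri_diag vector_matrix_mat) (simp add: cubic_tri_def cubic_def power3_eq_cube algebra_simps)
  then have c: "cubic 1 t (v v* A) = c * cubic 1 s v" for v by simp
  moreover have "c \<noteq> 0" using cubic_nonzero_subst[OF A, of t] c by auto
  ultimately show ?thesis by (auto simp: cub_equiv_def)
qed

text \<open>
  For k = 1 only the products of the partial derivatives with linear forms belong to the ideal. This is
  enough: by lam_mult the value of lam s on the product of the m-th variable with a quadratic form is the
  m-th component of eta s.
\<close>

lemma admissible_grad_eta:
  assumes k: "k \<in> {0, 1}" and t: "t \<in> objE6" and s: "s \<in> objE6" and A: "admissible k t s A"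
  shows "eta s (lin_subst A (grad t $ j)) = 0"
proof (cases "k = 0")
  case True
  have "lin_subst A (grad t $ j) \<in> jac_set s"
    using A grad_in_jac_set[of t j] unfolding admissible_def True I_E6_0[OF t] I_E6_0[OF s] by blast
  then show ?thesis by (simp add: jac_set_def)
next
  case False
  with k have k1: "k = 1" by simp
  obtain B where B: "A ** B = mat 1" using A by (auto simp: admissible_def invertible_def)
  let ?G = "lin_subst A (grad t $ j)"
  have G2: "?G \<in> order_ge 2"
    using grad_in_jac_set[of t j] by (intro lin_subst_order_ge) (simp add: jac_set_def)
  have "lam s (vars $ m * ?G) = 0" for m
  proof -
    have "lin_subst B (vars $ m) * (grad t $ j) \<in> ideal_prod ps3_ring (order_ge 1) (jac_set t)"
      using ideal_prod.prod[OF lin_subst_order_ge[OF vars_in_order_ge[of m], of B] grad_in_jac_set[of t j],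
          of ps3_ring] by (simp del: lin_subst_vars)
    then have "lin_subst B (vars $ m) * (grad t $ j) \<in> I_E6 k t"
      by (simp only: k1 I_E6_1[OF t] ideal_prod_jac_set[OF t])
    then have "lin_subst A (lin_subst B (vars $ m) * (grad t $ j)) \<in> mjac_set s"
      using A unfolding admissible_def k1 I_E6_1[OF s] by blast
    then have "vars $ m * ?G \<in> mjac_set s"
      by (simp add: lin_subst_inverse[OF B] del: lin_subst_vars)
    then show ?thesis by (simp add: mjac_set_def)
  qed
  moreover have "lam s (vars $ m * ?G) = eta s ?G $ m" for m
    unfolding lam_mult using exhaust_3[of m] order_ge_coeff3[OF G2]
    by (auto simp: coeff3_var simp del: eta_nth)
  ultimately show ?thesis by (simp add: vec_eq_iff)
qed

lemma admissible_iff_01: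
  assumes k: "k \<in> {0, 1}" and t: "t \<in> objE6" and s: "s \<in> objE6" and gen: "s \<noteq> 0" "s ^ 3 \<noteq> 216"
  shows "admissible k t s A \<longleftrightarrow> invertible A \<and> cub_equiv A t s"
proof
  assume A: "admissible k t s A"
  then have inv: "invertible A" by (simp add: admissible_def)
  have "\<exists>x :: complex ^ 3. \<forall>v. cubic_grad t (v v* A) $ j = (\<Sum>l\<in>UNIV. x $ l * cubic_grad s v $ l)" for j
  proof -
    have "lin_subst A (grad t $ j) \<in> order_ge 2"
      using grad_in_jac_set[of t j] by (intro lin_subst_order_ge) (simp add: jac_set_def)
    from quadric_in_gradient_span[OF this admissible_grad_eta[OF k t s A]]
    show ?thesis by (simp add: ev_grad del: grad_nth)
  qed
  from cub_equiv_of_gradient[OF gen inv this] inv show "invertible A \<and> cub_equiv A t s" by simp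
next
  assume A: "invertible A \<and> cub_equiv A t s"
  then obtain B where B: "A ** B = mat 1" "B ** A = mat 1" by (auto simp: invertible_def)
  have B': "cub_equiv B s t" using A B cub_equiv_inverse by blast
  from k consider "k = 0" | "k = 1" by blast
  then show "admissible k t s A"
  proof cases
    case 1
    show ?thesis
      by (rule admissibleI[OF B(1)]) (use lin_subst_jac_set[OF t B(2)] lin_subst_jac_set[OF s B(1)] A B' in
        \<open>simp_all add: 1 I_E6_0[OF t] I_E6_0[OF s]\<close>)
  next
    case 2
    show ?thesis
      by (rule admissibleI[OF B(1)]) (use lin_subst_mjac_set[OF t s B(2)] lin_subst_mjac_set[OF s t B(1)] A B' in
        \<open>simp_all add: 2 I_E6_1[OF t] I_E6_1[OF s]\<close>)
  qed
qed

section \<open>The action of the Hessian group on the parameter\<close>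

lemma vector_matrix_scale: "v v* (mat c ** A) = (c *s v) v* A" for v :: "complex ^ 3"
  by (simp add: vector_matrix_mul_assoc[symmetric] vector_matrix_mat)

lemma cubic_homogeneous: "cubic a b (c *s v) = c ^ 3 * cubic a b v"
  by (simp add: cubic_def power_mult_distrib power3_eq_cube algebra_simps)

lemma cub_equiv_proj_class:
  assumes "cub_equiv A t s" "B \<in> proj_class A"
  shows "cub_equiv B t s"
proof -
  obtain c where c: "c \<noteq> 0" "\<And>v. cubic 1 t (v v* A) = c * cubic 1 s v"
    using assms(1) by (auto simp: cub_equiv_def)
  obtain d where d: "d \<noteq> 0" "B = mat d ** A" using assms(2) by (auto simp: proj_class_eq)
  have "cubic 1 t (v v* B) = (c * d ^ 3) * cubic 1 s v" for v
    by (simp add: d(2) vector_matrix_scale c(2) cubic_homogeneous)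
  then show ?thesis using c(1) d(1) unfolding cub_equiv_def by (intro exI[of _ "c * d ^ 3"]) simp
qed

lemma cub_equiv_unique:
  assumes "cub_equiv A t s" "cub_equiv A t s'"
  shows "s = s'"
proof -
  obtain c where c: "c \<noteq> 0" "\<And>v. cubic 1 t (v v* A) = c * cubic 1 s v"
    using assms(1) by (auto simp: cub_equiv_def)
  obtain d where d: "\<And>v. cubic 1 t (v v* A) = d * cubic 1 s' v"
    using assms(2) by (auto simp: cub_equiv_def)
  have "cubic (c * 1) (c * s) v = cubic (d * 1) (d * s') v" for v
    using c(2)[of v] d[of v] by (simp only: cubic_scale)
  from cubic_eqD[OF this] c(1) show ?thesis by simp
qed

lemma cub_equiv_mult:
  assumes "cub_equiv A t s" "cub_equiv B s u"
  shows "cub_equiv (B ** A) t u"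
proof -
  obtain c where c: "c \<noteq> 0" "\<And>v. cubic 1 t (v v* A) = c * cubic 1 s v"
    using assms(1) by (auto simp: cub_equiv_def)
  obtain d where d: "d \<noteq> 0" "\<And>v. cubic 1 s (v v* B) = d * cubic 1 u v"
    using assms(2) by (auto simp: cub_equiv_def)
  have "cubic 1 t (v v* (B ** A)) = (c * d) * cubic 1 u v" for v
    using c(2)[of "v v* B"] d(2)[of v] by (simp add: vector_matrix_mul_assoc)
  then show ?thesis using c(1) d(1) unfolding cub_equiv_def by (intro exI[of _ "c * d"]) simp
qed

lemma cub_equiv_id: "cub_equiv (mat 1) t t"
  by (auto simp: cub_equiv_def intro!: exI[of _ 1])

context cube_root_of_unity
begin

lemma rho_inverse: "\<rho> * \<rho>\<^sup>2 = 1" "\<rho>\<^sup>2 * \<rho> = 1"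
  using rho_cube by (simp_all add: power2_eq_square power3_eq_cube mult.assoc)

text \<open>
  The image of x y z under A is x y z or one of the other three triangles of the pencil. The latter are
  x^3 + y^3 + z^3 - 3 x y z up to a power of A1, and A2 moves this triangle back to x y z. This reduces the
  claim to in_hessian_monomial.
\<close>

theorem cub_equiv_in_hessian:
  assumes A: "invertible A" and t: "t \<in> objE6" and eq: "cub_equiv A t s"
  shows "in_hessian A"
proof -
  have pencil: "pencil_map A" by (rule cub_equiv_pencil_map[OF A t eq])
  then obtain p q where P: "\<And>v. cubic 0 1 (v v* A) = cubic p q v" unfolding pencil_map_def by metis
  from pencil obtain p' q' where S: "\<And>v. cubic 1 0 (v v* A) = cubic p' q' v" unfolding pencil_map_def by metis
  show ?thesis
  proof (cases "p = 0")
    case True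
    have P0: "cubic 0 1 (v v* A) = q * cubic 0 1 v" for v by (simp add: P True cubic_scale)
    have "det A \<noteq> 0" using A by (simp add: invertible_det_nz)
    then show ?thesis using P0 S by (rule in_hessian_monomial)
  next
    case False
    have "q ^ 3 = (- 3 * p) ^ 3" using triangle_in_pencil[OF A P False] by (simp add: power_mult_distrib)
    then have "q = - 3 * p \<or> q = \<rho> * (- 3 * p) \<or> q = \<rho>\<^sup>2 * (- 3 * p)" by (rule cube_roots_scaled)
    then have "\<exists>\<omega>\<in>{1, \<rho>, \<rho>\<^sup>2}. \<omega> * q = - 3 * p"
    proof (elim disjE)
      show ?thesis if "q = \<rho> * (- 3 * p)"
        using that by (intro bexI[of _ "\<rho>\<^sup>2"]) (simp_all add: rho_inverse flip: mult.assoc)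
      show ?thesis if "q = \<rho>\<^sup>2 * (- 3 * p)"
        using that by (intro bexI[of _ "\<rho>"]) (simp_all add: rho_inverse flip: mult.assoc)
    qed auto
    moreover have "\<exists>W. in_hessian W \<and> (\<forall>a b v. cubic a b (v v* W) = cubic a (\<omega> * b) v)"
      if "\<omega> \<in> {1, \<rho>, \<rho>\<^sup>2}" for \<omega>
    proof -
      have g: "in_hessian (mat_A1 \<rho>)" by (rule in_hessian_gens) simp
      have "in_hessian (mat 1) \<and> (\<forall>a b v. cubic a b (v v* mat 1) = cubic a (1 * b) v)"
        by (simp add: in_hessian_scalar)
      moreover have "in_hessian (mat_A1 \<rho>) \<and> (\<forall>a b v. cubic a b (v v* mat_A1 \<rho>) = cubic a (\<rho> * b) v)"
        by (simp add: g cubic_A1)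
      moreover have "in_hessian (mat_A1 \<rho> ** mat_A1 \<rho>) \<and>
          (\<forall>a b v. cubic a b (v v* (mat_A1 \<rho> ** mat_A1 \<rho>)) = cubic a (\<rho>\<^sup>2 * b) v)"
        by (simp add: g in_hessian_mult cubic_A1 power2_eq_square mult.assoc flip: vector_matrix_mul_assoc)
      ultimately show ?thesis using that by blast
    qed
    ultimately obtain W \<omega> where W: "in_hessian W" "\<And>a b v. cubic a b (v v* W) = cubic a (\<omega> * b) v"
      and \<omega>: "\<omega> * q = - 3 * p" by blast
    \<comment> \<open>W moves the triangle to x^3 + y^3 + z^3 - 3 x y z, and A2 moves the latter to x y z\<close>
    define h where "h = mat_A2 \<rho> ** W"
    have h: "in_hessian h" unfolding h_def by (intro in_hessian_mult W(1) in_hessian_gens) simp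
    have act: "cubic a b (v v* h) = cubic (3 * a + \<omega> * b) (18 * a - 3 * (\<omega> * b)) v" for a b v
      by (simp add: h_def W(2) cubic_A2 flip: vector_matrix_mul_assoc)
    have hP: "cubic 0 1 (v v* (h ** A)) = (27 * p) * cubic 0 1 v" for v
    proof -
      have "cubic 0 1 (v v* (h ** A)) = cubic p q (v v* h)"
        by (simp add: P flip: vector_matrix_mul_assoc)
      also have "\<dots> = cubic 0 (27 * p) v" by (simp add: act \<omega>)
      finally show ?thesis by (simp add: cubic_scale)
    qed
    have hS: "cubic 1 0 (v v* (h ** A)) = cubic (3 * p' + \<omega> * q') (18 * p' - 3 * (\<omega> * q')) v" for v
      by (simp add: S act flip: vector_matrix_mul_assoc)
    have "det (h ** A) \<noteq> 0"
      using A h by (simp add: det_mul in_hessian_def invertible_det_nz)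
    then have "in_hessian (h ** A)" using hP hS by (rule in_hessian_monomial)
    with h show ?thesis using A by (rule in_hessian_cancel)
  qed
qed


lemma objE6_iff: "t \<in> objE6 \<longleftrightarrow> t ^ 3 + 27 \<noteq> 0"
  by (simp add: objE6_def add_eq_0_iff2)

lemma moeb_P_simps: "t \<in> objE6 \<Longrightarrow> moeb_P \<rho> t = \<rho> * t"
  by (simp add: moeb_P_def moebius_def)

lemma moeb_R_simps: "t \<in> objE6 \<Longrightarrow> moeb_R t = (18 - 3 * t) / (3 + t)"
  by (simp add: moeb_R_def moebius_def add.commute)

lemma moeb_P_Bij: "moeb_P \<rho> \<in> Bij objE6"
proof -
  have "(\<rho>\<^sup>2) ^ 3 = (\<rho> ^ 3)\<^sup>2" by (simp flip: power_mult)
  then have "\<rho> * x \<in> objE6" "\<rho>\<^sup>2 * x \<in> objE6" if "x \<in> objE6" for x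
    using that rho_cube by (simp_all add: objE6_def power_mult_distrib)
  moreover have "\<rho>\<^sup>2 * (\<rho> * x) = x" "\<rho> * (\<rho>\<^sup>2 * x) = x" for x
    by (simp_all add: rho_inverse flip: mult.assoc)
  ultimately have "bij_betw (\<lambda>t. \<rho> * t) objE6 objE6"
    by (intro bij_betw_byWitness[where f' = "\<lambda>t. \<rho>\<^sup>2 * t"]) auto
  then have "bij_betw (moeb_P \<rho>) objE6 objE6"
    by (subst bij_betw_cong[of _ _ "\<lambda>t. \<rho> * t"]) (simp_all add: moeb_P_simps)
  then show ?thesis by (simp add: Bij_def moeb_P_def)
qed

lemma objE6_pole: "t \<in> objE6 \<Longrightarrow> 3 + t \<noteq> 0"
proof
  assume "t \<in> objE6" "3 + t = 0"
  then have "t = -3" by (simp add: add_eq_0_iff)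
  with \<open>t \<in> objE6\<close> show False by (simp add: objE6_def)
qed

lemma moeb_R_closed:
  assumes t: "t \<in> objE6"
  shows "(18 - 3 * t) / (3 + t) \<in> objE6"
proof -
  note n = objE6_pole[OF t]
  have "t ^ 3 + 27 = (3 + t) * (9 - 3 * t + t\<^sup>2)" by (simp add: power2_eq_square power3_eq_cube algebra_simps)
  with t have q: "9 - 3 * t + t\<^sup>2 \<noteq> 0" by (auto simp: objE6_iff)
  have "(18 - 3 * t) ^ 3 + 27 * (3 + t) ^ 3 = 729 * (9 - 3 * t + t\<^sup>2)"
    by (simp add: power2_eq_square power3_eq_cube algebra_simps)
  moreover have "((18 - 3 * t) / (3 + t)) ^ 3 + 27 = ((18 - 3 * t) ^ 3 + 27 * (3 + t) ^ 3) / (3 + t) ^ 3"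
    using n by (simp add: power_divide add_divide_distrib)
  ultimately have "((18 - 3 * t) / (3 + t)) ^ 3 + 27 = (729 * (9 - 3 * t + t\<^sup>2)) / (3 + t) ^ 3"
    by (simp only:)
  then have "((18 - 3 * t) / (3 + t)) ^ 3 + 27 \<noteq> 0"
    using n q by (simp only: divide_eq_0_iff mult_eq_0_iff power_eq_0_iff) simp
  then show ?thesis by (simp only: objE6_iff not_False_eq_True)
qed

lemma moeb_R_involution:
  assumes t: "t \<in> objE6"
  shows "(18 - 3 * ((18 - 3 * t) / (3 + t))) / (3 + (18 - 3 * t) / (3 + t)) = t"
proof -
  note n = objE6_pole[OF t]
  have "3 + (18 - 3 * t) / (3 + t) = 27 / (3 + t)" using n by (simp add: field_simps)
  moreover have "18 - 3 * ((18 - 3 * t) / (3 + t)) = 27 * t / (3 + t)" using n by (simp add: field_simps)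
  ultimately show ?thesis using n by simp
qed

lemma moeb_R_Bij: "moeb_R \<in> Bij objE6"
proof -
  have "bij_betw (\<lambda>t. (18 - 3 * t) / (3 + t)) objE6 objE6"
    by (intro bij_betw_byWitness[where f' = "\<lambda>t. (18 - 3 * t) / (3 + t)"])
      (use moeb_R_involution moeb_R_closed in blast)+
  then have "bij_betw moeb_R objE6 objE6"
    by (subst bij_betw_cong[of _ _ "\<lambda>t. (18 - 3 * t) / (3 + t)"]) (simp_all add: moeb_R_simps)
  then show ?thesis by (simp add: Bij_def moeb_R_def)
qed

lemma group_H: "group (H_E6 \<rho>)"
  unfolding H_E6_def by (rule group.group_subgroup_generated[OF group_BijGroup])

lemma carrier_H: "carrier (H_E6 \<rho>) \<subseteq> Bij objE6"
  using group.carrier_subgroup_generated_subset[OF group_BijGroup, of objE6 "{moeb_P \<rho>, moeb_R}"]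
  by (simp add: H_E6_def BijGroup_def)

lemma one_H: "\<one>\<^bsub>H_E6 \<rho>\<^esub> = (\<lambda>t\<in>objE6. t)"
  by (simp add: H_E6_def BijGroup_def)

lemma mult_H: "h \<in> carrier (H_E6 \<rho>) \<Longrightarrow> h' \<in> carrier (H_E6 \<rho>) \<Longrightarrow>
    h \<otimes>\<^bsub>H_E6 \<rho>\<^esub> h' = compose objE6 h h'"
  using carrier_H by (auto simp: H_E6_def BijGroup_def)

lemma gens_H: "moeb_P \<rho> \<in> carrier (H_E6 \<rho>)" "moeb_R \<in> carrier (H_E6 \<rho>)"
  using moeb_P_Bij moeb_R_Bij
  by (auto simp: H_E6_def carrier_subgroup_generated BijGroup_def intro: generate.incl)

definition represents :: "complex ^ 3 ^ 3 \<Rightarrow> (complex \<Rightarrow> complex) \<Rightarrow> bool" where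
  "represents A h \<longleftrightarrow> invertible A \<and> h \<in> carrier (H_E6 \<rho>) \<and> (\<forall>t\<in>objE6. cub_equiv A t (h t))"

lemma represents_one: "represents (mat 1) \<one>\<^bsub>H_E6 \<rho>\<^esub>"
  using group.is_monoid[OF group_H, THEN monoid.one_closed]
  by (simp add: represents_def cub_equiv_id invertible_mat one_H)

lemma H_maps: "h \<in> carrier (H_E6 \<rho>) \<Longrightarrow> t \<in> objE6 \<Longrightarrow> h t \<in> objE6"
  using carrier_H by (auto simp: Bij_def bij_betw_def)

lemma represents_mult:
  assumes "represents A h" "represents B h'"
  shows "represents (A ** B) (h \<otimes>\<^bsub>H_E6 \<rho>\<^esub> h')"
  using assms H_maps[of h'] group.is_monoid[OF group_H, THEN monoid.m_closed]
  by (auto simp: represents_def invertible_mult mult_H compose_def intro: cub_equiv_mult)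

lemma represents_inverse:
  assumes A: "represents A h" and B: "A ** B = mat 1"
  shows "represents B (inv\<^bsub>H_E6 \<rho>\<^esub> h)"
proof -
  let ?g = "inv\<^bsub>H_E6 \<rho>\<^esub> h"
  have h: "h \<in> carrier (H_E6 \<rho>)" using A by (simp add: represents_def)
  then have g: "?g \<in> carrier (H_E6 \<rho>)" by (rule group.inv_closed[OF group_H])
  have "cub_equiv B t (?g t)" if t: "t \<in> objE6" for t
  proof -
    have "h (?g t) = t"
      using group.r_inv[OF group_H h] t by (simp add: mult_H[OF h g] one_H compose_def fun_eq_iff) metis
    moreover have "cub_equiv A (?g t) (h (?g t))"
      using A H_maps[OF g t] by (simp add: represents_def)
    ultimately show ?thesis using cub_equiv_inverse[OF B] by simp
  qed
  moreover have "invertible B"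
    using B matrix_left_right_inverse[of A B] by (auto simp: invertible_def)
  ultimately show ?thesis using g by (simp add: represents_def)
qed

lemma represents_gens:
  "represents (mat_A1 \<rho>) (moeb_P \<rho>)" "represents (mat_A2 \<rho>) moeb_R"
  "represents mat_A3 \<one>\<^bsub>H_E6 \<rho>\<^esub>" "represents mat_A4 \<one>\<^bsub>H_E6 \<rho>\<^esub>"
proof -
  have one: "\<one>\<^bsub>H_E6 \<rho>\<^esub> \<in> carrier (H_E6 \<rho>)"
    using group.is_monoid[OF group_H] by (rule monoid.one_closed)
  show "represents mat_A3 \<one>\<^bsub>H_E6 \<rho>\<^esub>" "represents mat_A4 \<one>\<^bsub>H_E6 \<rho>\<^esub>"
    using one invertible_gens
    by (auto simp: represents_def one_H cub_equiv_def cubic_A34 intro!: exI[of _ 1])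
  show "represents (mat_A1 \<rho>) (moeb_P \<rho>)"
    using gens_H invertible_gens
    by (auto simp: represents_def moeb_P_simps cub_equiv_def cubic_A1 intro!: exI[of _ 1])
  have "cub_equiv (mat_A2 \<rho>) t (moeb_R t)" if t: "t \<in> objE6" for t
  proof -
    have "cubic 1 t (v v* mat_A2 \<rho>) = (3 + t) * cubic 1 (moeb_R t) v" for v
      using objE6_pole[OF t] by (simp add: cubic_A2 cubic_scale moeb_R_simps[OF t])
    then show ?thesis using objE6_pole[OF t] by (auto simp: cub_equiv_def)
  qed
  then show "represents (mat_A2 \<rho>) moeb_R"
    using gens_H invertible_gens by (simp add: represents_def)
qed

lemma hessian_represents:
  assumes "g \<in> carrier (G_E6 \<rho>)"
  shows "\<exists>A h. g = proj_class A \<and> represents A h"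
  using assms unfolding carrier_G
proof (induction rule: generate.induct)
  case one
  show ?case using represents_one one_PGL3 by blast
next
  case (incl g)
  then show ?case using represents_gens by blast
next
  case (inv g)
  then obtain A h where A: "g = proj_class A" "represents A h" using represents_gens by blast
  then obtain B where B: "A ** B = mat 1" by (auto simp: represents_def invertible_def)
  show ?case using inv_PGL3[OF B] represents_inverse[OF A(2) B] A(1) by metis
next
  case (eng g g')
  then obtain A h B h' where "g = proj_class A" "represents A h" "g' = proj_class B" "represents B h'"
    by blast
  then show ?case
    using represents_mult[of A h B h'] mult_PGL3[of A B] by (metis represents_def)
qed

text \<open>
  The parameter s is unique by cub_equiv_unique.
\<close>

definition pi_map :: "(complex ^ 3 ^ 3) set \<Rightarrow> complex \<Rightarrow> complex" where
  "pi_map g = (\<lambda>t\<in>objE6. THE s. \<exists>A\<in>g. cub_equiv A t s)"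

lemma pi_map_represents:
  assumes "represents A h"
  shows "pi_map (proj_class A) = h"
proof
  fix t
  have h: "h \<in> Bij objE6" using assms carrier_H by (auto simp: represents_def)
  show "pi_map (proj_class A) t = h t"
  proof (cases "t \<in> objE6")
    case True
    then have c: "cub_equiv A t (h t)" using assms by (simp add: represents_def)
    have "(THE s. \<exists>B\<in>proj_class A. cub_equiv B t s) = h t"
    proof (rule the_equality)
      show "\<exists>B\<in>proj_class A. cub_equiv B t (h t)" using c proj_class_self by blast
      fix s assume "\<exists>B\<in>proj_class A. cub_equiv B t s"
      then obtain B where B: "B \<in> proj_class A" "cub_equiv B t s" by blast
      then show "s = h t" using cub_equiv_unique cub_equiv_proj_class[OF c B(1)] by blast
    qed
    then show ?thesis using True by (simp add: pi_map_def)
  next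
    case False
    then show ?thesis using h by (simp add: pi_map_def Bij_def extensional_def)
  qed
qed

lemma pi_map_hom: "pi_map \<in> hom (G_E6 \<rho>) (H_E6 \<rho>)"
proof (rule homI)
  fix g assume "g \<in> carrier (G_E6 \<rho>)"
  then obtain A h where "g = proj_class A" "represents A h" using hessian_represents by blast
  then show "pi_map g \<in> carrier (H_E6 \<rho>)" by (simp add: pi_map_represents) (simp add: represents_def)
next
  fix g g' assume "g \<in> carrier (G_E6 \<rho>)" "g' \<in> carrier (G_E6 \<rho>)"
  then obtain A h B h' where *: "g = proj_class A" "represents A h" "g' = proj_class B" "represents B h'"
    using hessian_represents by metis
  then have "g \<otimes>\<^bsub>G_E6 \<rho>\<^esub> g' = proj_class (A ** B)"
    by (simp add: G_E6_def mult_PGL3 represents_def)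
  then show "pi_map (g \<otimes>\<^bsub>G_E6 \<rho>\<^esub> g') = pi_map g \<otimes>\<^bsub>H_E6 \<rho>\<^esub> pi_map g'"
    using * by (simp add: pi_map_represents represents_mult)
qed

text \<open>
  This is where all equivalences between members of the family are needed: by cub_equiv_in_hessian each of
  them comes from G, and then pi_map is computed by uniqueness of the target parameter.
\<close>

lemma pi_map_arrows:
  assumes t: "t \<in> objE6"
  shows "{g \<in> carrier (G_E6 \<rho>). pi_map g t = s} = proj_class ` {A. invertible A \<and> cub_equiv A t s}"
proof (intro equalityI subsetI)
  fix g assume "g \<in> {g \<in> carrier (G_E6 \<rho>). pi_map g t = s}"
  then obtain A h where "g = proj_class A" "represents A h" "pi_map g t = s"
    using hessian_represents by blast
  then show "g \<in> proj_class ` {A. invertible A \<and> cub_equiv A t s}"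
    using t by (auto simp: pi_map_represents) (auto simp: represents_def)
next
  fix g assume "g \<in> proj_class ` {A. invertible A \<and> cub_equiv A t s}"
  then obtain A where A: "g = proj_class A" "invertible A" "cub_equiv A t s" by blast
  then have g: "g \<in> carrier (G_E6 \<rho>)"
    using cub_equiv_in_hessian[OF A(2) t A(3)] by (simp add: in_hessian_def)
  then obtain B h where B: "g = proj_class B" "represents B h" using hessian_represents by blast
  have "A \<in> proj_class B" using proj_class_self[of A] A(1) B(1) by simp
  moreover have "cub_equiv B t (h t)" using B(2) t by (simp add: represents_def)
  ultimately have "cub_equiv A t (h t)" using cub_equiv_proj_class by blast
  then have "h t = s" using A(3) cub_equiv_unique by blast
  with g B show "g \<in> {g \<in> carrier (G_E6 \<rho>). pi_map g t = s}" by (simp add: pi_map_represents)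
qed

end

section \<open>The groupoid of the family as an action groupoid\<close>

definition subst_class :: "enat \<Rightarrow> complex \<Rightarrow> complex \<Rightarrow> complex ^ 3 ^ 3 \<Rightarrow> (ps3 set \<Rightarrow> ps3 set) set" where
  "subst_class k t s A = subst_map k t s ` proj_class A"

context
  fixes k :: enat and S :: "complex set"
  assumes S: "S \<subseteq> objE6"
    and adm_all: "\<forall>t\<in>S. \<forall>s\<in>S. \<forall>A. admissible k t s A \<longleftrightarrow> invertible A \<and> cub_equiv A t s"
begin

lemma adm: "t \<in> S \<Longrightarrow> s \<in> S \<Longrightarrow> admissible k t s A \<longleftrightarrow> invertible A \<and> cub_equiv A t s"
  using adm_all by blast

lemma admissible_proj_class:
  assumes "t \<in> S" "s \<in> S" "admissible k t s A" "B \<in> proj_class A"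
  shows "admissible k t s B"
proof -
  obtain c where "c \<noteq> 0" "B = mat c ** A" using assms(4) by (auto simp: proj_class_eq)
  then show ?thesis using assms cub_equiv_proj_class[of A t s B] by (auto simp: adm invertible_mult invertible_mat)
qed

lemma matrix_arrow_eq:
  assumes t: "t \<in> S" and s: "s \<in> S" and A: "admissible k t s A"
  shows "matrix_arrow k t s (proj_class A) = subst_class k t s A"
proof (intro equalityI subsetI)
  fix \<phi> assume \<phi>: "\<phi> \<in> matrix_arrow k t s (proj_class A)"
  then have "\<phi> \<in> graded_iso_E6 k t s" by (simp add: matrix_arrow_def)
  then obtain B where B: "admissible k t s B" "\<phi> = subst_map k t s B"
    using graded_iso_subst_map[of t s \<phi> k] t s S by blast
  from \<phi> obtain C where C: "C \<in> proj_class A"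
    "\<And>j. \<phi> (class_E6 k t (vars $ j)) = class_E6 k s (lin_form C j)"
    by (auto simp: matrix_arrow_def lin_form_def)
  have "B = C" using subst_map_inj[OF _ B(1)] C(2) B(2) s S by blast
  then show "\<phi> \<in> subst_class k t s A" using B(2) C(1) by (simp add: subst_class_def)
next
  fix \<phi> assume "\<phi> \<in> subst_class k t s A"
  then obtain B where B: "B \<in> proj_class A" "\<phi> = subst_map k t s B" by (auto simp: subst_class_def)
  then have "admissible k t s B" using admissible_proj_class t s A by blast
  then have "\<phi> \<in> graded_iso_E6 k t s" "\<And>j. \<phi> (class_E6 k t (vars $ j)) = class_E6 k s (lin_form B j)"
    using B(2) subst_map_graded_iso subst_map_class by auto
  then show "\<phi> \<in> matrix_arrow k t s (proj_class A)"
    using B(1) unfolding matrix_arrow_def lin_form_def by blast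
qed

lemma scale3_class:
  assumes t: "t \<in> S" and c: "c \<noteq> 0"
  shows "scale3 c ` class_E6 k t F = class_E6 k t (lin_subst (mat c) F)"
proof -
  have inv: "mat c ** mat (1 / c) = (mat 1 :: complex ^ 3 ^ 3)" using c by (simp add: mat_mult_mat)
  have "mat c \<in> proj_class (mat 1)" using c by (auto simp: proj_class_eq)
  then have a: "admissible k t t (mat c)"
    using t c cub_equiv_proj_class[OF cub_equiv_id] by (simp add: adm invertible_mat)
  show ?thesis
  proof (intro equalityI subsetI)
    fix H assume "H \<in> scale3 c ` class_E6 k t F"
    then obtain G where "G - F \<in> I_E6 k t" "H = lin_subst (mat c) G"
      by (auto simp: class_E6_set simp flip: lin_subst_scale)
    then show "H \<in> class_E6 k t (lin_subst (mat c) F)"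
      using a by (simp add: class_E6_set admissible_def flip: lin_subst_hom(2))
  next
    fix H assume "H \<in> class_E6 k t (lin_subst (mat c) F)"
    then have HI: "H - lin_subst (mat c) F \<in> I_E6 k t" by (simp add: class_E6_set)
    define G where "G = lin_subst (mat (1 / c)) H"
    have H: "lin_subst (mat c) G = H" by (simp add: G_def lin_subst_inverse[OF inv])
    have "lin_subst (mat c) (G - F) \<in> I_E6 k t" using HI by (simp add: H)
    then have "G - F \<in> I_E6 k t" using a unfolding admissible_def by blast
    then have "G \<in> class_E6 k t F" by (simp add: class_E6_set)
    then show "H \<in> scale3 c ` class_E6 k t F" using H by (auto simp flip: lin_subst_scale)
  qed
qed

lemma scalar_class_eq:
  assumes t: "t \<in> S" and s: "s \<in> S" and A: "admissible k t s A"
  shows "scalar_class k t (subst_map k t s A) = subst_class k t s A"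
proof -
  have scale: "(\<lambda>a\<in>carrier (A_E6 k t). subst_map k t s A (scale3 c ` a)) = subst_map k t s (mat c ** A)"
    if c: "c \<noteq> 0" for c
  proof
    fix a
    have "mat c ** A \<in> proj_class A" using c by (auto simp: proj_class_eq)
    then have cA: "admissible k t s (mat c ** A)" using admissible_proj_class t s A by blast
    show "(\<lambda>a\<in>carrier (A_E6 k t). subst_map k t s A (scale3 c ` a)) a = subst_map k t s (mat c ** A) a"
    proof (cases "a \<in> carrier (A_E6 k t)")
      case True
      then obtain F where "a = class_E6 k t F" by auto
      then show ?thesis
        by (simp add: scale3_class[OF t c] subst_map_class[OF A] lin_subst_lin_subst
            subst_map_class[OF cA[unfolded mat_mult_commute[of c A]]] mat_mult_commute[of c A])
    next
      case False
      then show ?thesis by (simp add: subst_map_def)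
    qed
  qed
  have "scalar_class k t (subst_map k t s A) =
      (\<lambda>c. \<lambda>a\<in>carrier (A_E6 k t). subst_map k t s A (scale3 c ` a)) ` {c. c \<noteq> 0}"
    unfolding scalar_class_def by blast
  also have "\<dots> = (\<lambda>c. subst_map k t s (mat c ** A)) ` {c. c \<noteq> 0}"
    by (rule image_cong) (use scale in blast)+
  also have "\<dots> = subst_class k t s A" unfolding subst_class_def proj_class_eq by blast
  finally show ?thesis .
qed

lemma subst_class_inj:
  assumes t: "t \<in> S" and s: "s \<in> S" and A: "admissible k t s A" and B: "admissible k t s B"
    and eq: "subst_class k t s A = subst_class k t s B"
  shows "proj_class A = proj_class B"
proof -
  have "subst_map k t s A \<in> subst_class k t s B"
    unfolding eq[symmetric] by (simp add: subst_class_def proj_class_self)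
  then obtain C where C: "C \<in> proj_class B" "subst_map k t s A = subst_map k t s C"
    by (auto simp: subst_class_def)
  then have "admissible k t s C" using admissible_proj_class t s B by blast
  then have "A = C" using s S by (intro subst_map_inj[OF _ A]) (auto simp: C(2) subst_map_class)
  then show ?thesis using C(1) proj_class_eqI by blast
qed

end

context cube_root_of_unity
begin

text \<open>
  An arrow of either groupoid from t to s is a projective class of matrices that carry f_t to a multiple of
  f_s: on one side by pi_map_arrows, on the other side by matrix_arrow_eq and scalar_class_eq.
\<close>

theorem groupoid_iso:
  assumes S: "S \<subseteq> objE6"
    and adm_all: "\<forall>t\<in>S. \<forall>s\<in>S. \<forall>A. admissible k t s A \<longleftrightarrow> invertible A \<and> cub_equiv A t s"
  shows "groupoid_iso_over_objs (matrix_arrow k) (action_groupoid (G_E6 \<rho>) pi_map S) (full_sub (Grp_E6 k) S)"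
proof -
  have adm: "admissible k t s A \<longleftrightarrow> invertible A \<and> cub_equiv A t s" if "t \<in> S" "s \<in> S" for t s A
    using adm_all that by blast
  note M = matrix_arrow_eq[OF S adm_all] and SC = scalar_class_eq[OF S adm_all]
  have arrows: "{g \<in> carrier (G_E6 \<rho>). pi_map g t = s} = proj_class ` {A. admissible k t s A}"
    if "t \<in> S" "s \<in> S" for t s
    using pi_map_arrows[of t s] that S by (auto simp: adm)
  have bij: "bij_betw (matrix_arrow k t s) {g \<in> carrier (G_E6 \<rho>). pi_map g t = s}
      (scalar_class k t ` graded_iso_E6 k t s)" if t: "t \<in> S" and s: "s \<in> S" for t s
  proof -
    have "inj_on (matrix_arrow k t s) (proj_class ` {A. admissible k t s A})"
    proof (rule inj_onI)
      fix g g' assume "g \<in> proj_class ` {A. admissible k t s A}" "g' \<in> proj_class ` {A. admissible k t s A}"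
        and eq: "matrix_arrow k t s g = matrix_arrow k t s g'"
      then obtain A B where A: "g = proj_class A" "admissible k t s A"
        and B: "g' = proj_class B" "admissible k t s B" by blast
      have "subst_class k t s A = subst_class k t s B"
        using eq unfolding A(1) B(1) M[OF t s A(2)] M[OF t s B(2)] .
      with subst_class_inj[OF S adm_all t s A(2) B(2)] A(1) B(1) show "g = g'" by simp
    qed
    moreover have "graded_iso_E6 k t s = subst_map k t s ` {A. admissible k t s A}"
      using graded_iso_subst_map[of t s _ k] subst_map_graded_iso[of k t s] t s S by blast
    then have "scalar_class k t ` graded_iso_E6 k t s = subst_class k t s ` {A. admissible k t s A}"
      by (simp add: image_image SC[OF t s] cong: image_cong_simp)
    moreover have "matrix_arrow k t s ` proj_class ` {A. admissible k t s A} =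
        subst_class k t s ` {A. admissible k t s A}"
      by (simp add: image_image M[OF t s] cong: image_cong_simp)
    ultimately show ?thesis by (simp add: arrows[OF t s] bij_betw_def)
  qed
  have ident: "matrix_arrow k t t \<one>\<^bsub>G_E6 \<rho>\<^esub> = scalar_class k t (\<lambda>a\<in>carrier (A_E6 k t). a)"
    if t: "t \<in> S" for t
  proof -
    have a: "admissible k t t (mat 1)" by (simp add: adm[OF t t] cub_equiv_id invertible_mat)
    have "subst_map k t t (mat 1) = (\<lambda>a\<in>carrier (A_E6 k t). a)"
    proof
      fix b show "subst_map k t t (mat 1) b = (\<lambda>a\<in>carrier (A_E6 k t). a) b"
      proof (cases "b \<in> carrier (A_E6 k t)")
        case True
        then show ?thesis using subst_map_class[OF a] by auto
      next
        case False
        then show ?thesis by (simp add: subst_map_def)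
      qed
    qed
    with SC[OF t t a] M[OF t t a] show ?thesis by (simp add: G_E6_def one_PGL3)
  qed
  have comp: "matrix_arrow k t u (b \<otimes>\<^bsub>G_E6 \<rho>\<^esub> a) =
      {compose (carrier (A_E6 k t)) \<psi> \<phi> | \<psi> \<phi>. \<psi> \<in> matrix_arrow k s u b \<and> \<phi> \<in> matrix_arrow k t s a}"
    if t: "t \<in> S" and s: "s \<in> S" and u: "u \<in> S" and "a \<in> proj_class ` {A. admissible k t s A}"
      "b \<in> proj_class ` {A. admissible k s u A}" for t s u a b
  proof -
    from that obtain A B where A: "a = proj_class A" "admissible k t s A"
      and B: "b = proj_class B" "admissible k s u B" by blast
    have BA: "admissible k t u (B ** A)"
      using A B cub_equiv_mult by (auto simp: adm t s u invertible_mult)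
    have prod: "b \<otimes>\<^bsub>G_E6 \<rho>\<^esub> a = proj_class (B ** A)"
      using A B by (simp add: G_E6_def mult_PGL3 admissible_def)
    have cp: "compose (carrier (A_E6 k t)) (subst_map k s u B') (subst_map k t s A') = subst_map k t u (B' ** A')"
      and in': "B' ** A' \<in> proj_class (B ** A)"
      if "A' \<in> proj_class A" "B' \<in> proj_class B" for A' B'
    proof -
      obtain c d where "A' = mat c ** A" "B' = mat d ** B" "c \<noteq> 0" "d \<noteq> 0"
        using \<open>A' \<in> proj_class A\<close> \<open>B' \<in> proj_class B\<close> by (auto simp: proj_class_eq)
      then have "B' ** A' = mat (d * c) ** (B ** A)" "d * c \<noteq> 0"
        by (simp_all add: matrix_mul_assoc flip: mat_mult_mat)
          (simp add: mat_mult_commute[of c B] flip: matrix_mul_assoc)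
      then show in': "B' ** A' \<in> proj_class (B ** A)" by (auto simp: proj_class_eq)
      show "compose (carrier (A_E6 k t)) (subst_map k s u B') (subst_map k t s A') = subst_map k t u (B' ** A')"
        using admissible_proj_class[OF S adm_all t s A(2) that(1)] admissible_proj_class[OF S adm_all s u B(2) that(2)]
          admissible_proj_class[OF S adm_all t u BA in'] by (rule subst_map_compose)
    qed
    have "subst_class k t u (B ** A) = {compose (carrier (A_E6 k t)) \<psi> \<phi> | \<psi> \<phi>.
        \<psi> \<in> subst_class k s u B \<and> \<phi> \<in> subst_class k t s A}" (is "?L = ?R")
    proof (intro equalityI subsetI)
      fix \<xi> assume "\<xi> \<in> ?L"
      then obtain c where c: "c \<noteq> 0" "\<xi> = subst_map k t u (mat c ** (B ** A))"
        by (auto simp: subst_class_def proj_class_eq)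
      have cB: "mat c ** B \<in> proj_class B" using c(1) by (auto simp: proj_class_eq)
      have "\<xi> = compose (carrier (A_E6 k t)) (subst_map k s u (mat c ** B)) (subst_map k t s A)"
        using cp[OF proj_class_self cB] c(2) by (simp add: matrix_mul_assoc)
      moreover have "subst_map k s u (mat c ** B) \<in> subst_class k s u B" "subst_map k t s A \<in> subst_class k t s A"
        unfolding subst_class_def using cB proj_class_self[of A] by blast+
      ultimately show "\<xi> \<in> ?R" by blast
    next
      fix \<xi> assume "\<xi> \<in> ?R"
      then obtain A' B' where AB': "A' \<in> proj_class A" "B' \<in> proj_class B"
        "\<xi> = compose (carrier (A_E6 k t)) (subst_map k s u B') (subst_map k t s A')"
        unfolding subst_class_def by blast
      then have "\<xi> = subst_map k t u (B' ** A')" using cp by simp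
      then show "\<xi> \<in> ?L" unfolding subst_class_def using in'[OF AB'(1,2)] by (rule image_eqI)
    qed
    then show ?thesis
      unfolding prod unfolding A(1) B(1) M[OF t u BA] M[OF t s A(2)] M[OF s u B(2)] .
  qed
  have "objE6 \<inter> S = S" using S by blast
  then show ?thesis
    unfolding groupoid_iso_over_objs_def action_groupoid_def full_sub_def Grp_E6_def
    using bij ident comp by (simp add: arrows)
qed

end

section \<open>The solvable Lie algebra\<close>

text \<open>
  An element x of the Lie algebra stands for the following data: x 0 is the coefficient e of the Euler
  derivation; x 1, x 2, x 3 and x 4, x 5, x 6 are vectors beta and w; x 7, x 8, x 9 is a vector n, read as a
  skew-symmetric matrix; x 10, ..., x 18 are the rows of a matrix M; x 19, x 20, x 21 is a covector zeta.
  Here e has degree zero, zeta has degree two, and beta, w, n, M have degree one.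
\<close>

definition g_pair :: "nat \<Rightarrow> (nat \<Rightarrow> complex) \<Rightarrow> (nat \<Rightarrow> complex) \<Rightarrow> complex" where
  "g_pair j x y = x 1 * y (10 + j) + x 2 * y (13 + j) + x 3 * y (16 + j) + x (4 + j) * y (1 + j) / 2 +
     [x 5 * y 9 - x 6 * y 8, x 6 * y 7 - x 4 * y 9, x 4 * y 8 - x 5 * y 7] ! j"

definition g_form :: "nat \<Rightarrow> (nat \<Rightarrow> complex) \<Rightarrow> (nat \<Rightarrow> complex) \<Rightarrow> complex" where
  "g_form j x y = g_pair j x y - g_pair j y x"

definition g_bracket :: "(nat \<Rightarrow> complex) \<Rightarrow> (nat \<Rightarrow> complex) \<Rightarrow> nat \<Rightarrow> complex" where
  "g_bracket x y = (\<lambda>n.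
     if n = 0 then 0
     else if n < 19 then x 0 * y n - y 0 * x n
     else if n < 22 then 2 * (x 0 * y n - y 0 * x n) + g_form (n - 19) x y
     else 0)"

definition g_E6 :: "(nat \<Rightarrow> complex) lie" where
  "g_E6 = \<lparr> carrier = {x. \<forall>n\<ge>22. x n = 0}, mult = (\<lambda>x y. undefined), one = undefined,
     ring.zero = (\<lambda>n. 0), add = (\<lambda>x y n. x n + y n), smult = (\<lambda>c x n. c * x n), lbracket = g_bracket \<rparr>"

lemma g_E6_simps [simp]:
  "carrier g_E6 = {x. \<forall>n\<ge>22. x n = 0}" "\<zero>\<^bsub>g_E6\<^esub> = (\<lambda>n. 0)" "x \<oplus>\<^bsub>g_E6\<^esub> y = (\<lambda>n. x n + y n)"
  "c \<odot>\<^bsub>g_E6\<^esub> x = (\<lambda>n. c * x n)" "lbracket g_E6 = g_bracket"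
  by (simp_all add: g_E6_def)

lemma less_3_cases: "j < 3 \<Longrightarrow> j = 0 \<or> j = 1 \<or> j = (2::nat)"
  by auto

lemma g_form_linear:
  assumes "j < 3"
  shows "g_form j (\<lambda>n. x n + y n) z = g_form j x z + g_form j y z"
    "g_form j (\<lambda>n. c * x n) z = c * g_form j x z"
    "g_form j x (\<lambda>n. y n + z n) = g_form j x y + g_form j x z"
    "g_form j x (\<lambda>n. c * y n) = c * g_form j x y"
    "g_form j x x = 0" "g_form j y x = - g_form j x y"
  using less_3_cases[OF assms]
  by (auto simp: g_form_def g_pair_def algebra_simps add_divide_distrib)

lemma g_form_bracket:
  assumes "j < 3"
  shows "g_form j x (g_bracket y z) = y 0 * g_form j x z - z 0 * g_form j x y"
proof -
  have "g_form j x (g_bracket y z) = g_form j x (\<lambda>n. y 0 * z n + (- z 0) * y n)"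
    using less_3_cases[OF assms] by (auto simp: g_form_def g_pair_def g_bracket_def)
  then show ?thesis by (simp only: g_form_linear(3,4)[OF assms]) simp
qed

lemma cring_complex_field: "cring complex_field"
  by (rule cring_from_type_algebra)

lemma complex_field_simps [simp]:
  "carrier complex_field = (UNIV :: complex set)" "\<one>\<^bsub>complex_field\<^esub> = (1 :: complex)"
  "a \<oplus>\<^bsub>complex_field\<^esub> b = a + (b :: complex)" "a \<otimes>\<^bsub>complex_field\<^esub> b = a * (b :: complex)"
  by (simp_all add: ring_of_type_algebra_def)

lemma module_g_E6: "Module.module complex_field g_E6"
proof (rule Module.moduleI)
  show "abelian_group g_E6"
  proof (rule abelian_groupI)
    fix x assume "x \<in> carrier g_E6"
    then show "\<exists>y\<in>carrier g_E6. y \<oplus>\<^bsub>g_E6\<^esub> x = \<zero>\<^bsub>g_E6\<^esub>"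
      by (intro bexI[of _ "\<lambda>n. - x n"]) auto
  qed (auto simp: algebra_simps)
qed (auto simp: cring_complex_field algebra_simps)

text \<open>
  In degree two the identity reduces to bilinear terms e g_form, whose factors cancel as 2 - 1 - 1 = 0.
\<close>

lemma jacobi_g_E6:
  "(\<lambda>n. g_bracket x (g_bracket y z) n + (g_bracket y (g_bracket z x) n + g_bracket z (g_bracket x y) n)) = (\<lambda>n. 0)"
proof
  fix n :: nat
  consider "n = 0" | "n \<noteq> 0" "n < 19" | "19 \<le> n" "n < 22" | "22 \<le> n" by linarith
  then show "g_bracket x (g_bracket y z) n + (g_bracket y (g_bracket z x) n + g_bracket z (g_bracket x y) n) = 0"
  proof cases
    case 1
    then show ?thesis by (simp add: g_bracket_def)
  next
    case 2
    then show ?thesis by (simp add: g_bracket_def algebra_simps)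
  next
    case 3
    then have j: "n - 19 < 3" by auto
    have top: "g_bracket x y n = 2 * (x 0 * y n - y 0 * x n) + g_form (n - 19) x y"
      and zero: "g_bracket x y 0 = 0" for x y
      using 3 by (simp_all add: g_bracket_def)
    show ?thesis
      unfolding top g_form_bracket[OF j] zero
        g_form_linear(6)[OF j, of x z] g_form_linear(6)[OF j, of y x] g_form_linear(6)[OF j, of z y]
      using g_form_linear(6)[OF j, of x y] g_form_linear(6)[OF j, of y z] g_form_linear(6)[OF j, of z x]
      by (simp add: algebra_simps)
  next
    case 4
    then show ?thesis by (simp add: g_bracket_def)
  qed
qed

lemma lie_algebra_g_E6: "lie_algebra g_E6"
  unfolding lie_algebra_def lie_algebra_axioms_def
  using module_g_E6 jacobi_g_E6
  by (auto simp: g_bracket_def g_form_linear(1-5) algebra_simps fun_eq_iff)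

lemma submodule_g_E6:
  assumes "S \<subseteq> carrier g_E6" "(\<lambda>n. 0) \<in> S" "\<And>x y. x \<in> S \<Longrightarrow> y \<in> S \<Longrightarrow> (\<lambda>n. x n + y n) \<in> S"
    "\<And>c x. x \<in> S \<Longrightarrow> (\<lambda>n. c * x n) \<in> S"
  shows "submodule S complex_field g_E6"
proof -
  interpret g: Module.module complex_field g_E6 by (rule module_g_E6)
  have inv: "\<ominus>\<^bsub>g_E6\<^esub> x = (\<lambda>n. - x n)" if "x \<in> carrier g_E6" for x
    using that by (intro g.minus_equality) auto
  show ?thesis
  proof (rule g.submoduleI)
    show "\<ominus>\<^bsub>g_E6\<^esub> x \<in> S" if "x \<in> S" for x
      using assms(4)[of x "-1"] inv[of x] that assms(1) by auto
  qed (use assms in auto)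
qed

lemma derived_sub_subset:
  assumes "submodule U complex_field L" "\<And>x y. x \<in> S \<Longrightarrow> y \<in> S \<Longrightarrow> lbracket L x y \<in> U"
  shows "derived_sub L S \<subseteq> U"
  unfolding derived_sub_def using assms by blast

lemma zero_in_derived_sub: "\<zero>\<^bsub>L\<^esub> \<in> derived_sub L S"
proof -
  have "\<zero>\<^bsub>L\<^esub> \<in> U" if "submodule U complex_field L" for U
  proof -
    from that interpret subgroup U "add_monoid L" by (rule submodule.axioms)
    show ?thesis using one_closed by simp
  qed
  then show ?thesis unfolding derived_sub_def by blast
qed

lemma solvable_g_E6: "solvable_lie g_E6"
proof -
  let ?U1 = "{x \<in> carrier g_E6. x 0 = 0}" and ?U2 = "{x \<in> carrier g_E6. \<forall>n<19. x n = 0}"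
  have 1: "derived_sub g_E6 (carrier g_E6) \<subseteq> ?U1"
    by (intro derived_sub_subset submodule_g_E6) (auto simp: g_bracket_def)
  have 2: "derived_sub g_E6 S \<subseteq> ?U2" if "S \<subseteq> ?U1" for S
  proof -
    have "g_bracket x y \<in> ?U2" if "x \<in> S" "y \<in> S" for x y
    proof -
      have "x 0 = 0" "y 0 = 0" using that \<open>S \<subseteq> ?U1\<close> by blast+
      then show ?thesis by (simp add: g_bracket_def)
    qed
    then show ?thesis by (intro derived_sub_subset submodule_g_E6) auto
  qed
  have U2: "g_bracket x y = (\<lambda>n. 0)" if "x \<in> ?U2" "y \<in> ?U2" for x y
  proof
    fix n
    have "g_form j x y = 0" if "j < 3" for j
      using less_3_cases[OF that] \<open>x \<in> ?U2\<close> \<open>y \<in> ?U2\<close> by (auto simp: g_form_def g_pair_def)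
    then show "g_bracket x y n = 0" using that by (auto simp: g_bracket_def)
  qed
  have 3: "derived_sub g_E6 S \<subseteq> {\<lambda>n. 0}" if "S \<subseteq> ?U2" for S
  proof -
    have "g_bracket x y = (\<lambda>n. 0)" if "x \<in> S" "y \<in> S" for x y
      using that \<open>S \<subseteq> ?U2\<close> U2 by blast
    then show ?thesis by (intro derived_sub_subset submodule_g_E6) auto
  qed
  have "(derived_sub g_E6 ^^ 3) (carrier g_E6) \<subseteq> {\<lambda>n. 0}"
    using 3[OF 2[OF 1]] by (simp add: numeral_3_eq_3 del: g_E6_simps)
  moreover have "\<zero>\<^bsub>g_E6\<^esub> \<in> (derived_sub g_E6 ^^ 3) (carrier g_E6)"
    using zero_in_derived_sub by (simp add: numeral_3_eq_3 del: g_E6_simps)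
  ultimately show ?thesis unfolding solvable_lie_def by (intro exI[of _ 3]) auto
qed

section \<open>The family of representations\<close>

text \<open>
  The action in the coordinates coord of O / m J. The entries of degree one of x give a linear map from the
  linear forms to the quadratic forms with components M (coefficients of squares) and N (values of eta).
  The matrix N has skew-symmetric part n. Its symmetric part is forced by beta and w, which give the
  induced map from quadratic to cubic forms: the entry at (i, j) is 3 w_k / 2 for {i, j, k} = {1, 2, 3} and
  (beta_i - t w_i) / 2 for i = j. The only occurrence of t contributes terms t w_i w'_i to a product of two
  such actions, which cancel in the commutator.
\<close>

definition g_act :: "complex \<Rightarrow> (nat \<Rightarrow> complex) \<Rightarrow> (nat \<Rightarrow> complex) \<Rightarrow> nat \<Rightarrow> complex" where
  "g_act t x u n = (if n < 11 then
     [0, x 0 * u 1, x 0 * u 2, x 0 * u 3,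
      2 * x 0 * u 4 + x 10 * u 1 + x 11 * u 2 + x 12 * u 3,
      2 * x 0 * u 5 + x 13 * u 1 + x 14 * u 2 + x 15 * u 3,
      2 * x 0 * u 6 + x 16 * u 1 + x 17 * u 2 + x 18 * u 3,
      2 * x 0 * u 7 + (x 1 - t * x 4) / 2 * u 1 + (3 / 2 * x 6 - x 9) * u 2 + (3 / 2 * x 5 + x 8) * u 3,
      2 * x 0 * u 8 + (3 / 2 * x 6 + x 9) * u 1 + (x 2 - t * x 5) / 2 * u 2 + (3 / 2 * x 4 - x 7) * u 3,
      2 * x 0 * u 9 + (3 / 2 * x 5 - x 8) * u 1 + (3 / 2 * x 4 + x 7) * u 2 + (x 3 - t * x 6) / 2 * u 3,
      3 * x 0 * u 10 + x 19 * u 1 + x 20 * u 2 + x 21 * u 3 + x 1 * u 4 + x 2 * u 5 + x 3 * u 6 +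
        x 4 * u 7 + x 5 * u 8 + x 6 * u 9] ! n else 0)"

section \<open>Coordinates on the first Yau algebra\<close>

lemma less_11_induct:
  assumes "n < (11::nat)" "P 0" "P 1" "P 2" "P 3" "P 4" "P 5" "P 6" "P 7" "P 8" "P 9" "P 10"
  shows "P n"
proof -
  have "n = 0 \<or> n = 1 \<or> n = 2 \<or> n = 3 \<or> n = 4 \<or> n = 5 \<or> n = 6 \<or> n = 7 \<or> n = 8 \<or> n = 9 \<or> n = 10"
    using assms(1) by presburger
  then show ?thesis using assms(2-) by blast
qed

definition coord :: "complex \<Rightarrow> ps3 \<Rightarrow> nat \<Rightarrow> complex" where
  "coord t F n = (if n < 11 then
     [coeff3 F 0 0 0, coeff3 F 1 0 0, coeff3 F 0 1 0, coeff3 F 0 0 1,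
      coeff3 F 2 0 0, coeff3 F 0 2 0, coeff3 F 0 0 2,
      eta t F $ 1, eta t F $ 2, eta t F $ 3, lam t F] ! n else 0)"

lemma coord_nth [simp]:
  "coord t F 0 = coeff3 F 0 0 0" "coord t F 1 = coeff3 F 1 0 0" "coord t F 2 = coeff3 F 0 1 0"
  "coord t F 3 = coeff3 F 0 0 1" "coord t F 4 = coeff3 F 2 0 0" "coord t F 5 = coeff3 F 0 2 0"
  "coord t F 6 = coeff3 F 0 0 2" "coord t F 7 = eta t F $ 1" "coord t F 8 = eta t F $ 2"
  "coord t F 9 = eta t F $ 3" "coord t F 10 = lam t F"
  "coord t F (Suc 0) = coeff3 F 1 0 0"
  by (simp_all add: coord_def del: eta_nth)

lemma coord_linear [simp]:
  "coord t (F + G) n = coord t F n + coord t G n"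
  "coord t (const3 c * F) n = c * coord t F n"
  "coord t 0 n = 0"
proof -
  have "coord t (F + G) n = coord t F n + coord t G n" if "n < 11"
    using that by (rule less_11_induct) (simp_all only: coord_nth eta_lam_linear vector_add_component coeff3_linear)
  moreover have "coord t (const3 c * F) n = c * coord t F n" if "n < 11"
    using that by (rule less_11_induct)
      (simp_all only: coord_nth eta_lam_linear vector_smult_component coeff3_linear)
  moreover have "coord t 0 n = 0" if "n < 11"
    using that by (rule less_11_induct) (simp_all only: coord_nth eta_lam_linear zero_index coeff3_linear)
  ultimately show "coord t (F + G) n = coord t F n + coord t G n"
    "coord t (const3 c * F) n = c * coord t F n" "coord t 0 n = 0"
    by (cases "n < 11"; simp add: coord_def del: coord_nth)+
qed

lemma coord_diff [simp]: "coord t (F - G) n = coord t F n - coord t G n"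
proof -
  have "F - G = F + const3 (- 1) * G" by simp
  then show ?thesis by (simp only: coord_linear) simp
qed

lemma coord_zero_iff: "(\<forall>n<11. coord t F n = 0) \<longleftrightarrow> F \<in> mjac_set t"
proof
  assume F: "F \<in> mjac_set t"
  have "coord t F n = 0" if "n < 11" for n
    using that by (rule less_11_induct)
      (use F in \<open>auto simp: mjac_set_def order_ge_coeff3\<close>)
  then show "\<forall>n<11. coord t F n = 0" by blast
next
  assume *: "\<forall>n<11. coord t F n = 0"
  have "coeff3 F 0 0 0 = 0" "coeff3 F 1 0 0 = 0" "coeff3 F 0 1 0 = 0" "coeff3 F 0 0 1 = 0"
    "coeff3 F 2 0 0 = 0" "coeff3 F 0 2 0 = 0" "coeff3 F 0 0 2 = 0"
    "eta t F $ 1 = 0" "eta t F $ 2 = 0" "eta t F $ 3 = 0" and l: "lam t F = 0"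
    using *[rule_format, of 0] *[rule_format, of 1] *[rule_format, of 2] *[rule_format, of 3]
      *[rule_format, of 4] *[rule_format, of 5] *[rule_format, of 6] *[rule_format, of 7]
      *[rule_format, of 8] *[rule_format, of 9] *[rule_format, of 10]
    by (simp_all del: eta_nth One_nat_def)
  then have c: "coeff3 F 0 0 0 = 0" "coeff3 F 1 0 0 = 0" "coeff3 F 0 1 0 = 0" "coeff3 F 0 0 1 = 0"
    "coeff3 F 2 0 0 = 0" "coeff3 F 0 2 0 = 0" "coeff3 F 0 0 2 = 0" "coeff3 F 0 1 1 = 0"
    "coeff3 F 1 0 1 = 0" "coeff3 F 1 1 0 = 0"
    by simp_all
  have "coeff3 F i j k = 0" if lt: "i + j + k < 3" for i j k
  proof -
    consider "i + j + k = 0" | "i + j + k = 1" | "i + j + k = 2" using less_3_cases[OF lt] by blast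
    then have "(i, j, k) \<in> {(0,0,0), (1,0,0), (0,1,0), (0,0,1), (2,0,0), (0,2,0), (0,0,2),
        (1,1,0), (1,0,1), (0,1,1)}"
    proof cases
      case 1
      then show ?thesis by simp
    next
      case 2
      then have "i = 1 \<and> j = 0 \<and> k = 0 \<or> i = 0 \<and> j = 1 \<and> k = 0 \<or> i = 0 \<and> j = 0 \<and> k = 1"
        by presburger
      then show ?thesis by (elim disjE conjE) simp_all
    next
      case 3
      from exponents_sum_2[OF 3] show ?thesis by (elim insertE emptyE) simp_all
    qed
    then show ?thesis by (elim insertE emptyE) (simp_all only: prod.inject c)
  qed
  then show "F \<in> mjac_set t" using l by (simp add: mjac_set_def order_ge_def)
qed

lemma class_eq_iff_coord:
  assumes t: "t \<in> objE6"
  shows "class_E6 1 t F = class_E6 1 t G \<longleftrightarrow> (\<forall>n<11. coord t F n = coord t G n)"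
proof -
  have "class_E6 1 t F = class_E6 1 t G \<longleftrightarrow> F - G \<in> mjac_set t"
    by (simp add: class_E6_eq_iff I_E6_1[OF t])
  then show ?thesis by (simp flip: coord_zero_iff)
qed

text \<open>
  The multiplication of O / m J in coordinates, see coord_product.
\<close>

definition coord_mult :: "complex \<Rightarrow> (nat \<Rightarrow> complex) \<Rightarrow> (nat \<Rightarrow> complex) \<Rightarrow> nat \<Rightarrow> complex" where
  "coord_mult t u v n = (if n < 11 then
     [u 0 * v 0,
      u 0 * v 1 + v 0 * u 1, u 0 * v 2 + v 0 * u 2, u 0 * v 3 + v 0 * u 3,
      u 0 * v 4 + v 0 * u 4 + u 1 * v 1, u 0 * v 5 + v 0 * u 5 + u 2 * v 2,
      u 0 * v 6 + v 0 * u 6 + u 3 * v 3,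
      u 0 * v 7 + v 0 * u 7 + 3 * (u 2 * v 3 + u 3 * v 2) - t * (u 1 * v 1),
      u 0 * v 8 + v 0 * u 8 + 3 * (u 1 * v 3 + u 3 * v 1) - t * (u 2 * v 2),
      u 0 * v 9 + v 0 * u 9 + 3 * (u 1 * v 2 + u 2 * v 1) - t * (u 3 * v 3),
      u 0 * v 10 + v 0 * u 10 + (u 1 * v 7 + u 2 * v 8 + u 3 * v 9) + (v 1 * u 7 + v 2 * u 8 + v 3 * u 9)]
     ! n else 0)"

lemma coord_mult_nth [simp]:
  "coord_mult t u v 0 = u 0 * v 0"
  "coord_mult t u v 1 = u 0 * v 1 + v 0 * u 1"
  "coord_mult t u v 2 = u 0 * v 2 + v 0 * u 2"
  "coord_mult t u v 3 = u 0 * v 3 + v 0 * u 3"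
  "coord_mult t u v 4 = u 0 * v 4 + v 0 * u 4 + u 1 * v 1"
  "coord_mult t u v 5 = u 0 * v 5 + v 0 * u 5 + u 2 * v 2"
  "coord_mult t u v 6 = u 0 * v 6 + v 0 * u 6 + u 3 * v 3"
  "coord_mult t u v 7 = u 0 * v 7 + v 0 * u 7 + 3 * (u 2 * v 3 + u 3 * v 2) - t * (u 1 * v 1)"
  "coord_mult t u v 8 = u 0 * v 8 + v 0 * u 8 + 3 * (u 1 * v 3 + u 3 * v 1) - t * (u 2 * v 2)"
  "coord_mult t u v 9 = u 0 * v 9 + v 0 * u 9 + 3 * (u 1 * v 2 + u 2 * v 1) - t * (u 3 * v 3)"
  "coord_mult t u v 10 = u 0 * v 10 + v 0 * u 10 + (u 1 * v 7 + u 2 * v 8 + u 3 * v 9) +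
     (v 1 * u 7 + v 2 * u 8 + v 3 * u 9)"
  "coord_mult t u v (Suc 0) = u 0 * v 1 + v 0 * u 1"
  by (simp_all add: coord_mult_def)

lemma coord_product: "coord t (F * G) n = coord_mult t (coord t F) (coord t G) n"
proof (cases "n < 11")
  case True
  then show ?thesis
    by (rule less_11_induct)
      (simp_all only: coord_nth coord_mult_nth coeff3_mult_le1 coeff3_mult_square eta_mult lam_mult,
       simp_all)
qed (simp add: coord_def coord_mult_def)

lemma coord_one: "coord t 1 n = (if n = 0 then 1 else 0)"
proof (cases "n < 11")
  case True
  then show ?thesis
    by (rule less_11_induct) (simp_all only: coord_nth eta_nth lam_def coeff3_one, simp_all)
qed (simp add: coord_def)

lemma coord_var:
  "coord t varX n = (if n = 1 then 1 else 0)"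
  "coord t varY n = (if n = 2 then 1 else 0)"
  "coord t varZ n = (if n = 3 then 1 else 0)"
proof -
  have "coord t varX n = (if n = 1 then 1 else 0) \<and> coord t varY n = (if n = 2 then 1 else 0) \<and>
      coord t varZ n = (if n = 3 then 1 else 0)" if "n < 11"
    using that by (rule less_11_induct) (simp_all only: coord_nth eta_nth lam_def coeff3_var, simp_all)
  then show "coord t varX n = (if n = 1 then 1 else 0)"
    "coord t varY n = (if n = 2 then 1 else 0)" "coord t varZ n = (if n = 3 then 1 else 0)"
    by (cases "n < 11"; simp add: coord_def del: coord_nth)+
qed

text \<open>
  A polynomial with prescribed coordinates, see coord_poly_of.
\<close>

definition poly_of :: "complex \<Rightarrow> (nat \<Rightarrow> complex) \<Rightarrow> ps3" where
  "poly_of t u = const3 (u 0) * monom3 0 0 0 + const3 (u 1) * monom3 1 0 0 + const3 (u 2) * monom3 0 1 0 +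
     const3 (u 3) * monom3 0 0 1 + const3 (u 4) * monom3 2 0 0 + const3 (u 5) * monom3 0 2 0 +
     const3 (u 6) * monom3 0 0 2 + const3 ((u 7 + t * u 4) / 3) * monom3 0 1 1 +
     const3 ((u 8 + t * u 5) / 3) * monom3 1 0 1 + const3 ((u 9 + t * u 6) / 3) * monom3 1 1 0 +
     const3 (u 10 / 3) * monom3 1 1 1"

lemma coord_poly_of [simp]: "n < 11 \<Longrightarrow> coord t (poly_of t u) n = u n"
  by (erule less_11_induct)
    (simp_all only: coord_nth eta_nth lam_def poly_of_def coeff3_linear coeff3_monom3, simp_all)

section \<open>The derivations of the first Yau algebra\<close>

lemma g_act_nth:
  "g_act t x u 0 = 0" "g_act t x u 1 = x 0 * u 1" "g_act t x u 2 = x 0 * u 2" "g_act t x u 3 = x 0 * u 3"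
  "g_act t x u 4 = 2 * x 0 * u 4 + x 10 * u 1 + x 11 * u 2 + x 12 * u 3"
  "g_act t x u 5 = 2 * x 0 * u 5 + x 13 * u 1 + x 14 * u 2 + x 15 * u 3"
  "g_act t x u 6 = 2 * x 0 * u 6 + x 16 * u 1 + x 17 * u 2 + x 18 * u 3"
  "g_act t x u 7 = 2 * x 0 * u 7 + (x 1 - t * x 4) / 2 * u 1 + (3 / 2 * x 6 - x 9) * u 2 + (3 / 2 * x 5 + x 8) * u 3"
  "g_act t x u 8 = 2 * x 0 * u 8 + (3 / 2 * x 6 + x 9) * u 1 + (x 2 - t * x 5) / 2 * u 2 + (3 / 2 * x 4 - x 7) * u 3"
  "g_act t x u 9 = 2 * x 0 * u 9 + (3 / 2 * x 5 - x 8) * u 1 + (3 / 2 * x 4 + x 7) * u 2 + (x 3 - t * x 6) / 2 * u 3"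
  "g_act t x u 10 = 3 * x 0 * u 10 + x 19 * u 1 + x 20 * u 2 + x 21 * u 3 + x 1 * u 4 + x 2 * u 5 + x 3 * u 6 +
        x 4 * u 7 + x 5 * u 8 + x 6 * u 9"
  by (simp_all add: g_act_def)

text \<open>
  With beta and w written as doubles, the identities for g_act have no denominators.
\<close>

lemma obtain_halves:
  fixes x :: "nat \<Rightarrow> complex"
  obtains a1 a2 a3 a4 a5 a6 where "x 1 = 2 * a1" "x 2 = 2 * a2" "x 3 = 2 * a3" "x 4 = 2 * a4"
    "x 5 = 2 * a5" "x 6 = 2 * a6"
  by (rule that[of "x 1 / 2" "x 2 / 2" "x 3 / 2" "x 4 / 2" "x 5 / 2" "x 6 / 2"]) simp_all

lemma cancel_halves:
  "(2 * a - t * (2 * b)) / 2 = a - t * (b :: complex)" "3 / 2 * (2 * a) = 3 * a" "2 * a * (2 * b) / 2 = 2 * a * b"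
  for a b t :: complex
  by (simp_all add: field_simps)

lemma g_act_derivation:
  assumes n: "n < 11"
  shows "g_act t x (coord_mult t u v) n = coord_mult t (g_act t x u) v n + coord_mult t u (g_act t x v) n"
proof -
  obtain a1 a2 a3 a4 a5 a6 where a: "x 1 = 2 * a1" "x 2 = 2 * a2" "x 3 = 2 * a3" "x 4 = 2 * a4"
    "x 5 = 2 * a5" "x 6 = 2 * a6" by (rule obtain_halves)
  from n show ?thesis
    by (rule less_11_induct; simp only: g_act_nth coord_mult_nth a cancel_halves; simp only: algebra_simps mult_zero_left mult_zero_right add_0 add_0_right; simp)
qed

lemma g_act_cong: "(\<And>n. n < 11 \<Longrightarrow> u n = v n) \<Longrightarrow> g_act t x u = g_act t x v"
  by (simp add: g_act_def fun_eq_iff)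

lemma g_act_linear:
  "n < 11 \<Longrightarrow> g_act t (\<lambda>n. x n + y n) u n = g_act t x u n + g_act t y u n"
  "n < 11 \<Longrightarrow> g_act t (\<lambda>n. c * x n) u n = c * g_act t x u n"
  "n < 11 \<Longrightarrow> g_act t x (\<lambda>n. u n + v n) n = g_act t x u n + g_act t x v n"
  "n < 11 \<Longrightarrow> g_act t x (\<lambda>n. c * u n) n = c * g_act t x u n"
  by (erule less_11_induct; simp only: g_act_nth; simp add: algebra_simps add_divide_distrib diff_divide_distrib)+

lemma g_bracket_nth:
  "g_bracket x y 0 = 0" "g_bracket x y 1 = x 0 * y 1 - y 0 * x 1" "g_bracket x y 2 = x 0 * y 2 - y 0 * x 2"
  "g_bracket x y 3 = x 0 * y 3 - y 0 * x 3" "g_bracket x y 4 = x 0 * y 4 - y 0 * x 4"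
  "g_bracket x y 5 = x 0 * y 5 - y 0 * x 5" "g_bracket x y 6 = x 0 * y 6 - y 0 * x 6"
  "g_bracket x y 7 = x 0 * y 7 - y 0 * x 7" "g_bracket x y 8 = x 0 * y 8 - y 0 * x 8"
  "g_bracket x y 9 = x 0 * y 9 - y 0 * x 9" "g_bracket x y 10 = x 0 * y 10 - y 0 * x 10"
  "g_bracket x y 11 = x 0 * y 11 - y 0 * x 11" "g_bracket x y 12 = x 0 * y 12 - y 0 * x 12"
  "g_bracket x y 13 = x 0 * y 13 - y 0 * x 13" "g_bracket x y 14 = x 0 * y 14 - y 0 * x 14"
  "g_bracket x y 15 = x 0 * y 15 - y 0 * x 15" "g_bracket x y 16 = x 0 * y 16 - y 0 * x 16"
  "g_bracket x y 17 = x 0 * y 17 - y 0 * x 17" "g_bracket x y 18 = x 0 * y 18 - y 0 * x 18"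
  "g_bracket x y 19 = 2 * (x 0 * y 19 - y 0 * x 19) + g_form 0 x y"
  "g_bracket x y 20 = 2 * (x 0 * y 20 - y 0 * x 20) + g_form 1 x y"
  "g_bracket x y 21 = 2 * (x 0 * y 21 - y 0 * x 21) + g_form 2 x y"
  by (simp_all add: g_bracket_def)

lemma g_form_nth:
  "g_form 0 x y = (x 1 * y 10 + x 2 * y 13 + x 3 * y 16 + x 4 * y 1 / 2 + (x 5 * y 9 - x 6 * y 8)) -
     (y 1 * x 10 + y 2 * x 13 + y 3 * x 16 + y 4 * x 1 / 2 + (y 5 * x 9 - y 6 * x 8))"
  "g_form 1 x y = (x 1 * y 11 + x 2 * y 14 + x 3 * y 17 + x 5 * y 2 / 2 + (x 6 * y 7 - x 4 * y 9)) -
     (y 1 * x 11 + y 2 * x 14 + y 3 * x 17 + y 5 * x 2 / 2 + (y 6 * x 7 - y 4 * x 9))"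
  "g_form 2 x y = (x 1 * y 12 + x 2 * y 15 + x 3 * y 18 + x 6 * y 3 / 2 + (x 4 * y 8 - x 5 * y 7)) -
     (y 1 * x 12 + y 2 * x 15 + y 3 * x 18 + y 6 * x 3 / 2 + (y 4 * x 8 - y 5 * x 7))"
  by (simp_all add: g_form_def g_pair_def numeral_eq_Suc)

lemma g_act_bracket:
  assumes n: "n < 11"
  shows "g_act t (g_bracket x y) u n = g_act t x (g_act t y u) n - g_act t y (g_act t x u) n"
proof -
  obtain a1 a2 a3 a4 a5 a6 where a: "x 1 = 2 * a1" "x 2 = 2 * a2" "x 3 = 2 * a3" "x 4 = 2 * a4"
    "x 5 = 2 * a5" "x 6 = 2 * a6" by (rule obtain_halves)
  obtain b1 b2 b3 b4 b5 b6 where b: "y 1 = 2 * b1" "y 2 = 2 * b2" "y 3 = 2 * b3" "y 4 = 2 * b4"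
    "y 5 = 2 * b5" "y 6 = 2 * b6" by (rule obtain_halves)
  from n show ?thesis
    by (rule less_11_induct; simp only: g_act_nth g_bracket_nth g_form_nth a b cancel_halves; simp add: algebra_simps)
qed

lemma g_act_faithful:
  assumes "x \<in> carrier g_E6" "y \<in> carrier g_E6"
    and eq: "\<And>u n. n < 11 \<Longrightarrow> g_act t x u n = g_act t y u n"
  shows "x = y"
proof
  fix n :: nat
  \<comment> \<open>the components of x are read off from the action on basis vectors\<close>
  let ?e = "\<lambda>m n. if n = (m::nat) then 1 else (0::complex)"
  have "x 0 = y 0" using eq[of 1 "?e 1"] by (simp only: g_act_nth) simp
  moreover have "x 1 = y 1" "x 2 = y 2" "x 3 = y 3" "x 4 = y 4" "x 5 = y 5" "x 6 = y 6"
    "x 19 = y 19" "x 20 = y 20" "x 21 = y 21"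
    using eq[of 10 "?e 4"] eq[of 10 "?e 5"] eq[of 10 "?e 6"] eq[of 10 "?e 7"] eq[of 10 "?e 8"]
      eq[of 10 "?e 9"] eq[of 10 "?e 1"] eq[of 10 "?e 2"] eq[of 10 "?e 3"]
    by (simp_all only: g_act_nth) simp_all
  moreover have "x 10 = y 10" "x 11 = y 11" "x 12 = y 12" "x 13 = y 13" "x 14 = y 14" "x 15 = y 15"
    "x 16 = y 16" "x 17 = y 17" "x 18 = y 18"
    using eq[of 4 "?e 1"] eq[of 4 "?e 2"] eq[of 4 "?e 3"] eq[of 5 "?e 1"] eq[of 5 "?e 2"] eq[of 5 "?e 3"]
      eq[of 6 "?e 1"] eq[of 6 "?e 2"] eq[of 6 "?e 3"]
    by (simp_all only: g_act_nth) simp_all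
  moreover have "3 / 2 * x 4 + x 7 = 3 / 2 * y 4 + y 7" "3 / 2 * x 5 + x 8 = 3 / 2 * y 5 + y 8"
    "3 / 2 * x 6 + x 9 = 3 / 2 * y 6 + y 9"
    using eq[of 9 "?e 2"] eq[of 7 "?e 3"] eq[of 8 "?e 1"]
    by (simp_all only: g_act_nth) simp_all
  moreover have "n = 0 \<or> n = 1 \<or> n = 2 \<or> n = 3 \<or> n = 4 \<or> n = 5 \<or> n = 6 \<or> n = 7 \<or> n = 8 \<or> n = 9 \<or> n = 10 \<or>
      n = 11 \<or> n = 12 \<or> n = 13 \<or> n = 14 \<or> n = 15 \<or> n = 16 \<or> n = 17 \<or> n = 18 \<or> n = 19 \<or> n = 20 \<or> n = 21 \<or> 22 \<le> n"
    by presburger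
  ultimately show "x n = y n" using assms(1,2) by (elim disjE) simp_all
qed

lemma order_ge_4_subset_mjac_set: "order_ge 4 \<subseteq> mjac_set t"
  using order_ge_mono[of 3 4] by (auto simp: mjac_set_def lam_def order_ge_coeff3[of _ 4])

text \<open>
  The derivation of O / m J that corresponds to an element of the Lie algebra.
\<close>

definition psi_E6 :: "complex \<Rightarrow> (nat \<Rightarrow> complex) \<Rightarrow> ps3 set \<Rightarrow> ps3 set" where
  "psi_E6 t x = (\<lambda>a\<in>carrier (A_E6 1 t).
     class_E6 1 t (poly_of t (g_act t x (coord t (SOME F. class_E6 1 t F = a)))))"

lemma psi_class:
  assumes t: "t \<in> objE6"
  shows "psi_E6 t x (class_E6 1 t F) = class_E6 1 t (poly_of t (g_act t x (coord t F)))"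
proof -
  define G where "G = (SOME G. class_E6 1 t G = class_E6 1 t F)"
  have "class_E6 1 t G = class_E6 1 t F" unfolding G_def by (rule someI[of _ F]) simp
  then have "\<And>n. n < 11 \<Longrightarrow> coord t G n = coord t F n" using class_eq_iff_coord[OF t] by blast
  then have "g_act t x (coord t G) = g_act t x (coord t F)" by (rule g_act_cong)
  then show ?thesis by (simp add: psi_E6_def G_def)
qed

lemma poly_of_coord:
  assumes t: "t \<in> objE6"
  shows "class_E6 1 t (poly_of t (coord t F)) = class_E6 1 t F"
  by (simp add: class_eq_iff_coord[OF t] del: coord_nth)

lemma coord_mult_cong:
  "(\<And>n. n < 11 \<Longrightarrow> u n = u' n) \<Longrightarrow> (\<And>n. n < 11 \<Longrightarrow> v n = v' n) \<Longrightarrow> coord_mult t u v = coord_mult t u' v'"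
  by (simp add: coord_mult_def fun_eq_iff)

lemma coord_fun:
  "coord t (F + G) = (\<lambda>n. coord t F n + coord t G n)" "coord t (const3 c * F) = (\<lambda>n. c * coord t F n)"
  "coord t (F * G) = coord_mult t (coord t F) (coord t G)"
  by (rule ext, rule coord_linear coord_product)+

lemma psi_derivation:
  assumes t: "t \<in> objE6"
  shows "psi_E6 t x \<in> derivations (A_E6 1 t)"
proof -
  have add: "psi_E6 t x (class_E6 1 t F \<oplus>\<^bsub>A_E6 1 t\<^esub> class_E6 1 t G) =
      psi_E6 t x (class_E6 1 t F) \<oplus>\<^bsub>A_E6 1 t\<^esub> psi_E6 t x (class_E6 1 t G)" for F G
    by (simp add: psi_class[OF t] class_eq_iff_coord[OF t] coord_fun(1) g_act_linear del: coord_nth)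
  have smult: "psi_E6 t x (c \<odot>\<^bsub>A_E6 1 t\<^esub> class_E6 1 t F) = c \<odot>\<^bsub>A_E6 1 t\<^esub> psi_E6 t x (class_E6 1 t F)" for c F
    by (simp add: psi_class[OF t] class_eq_iff_coord[OF t] coord_fun(2) g_act_linear del: coord_nth)
  have mult: "psi_E6 t x (class_E6 1 t F \<otimes>\<^bsub>A_E6 1 t\<^esub> class_E6 1 t G) =
      (psi_E6 t x (class_E6 1 t F) \<otimes>\<^bsub>A_E6 1 t\<^esub> class_E6 1 t G) \<oplus>\<^bsub>A_E6 1 t\<^esub>
      (class_E6 1 t F \<otimes>\<^bsub>A_E6 1 t\<^esub> psi_E6 t x (class_E6 1 t G))" for F G
  proof -
    have "coord_mult t (coord t (poly_of t (g_act t x (coord t F)))) (coord t G) =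
        coord_mult t (g_act t x (coord t F)) (coord t G)"
      "coord_mult t (coord t F) (coord t (poly_of t (g_act t x (coord t G)))) =
        coord_mult t (coord t F) (g_act t x (coord t G))"
      by (intro coord_mult_cong; simp del: coord_nth)+
    then show ?thesis
      by (simp add: psi_class[OF t] class_eq_iff_coord[OF t] coord_fun(3) g_act_derivation del: coord_nth)
  qed
  have "psi_E6 t x \<in> carrier (A_E6 1 t) \<rightarrow>\<^sub>E carrier (A_E6 1 t)"
    by (auto simp: psi_class[OF t] psi_E6_def[abs_def] intro: psi_class[OF t])
  then show ?thesis
    unfolding derivations_def using add smult mult by auto
qed

lemma derivation_coordinates:
  assumes t: "t \<in> objE6" and D: "D \<in> derivations (A_E6 1 t)"
  obtains \<Delta> where "\<And>F. D (class_E6 1 t F) = class_E6 1 t (poly_of t (\<Delta> F))"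
    "\<And>F G n. n < 11 \<Longrightarrow> \<Delta> (F + G) n = \<Delta> F n + \<Delta> G n"
    "\<And>c F n. n < 11 \<Longrightarrow> \<Delta> (const3 c * F) n = c * \<Delta> F n"
    "\<And>F G n. n < 11 \<Longrightarrow> \<Delta> (F * G) n = coord_mult t (\<Delta> F) (coord t G) n + coord_mult t (coord t F) (\<Delta> G) n"
    "\<And>F n. n < 11 \<Longrightarrow> F \<in> mjac_set t \<Longrightarrow> \<Delta> F n = 0"
proof -
  have "D \<in> carrier (A_E6 1 t) \<rightarrow> carrier (A_E6 1 t)" using D by (auto simp: derivations_def)
  then have "\<exists>G. D (class_E6 1 t F) = class_E6 1 t G" for F by (auto simp: Pi_iff)
  then obtain \<delta> where \<delta>: "\<And>F. D (class_E6 1 t F) = class_E6 1 t (\<delta> F)" by metis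
  have add: "D (class_E6 1 t F \<oplus>\<^bsub>A_E6 1 t\<^esub> class_E6 1 t G) =
      D (class_E6 1 t F) \<oplus>\<^bsub>A_E6 1 t\<^esub> D (class_E6 1 t G)"
    and smult: "D (c \<odot>\<^bsub>A_E6 1 t\<^esub> class_E6 1 t F) = c \<odot>\<^bsub>A_E6 1 t\<^esub> D (class_E6 1 t F)"
    and mult: "D (class_E6 1 t F \<otimes>\<^bsub>A_E6 1 t\<^esub> class_E6 1 t G) =
      (D (class_E6 1 t F) \<otimes>\<^bsub>A_E6 1 t\<^esub> class_E6 1 t G) \<oplus>\<^bsub>A_E6 1 t\<^esub>
      (class_E6 1 t F \<otimes>\<^bsub>A_E6 1 t\<^esub> D (class_E6 1 t G))" for F G c
    using D unfolding derivations_def by auto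
  have add': "coord t (\<delta> (F + G)) n = coord t (\<delta> F) n + coord t (\<delta> G) n" if "n < 11" for F G n
    using add[of F G] that by (simp add: \<delta> class_eq_iff_coord[OF t] del: coord_nth)
  have smult': "coord t (\<delta> (const3 c * F)) n = c * coord t (\<delta> F) n" if "n < 11" for F c n
    using smult[of c F] that by (simp add: \<delta> class_eq_iff_coord[OF t] del: coord_nth)
  have mult': "coord t (\<delta> (F * G)) n =
      coord_mult t (coord t (\<delta> F)) (coord t G) n + coord_mult t (coord t F) (coord t (\<delta> G)) n"
    if "n < 11" for F G n
    using mult[of F G] that by (simp add: \<delta> class_eq_iff_coord[OF t] coord_product del: coord_nth)
  have zero: "coord t (\<delta> F) n = 0" if "n < 11" "F \<in> mjac_set t" for F n
  proof -
    have "class_E6 1 t F = class_E6 1 t (const3 0 * 1)"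
      using that(2) by (simp add: class_E6_eq_iff I_E6_1[OF t])
    then have "class_E6 1 t (\<delta> F) = class_E6 1 t (\<delta> (const3 0 * 1))" by (metis \<delta>)
    then have "coord t (\<delta> F) n = coord t (\<delta> (const3 0 * 1)) n"
      using that(1) class_eq_iff_coord[OF t] by blast
    then show ?thesis using smult'[OF that(1), of 0 1] by simp
  qed
  show ?thesis
    by (rule that[of "\<lambda>F. coord t (\<delta> F)"])
      (simp only: \<delta> poly_of_coord[OF t], simp only: add', simp only: smult', simp only: mult', simp only: zero)
qed

text \<open>
  The element whose derivation maps x, y, z to the classes with coordinates a, b, c. The formulas solve the
  equations in g_act for e, beta, w, n, M, zeta.
\<close>

definition derivation_element :: "complex \<Rightarrow> (nat \<Rightarrow> complex) \<Rightarrow> (nat \<Rightarrow> complex) \<Rightarrow> (nat \<Rightarrow> complex) \<Rightarrow> nat \<Rightarrow> complex" where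
  "derivation_element t a b c n = (if n < 22 then
     [a 1,
      2 * a 7 + t * ((b 9 + c 8) / 3), 2 * b 8 + t * ((a 9 + c 7) / 3), 2 * c 9 + t * ((a 8 + b 7) / 3),
      (b 9 + c 8) / 3, (a 9 + c 7) / 3, (a 8 + b 7) / 3,
      (b 9 - c 8) / 2, (c 7 - a 9) / 2, (a 8 - b 7) / 2,
      a 4, b 4, c 4, a 5, b 5, c 5, a 6, b 6, c 6,
      a 10, b 10, c 10] ! n else 0)"

lemma derivation_element_nth:
  "derivation_element t a b c 0 = a 1"
  "derivation_element t a b c 1 = 2 * a 7 + t * ((b 9 + c 8) / 3)"
  "derivation_element t a b c 2 = 2 * b 8 + t * ((a 9 + c 7) / 3)"
  "derivation_element t a b c 3 = 2 * c 9 + t * ((a 8 + b 7) / 3)"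
  "derivation_element t a b c 4 = (b 9 + c 8) / 3"
  "derivation_element t a b c 5 = (a 9 + c 7) / 3"
  "derivation_element t a b c 6 = (a 8 + b 7) / 3"
  "derivation_element t a b c 7 = (b 9 - c 8) / 2"
  "derivation_element t a b c 8 = (c 7 - a 9) / 2"
  "derivation_element t a b c 9 = (a 8 - b 7) / 2"
  "derivation_element t a b c 10 = a 4" "derivation_element t a b c 11 = b 4" "derivation_element t a b c 12 = c 4"
  "derivation_element t a b c 13 = a 5" "derivation_element t a b c 14 = b 5" "derivation_element t a b c 15 = c 5"
  "derivation_element t a b c 16 = a 6" "derivation_element t a b c 17 = b 6" "derivation_element t a b c 18 = c 6"
  "derivation_element t a b c 19 = a 10" "derivation_element t a b c 20 = b 10" "derivation_element t a b c 21 = c 10"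
  by (simp_all add: derivation_element_def)

lemma g_act_derivation_element:
  assumes a: "a 0 = 0" "a 2 = 0" "a 3 = 0" and b: "b 0 = 0" "b 1 = 0" "b 2 = a 1" "b 3 = 0"
    and c: "c 0 = 0" "c 1 = 0" "c 2 = 0" "c 3 = a 1" and n: "n < 11"
  shows "g_act t (derivation_element t a b c) (coord t varX) n = a n"
    "g_act t (derivation_element t a b c) (coord t varY) n = b n"
    "g_act t (derivation_element t a b c) (coord t varZ) n = c n"
proof -
  show "g_act t (derivation_element t a b c) (coord t varX) n = a n"
    using n by (rule less_11_induct)
      (simp_all only: g_act_nth derivation_element_nth coord_var,
     simp_all add: a b c b(2)[unfolded One_nat_def] c(2)[unfolded One_nat_def] field_simps)
  show "g_act t (derivation_element t a b c) (coord t varY) n = b n"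
    using n by (rule less_11_induct)
      (simp_all only: g_act_nth derivation_element_nth coord_var,
     simp_all add: a b c b(2)[unfolded One_nat_def] c(2)[unfolded One_nat_def] field_simps)
  show "g_act t (derivation_element t a b c) (coord t varZ) n = c n"
    using n by (rule less_11_induct)
      (simp_all only: g_act_nth derivation_element_nth coord_var,
     simp_all add: a b c b(2)[unfolded One_nat_def] c(2)[unfolded One_nat_def] field_simps)
qed

lemma cyclic_zero:
  fixes x y z t :: complex
  assumes "t ^ 3 \<noteq> 216" "6 * x = t * y" "6 * y = t * z" "6 * z = t * x"
  shows "x = 0" "y = 0" "z = 0"
proof -
  have *: "x = 0" if "6 * x = t * y" "6 * y = t * z" "6 * z = t * x" for x y z
  proof -
    have "t ^ 3 * x = 216 * x" using that by Groebner_Basis.algebra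
    then show ?thesis using assms(1) by simp
  qed
  show "x = 0" "y = 0" "z = 0"
    using *[of x y z] *[of y z x] *[of z x y] assms by auto
qed

text \<open>
  A derivation respects the relations of O / m J. In degree two, the relations x^2 y = 0, y^2 z = 0 and
  z^2 x = 0 show that the images of the variables have no constant terms. In degree three, the relations of
  type x^2 y = 0 give cyclic systems 6 p = t q, 6 q = t r, 6 r = t p for the off-diagonal coefficients of the
  linear terms, which vanish as t^3 \<noteq> 216, and the relations 3 x^3 + t x y z = 0 show that the diagonal
  coefficients agree as t \<noteq> 0. The terms of higher degree are arbitrary and are matched by
  derivation_element.
\<close>

lemma psi_surj:
  assumes t: "t \<in> objE6" "t \<noteq> 0" "t ^ 3 \<noteq> 216" and D: "D \<in> derivations (A_E6 1 t)"
  shows "\<exists>x\<in>carrier g_E6. D = psi_E6 t x"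
proof -
  obtain \<Delta> where \<Delta>: "\<And>F. D (class_E6 1 t F) = class_E6 1 t (poly_of t (\<Delta> F))"
    and add: "\<And>F G n. n < 11 \<Longrightarrow> \<Delta> (F + G) n = \<Delta> F n + \<Delta> G n"
    and smult: "\<And>c F n. n < 11 \<Longrightarrow> \<Delta> (const3 c * F) n = c * \<Delta> F n"
    and mult: "\<And>F G n. n < 11 \<Longrightarrow>
      \<Delta> (F * G) n = coord_mult t (\<Delta> F) (coord t G) n + coord_mult t (coord t F) (\<Delta> G) n"
    and zero: "\<And>F n. n < 11 \<Longrightarrow> F \<in> mjac_set t \<Longrightarrow> \<Delta> F n = 0"
    using derivation_coordinates[OF t(1) D] by blast
  define a where "a = \<Delta> varX"
  define b where "b = \<Delta> varY"
  define c where "c = \<Delta> varZ"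
  have m: "\<Delta> (F * (G * H)) n = coord_mult t (\<Delta> F) (coord t (G * H)) n +
      coord_mult t (coord t F) (\<lambda>n. coord_mult t (\<Delta> G) (coord t H) n + coord_mult t (coord t G) (\<Delta> H) n) n"
    if "n < 11" for F G H n
    unfolding mult[OF that, of F "G * H"]
    using coord_mult_cong[of "coord t F" "coord t F" "\<Delta> (G * H)", OF refl mult] by (simp del: coord_nth)
  note calc = coord_mult_nth coord_product coord_var a_def[symmetric] b_def[symmetric] c_def[symmetric]
  have relation: "coord_mult t (\<Delta> F) (coord t (G * H)) n +
      coord_mult t (coord t F) (\<lambda>n. coord_mult t (\<Delta> G) (coord t H) n + coord_mult t (coord t G) (\<Delta> H) n) n = 0"
    if "n < 11" "F * (G * H) \<in> mjac_set t" for F G H n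
    using zero[OF that] m[OF that(1)] by simp
  have sq: "vars $ i * (vars $ i * vars $ j) \<in> mjac_set t" if "i \<noteq> j" for i j
  proof -
    have "coord t (vars $ i * (vars $ i * vars $ j)) n = 0" if "n < 11" for n
      using that by (rule less_11_induct; insert exhaust_3[of i] exhaust_3[of j] \<open>i \<noteq> j\<close>; elim disjE;
        simp only: vars_nth; simp only: coord_product coord_mult_nth coord_var; simp)
    then show ?thesis using coord_zero_iff by blast
  qed
  have XXY: "varX * (varX * varY) \<in> mjac_set t" and XXZ: "varX * (varX * varZ) \<in> mjac_set t"
    and YYX: "varY * (varY * varX) \<in> mjac_set t" and YYZ: "varY * (varY * varZ) \<in> mjac_set t"
    and ZZX: "varZ * (varZ * varX) \<in> mjac_set t" and ZZY: "varZ * (varZ * varY) \<in> mjac_set t"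
    using sq[of 1 2] sq[of 1 3] sq[of 2 1] sq[of 2 3] sq[of 3 1] sq[of 3 2] by simp_all
  have b0: "b 0 = 0" using relation[OF _ XXY, of 4] by (simp only: calc) simp
  have c0: "c 0 = 0" using relation[OF _ YYZ, of 5] by (simp only: calc) simp
  have a0: "a 0 = 0" using relation[OF _ ZZX, of 6] by (simp only: calc) simp
  have r1: "6 * a 3 - t * b 1 = 0" using relation[OF _ XXY, of 10] by (simp only: calc) (simp add: a0 b0 c0)
  have r2: "6 * a 2 - t * c 1 = 0" using relation[OF _ XXZ, of 10] by (simp only: calc) (simp add: a0 b0 c0)
  have r3: "6 * b 3 - t * a 2 = 0" using relation[OF _ YYX, of 10] by (simp only: calc) (simp add: a0 b0 c0)
  have r4: "6 * b 1 - t * c 2 = 0" using relation[OF _ YYZ, of 10] by (simp only: calc) (simp add: a0 b0 c0)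
  have r5: "6 * c 2 - t * a 3 = 0" using relation[OF _ ZZX, of 10] by (simp only: calc) (simp add: a0 b0 c0)
  have r6: "6 * c 1 - t * b 3 = 0" using relation[OF _ ZZY, of 10] by (simp only: calc) (simp add: a0 b0 c0)
  have z: "a 3 = 0" "b 1 = 0" "c 2 = 0" "a 2 = 0" "c 1 = 0" "b 3 = 0"
    using cyclic_zero[OF t(3), of "a 3" "b 1" "c 2"] cyclic_zero[OF t(3), of "a 2" "c 1" "b 3"]
      r1 r2 r3 r4 r5 r6 by simp_all
  have cube: "3 * \<Delta> (vars $ i * (vars $ i * vars $ i)) 10 + t * \<Delta> (varX * (varY * varZ)) 10 = 0" for i
  proof -
    let ?F = "const3 3 * (vars $ i * (vars $ i * vars $ i)) + const3 t * (varX * (varY * varZ))"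
    have "coord t ?F n = 0" if "n < 11" for n
      using that by (rule less_11_induct; insert exhaust_3[of i]; elim disjE; simp only: vars_nth;
        simp only: coord_linear coord_product coord_mult_nth coord_var; simp add: coeff3_const3)
    then have "?F \<in> mjac_set t" using coord_zero_iff by blast
    then have "\<Delta> ?F 10 = 0" by (intro zero) simp_all
    then show ?thesis by (simp add: add smult)
  qed
  have XYZ: "\<Delta> (varX * (varY * varZ)) 10 = 3 * (a 1 + b 2 + c 3)"
    using m[of 10 varX varY varZ] by (simp only: calc) (simp add: a0 b0 c0)
  have cubes: "\<Delta> (varX * (varX * varX)) 10 = - 3 * t * a 1" "\<Delta> (varY * (varY * varY)) 10 = - 3 * t * b 2"
    "\<Delta> (varZ * (varZ * varZ)) 10 = - 3 * t * c 3"
    using m[of 10 varX varX varX] m[of 10 varY varY varY] m[of 10 varZ varZ varZ]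
    by (simp_all only: calc) (simp_all add: a0 b0 c0)
  have d: "3 * d = e" if "3 * (- 3 * t * d) + t * (3 * e) = 0" for d e
  proof -
    have "(3 * t) * (e - 3 * d) = 0" using that by (simp add: algebra_simps)
    then show ?thesis using t(2) by simp
  qed
  have "3 * a 1 = a 1 + b 2 + c 3" "3 * b 2 = a 1 + b 2 + c 3" "3 * c 3 = a 1 + b 2 + c 3"
    using cube[of 1] cube[of 2] cube[of 3] by (intro d; simp only: vars_nth cubes XYZ)+
  then have diag: "b 2 = a 1" "c 3 = a 1" by (metis mult_cancel_left zero_neq_numeral)+
  define x where "x = derivation_element t a b c"
  have x: "x \<in> carrier g_E6" by (simp add: x_def derivation_element_def)
  let ?P = "\<lambda>F. \<forall>n<11. \<Delta> F n = g_act t x (coord t F) n"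
  have P_add: "?P (F + G)" if "?P F" "?P G" for F G
  proof (intro allI impI)
    fix n :: nat assume n: "n < 11"
    show "\<Delta> (F + G) n = g_act t x (coord t (F + G)) n"
      unfolding coord_fun(1) g_act_linear(3)[OF n] add[OF n] using that n by simp
  qed
  have P_mult: "?P (F * G)" if F: "?P F" and G: "?P G" for F G
  proof (intro allI impI)
    fix n :: nat assume n: "n < 11"
    have "coord_mult t (\<Delta> F) (coord t G) = coord_mult t (g_act t x (coord t F)) (coord t G)"
      "coord_mult t (coord t F) (\<Delta> G) = coord_mult t (coord t F) (g_act t x (coord t G))"
      using F G by (intro coord_mult_cong; blast)+
    then show "\<Delta> (F * G) n = g_act t x (coord t (F * G)) n"
      by (simp only: mult[OF n] coord_fun(3) g_act_derivation[OF n])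
  qed
  have P_const: "?P (const3 k)" for k
  proof (intro allI impI)
    fix n :: nat assume n: "n < 11"
    have one: "coord_mult t u (coord t 1) n = u n" "coord_mult t (coord t 1) u n = u n" if "n < 11" for u n
      using that by (rule less_11_induct; simp only: coord_mult_nth coord_one; simp)+
    have "\<Delta> 1 n = 0" if "n < 11" for n using mult[OF that, of 1 1] by (simp add: one[OF that])
    then have "\<Delta> (const3 k) n = 0" using smult[OF n, of k 1] n by simp
    moreover have "g_act t x (coord t 1) n = 0"
      using n by (rule less_11_induct; simp only: g_act_nth coord_one; simp)
    then have "g_act t x (coord t (const3 k * 1)) n = 0"
      by (simp only: coord_fun(2) g_act_linear(4)[OF n] mult_zero_right)
    ultimately show "\<Delta> (const3 k) n = g_act t x (coord t (const3 k)) n" by simp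
  qed
  have P_var: "?P (vars $ j)" for j
    using exhaust_3[of j] a0 b0 c0 z diag
    by (auto simp: x_def g_act_derivation_element simp flip: a_def b_def c_def)
  have P: "?P F" for F
  proof (intro allI impI)
    fix n :: nat assume n: "n < 11"
    have "\<exists>T. ?P T \<and> F - T \<in> order_ge 4"
    proof (rule polynomial_approx)
      show "?P (vars $ j * G)" if "?P G" for j G using P_mult[OF P_var that] .
    qed (fact P_const P_add)+
    then obtain T where T: "?P T" "F - T \<in> order_ge 4" by blast
    then have "F - T \<in> mjac_set t" using order_ge_4_subset_mjac_set by blast
    then have "\<Delta> (F - T) n = 0" "coord t (F - T) k = 0" if "k < 11" for k
      using zero[OF n] coord_zero_iff that by blast+
    then have "\<Delta> (T + (F - T)) n = \<Delta> T n" "coord t F k = coord t T k" if "k < 11" for k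
      using add[OF n, of T "F - T"] that by simp_all
    moreover from this(2) have "g_act t x (coord t F) = g_act t x (coord t T)" by (rule g_act_cong)
    ultimately show "\<Delta> F n = g_act t x (coord t F) n" using T(1) n by simp
  qed
  have "D = psi_E6 t x"
  proof
    fix e
    show "D e = psi_E6 t x e"
    proof (cases "e \<in> carrier (A_E6 1 t)")
      case True
      then obtain F where "e = class_E6 1 t F" by auto
      then show ?thesis
        using P[of F] by (simp add: \<Delta> psi_class[OF t(1)] class_eq_iff_coord[OF t(1)] del: coord_nth)
    next
      case False
      then show ?thesis using D by (auto simp: psi_E6_def derivations_def PiE_def extensional_def)
    qed
  qed
  with x show ?thesis by blast
qed

theorem psi_lie_iso:
  assumes t: "t \<in> objE6" "t \<noteq> 0" "t ^ 3 \<noteq> 216"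
  shows "psi_E6 t \<in> lie_iso g_E6 (L1_E6 t)"
proof -
  note cl = psi_class[OF t(1)] and eq = class_eq_iff_coord[OF t(1)]
  have ext: "psi_E6 t x = (\<lambda>a\<in>carrier (A_E6 1 t). f a)"
    if "\<And>F. psi_E6 t x (class_E6 1 t F) = f (class_E6 1 t F)" for x f
  proof
    fix a show "psi_E6 t x a = (\<lambda>a\<in>carrier (A_E6 1 t). f a) a"
    proof (cases "a \<in> carrier (A_E6 1 t)")
      case True
      then show ?thesis using that by auto
    next
      case False
      then show ?thesis by (simp add: psi_E6_def)
    qed
  qed
  have inj: "x = y" if "x \<in> carrier g_E6" "y \<in> carrier g_E6" "psi_E6 t x = psi_E6 t y" for x y
  proof (rule g_act_faithful[OF that(1,2)])
    fix u and n :: nat assume n: "n < 11"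
    have "g_act t x (coord t (poly_of t u)) n = g_act t y (coord t (poly_of t u)) n"
      using arg_cong[OF that(3), of "\<lambda>f. f (class_E6 1 t (poly_of t u))"] n
      by (simp add: cl eq del: coord_nth)
    moreover have "g_act t z (coord t (poly_of t u)) = g_act t z u" for z
      by (rule g_act_cong) (simp del: coord_nth)
    ultimately show "g_act t x u n = g_act t y u n" by simp
  qed
  have bij: "bij_betw (psi_E6 t) (carrier g_E6) (carrier (L1_E6 t))"
    unfolding bij_betw_def
  proof
    show "inj_on (psi_E6 t) (carrier g_E6)" using inj by (rule inj_onI)
    have "carrier (L1_E6 t) = derivations (A_E6 1 t)" by (simp add: L1_E6_def Der_def)
    then show "psi_E6 t ` carrier g_E6 = carrier (L1_E6 t)"
      using psi_derivation[OF t(1)] psi_surj[OF t] by blast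
  qed
  have add: "psi_E6 t (x \<oplus>\<^bsub>g_E6\<^esub> y) = psi_E6 t x \<oplus>\<^bsub>L1_E6 t\<^esub> psi_E6 t y" for x y
  proof -
    have "psi_E6 t (\<lambda>n. x n + y n) (class_E6 1 t F) =
        psi_E6 t x (class_E6 1 t F) \<oplus>\<^bsub>A_E6 1 t\<^esub> psi_E6 t y (class_E6 1 t F)" for F
      by (simp add: cl eq g_act_linear del: coord_nth)
    from ext[OF this] show ?thesis by (simp add: L1_E6_def Der_def)
  qed
  have smult: "psi_E6 t (c \<odot>\<^bsub>g_E6\<^esub> x) = c \<odot>\<^bsub>L1_E6 t\<^esub> psi_E6 t x" for c x
  proof -
    have "psi_E6 t (\<lambda>n. c * x n) (class_E6 1 t F) = c \<odot>\<^bsub>A_E6 1 t\<^esub> psi_E6 t x (class_E6 1 t F)" for F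
      by (simp add: cl eq g_act_linear del: coord_nth)
    from ext[OF this] show ?thesis by (simp add: L1_E6_def Der_def)
  qed
  have bracket: "psi_E6 t (lbracket g_E6 x y) = lbracket (L1_E6 t) (psi_E6 t x) (psi_E6 t y)" for x y
  proof -
    have act: "g_act t x (coord t (poly_of t u)) = g_act t x u" for x u
      by (rule g_act_cong) (simp del: coord_nth)
    have "psi_E6 t (g_bracket x y) (class_E6 1 t F) =
        psi_E6 t x (psi_E6 t y (class_E6 1 t F)) \<ominus>\<^bsub>A_E6 1 t\<^esub> psi_E6 t y (psi_E6 t x (class_E6 1 t F))" for F
      by (simp add: cl eq g_act_bracket act del: coord_nth)
    from ext[OF this] show ?thesis by (simp add: L1_E6_def Der_def)
  qed
  show ?thesis
    unfolding lie_iso_def using bij add smult bracket by blast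
qed

section \<open>The matrices of the representations\<close>

definition idx :: "11 \<Rightarrow> nat" where
  "idx = (SOME f. bij_betw f UNIV {..<11})"

lemma bij_idx: "bij_betw idx UNIV {..<11}"
proof -
  have "\<exists>f. bij_betw f (UNIV :: 11 set) {..<11 :: nat}"
    by (rule finite_same_card_bij) simp_all
  then show ?thesis unfolding idx_def by (rule someI_ex)
qed

lemma idx_less: "idx i < 11"
  using bij_idx by (auto simp: bij_betw_def)

lemma sum_idx: "(\<Sum>i\<in>UNIV. f (idx i)) = (\<Sum>n<11. f n)"
  using sum.reindex_bij_betw[OF bij_idx] .

lemma idx_surj: "n < 11 \<Longrightarrow> \<exists>i. idx i = n"
  using bij_idx by (auto simp: bij_betw_def image_iff dest!: equalityD2)

definition vec_of :: "(nat \<Rightarrow> complex) \<Rightarrow> complex ^ 11" where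
  "vec_of u = (\<chi> i. u (idx i))"

lemma vec_of_eq_iff: "vec_of u = vec_of v \<longleftrightarrow> (\<forall>n<11. u n = v n)"
  using idx_surj idx_less by (auto simp: vec_of_def vec_eq_iff)

lemma vec_of_surj: "\<exists>u. w = vec_of u"
proof -
  have inj: "inj idx" using bij_idx by (simp add: bij_betw_def)
  have "w = vec_of (\<lambda>n. w $ inv_into UNIV idx n)" by (simp add: vec_of_def vec_eq_iff inv_f_f[OF inj])
  then show ?thesis by blast
qed

lemma sum_less_11: "(\<Sum>k<11. f k) = f 0 + f 1 + f 2 + f 3 + f 4 + f 5 + f 6 + f 7 + f 8 + f 9 + f (10::nat)"
  by (simp add: lessThan_nat_numeral lessThan_Suc add_ac)

definition unit_seq :: "nat \<Rightarrow> nat \<Rightarrow> complex" where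
  "unit_seq m = (\<lambda>n. if n = m then 1 else 0)"

definition g_rep :: "complex \<Rightarrow> (nat \<Rightarrow> complex) \<Rightarrow> complex ^ 11 ^ 11" where
  "g_rep t x = (\<chi> i j. g_act t x (unit_seq (idx j)) (idx i))"

lemma g_rep_vec_of: "g_rep t x *v vec_of u = vec_of (g_act t x u)"
proof -
  have "(\<Sum>m<11. g_act t x (unit_seq m) n * u m) = g_act t x u n" if "n < 11" for n
    using that by (rule less_11_induct)
      (simp_all only: sum_less_11 g_act_nth unit_seq_def, simp_all add: algebra_simps)
  then have "(\<Sum>j\<in>UNIV. g_act t x (unit_seq (idx j)) (idx i) * u (idx j)) = g_act t x u (idx i)" for i
    using sum_idx[of "\<lambda>m. g_act t x (unit_seq m) (idx i) * u m"] idx_less by simp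
  then show ?thesis by (simp add: g_rep_def vec_of_def matrix_vector_mult_def vec_eq_iff)
qed

lemma matrix_eq_vec_of: "A = B \<longleftrightarrow> (\<forall>u. A *v vec_of u = B *v vec_of u)"
  unfolding matrix_eq using vec_of_surj by metis

lemma matrix_rep_g_rep: "matrix_rep g_E6 (g_rep t)"
  unfolding matrix_rep_def
proof (intro conjI ballI allI)
  fix x y
  show "g_rep t (x \<oplus>\<^bsub>g_E6\<^esub> y) = g_rep t x + g_rep t y"
    using idx_less by (simp add: g_rep_def vec_eq_iff g_act_linear)
  show "g_rep t (lbracket g_E6 x y) = g_rep t x ** g_rep t y - g_rep t y ** g_rep t x"
    unfolding matrix_eq_vec_of
  proof
    fix u
    have "g_rep t (g_bracket x y) *v vec_of u = vec_of (g_act t x (g_act t y u)) - vec_of (g_act t y (g_act t x u))"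
      using idx_less by (simp add: g_rep_vec_of) (simp add: vec_of_def vec_eq_iff g_act_bracket)
    then show "g_rep t (lbracket g_E6 x y) *v vec_of u = (g_rep t x ** g_rep t y - g_rep t y ** g_rep t x) *v vec_of u"
      by (simp add: matrix_vector_mult_diff_rdistrib g_rep_vec_of flip: matrix_vector_mul_assoc)
  qed
next
  fix c x
  show "g_rep t (c \<odot>\<^bsub>g_E6\<^esub> x) = mat c ** g_rep t x"
    using idx_less by (simp add: g_rep_def vec_eq_iff mat_mult_nth g_act_linear)
qed

lemma natural_rep_g_rep:
  assumes t: "t \<in> objE6"
  shows "is_natural_rep g_E6 (A_E6 1 t) (psi_E6 t) (g_rep t)"
proof -
  define \<theta> where "\<theta> = (\<lambda>a. vec_of (coord t (SOME F. class_E6 1 t F = a)))"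
  have \<theta>: "\<theta> (class_E6 1 t F) = vec_of (coord t F)" for F
  proof -
    define G where "G = (SOME G. class_E6 1 t G = class_E6 1 t F)"
    have "class_E6 1 t G = class_E6 1 t F" unfolding G_def by (rule someI[of _ F]) simp
    then have "vec_of (coord t G) = vec_of (coord t F)"
      unfolding vec_of_eq_iff class_eq_iff_coord[OF t] .
    then show ?thesis unfolding \<theta>_def G_def .
  qed
  have bij: "bij_betw \<theta> (carrier (A_E6 1 t)) UNIV"
    unfolding bij_betw_def
  proof
    show "inj_on \<theta> (carrier (A_E6 1 t))"
    proof (rule inj_onI)
      fix a b assume "a \<in> carrier (A_E6 1 t)" "b \<in> carrier (A_E6 1 t)" and eq: "\<theta> a = \<theta> b"
      then obtain F G where "a = class_E6 1 t F" "b = class_E6 1 t G" by auto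
      with eq show "a = b" by (simp add: \<theta> vec_of_eq_iff class_eq_iff_coord[OF t])
    qed
    have "\<exists>F. w = \<theta> (class_E6 1 t F)" for w
    proof -
      obtain u where "w = vec_of u" using vec_of_surj by blast
      then have "w = \<theta> (class_E6 1 t (poly_of t u))" by (simp add: \<theta> vec_of_eq_iff del: coord_nth)
      then show ?thesis ..
    qed
    then show "\<theta> ` carrier (A_E6 1 t) = UNIV" by (simp add: image_image) blast
  qed
  moreover have "\<theta> (class_E6 1 t F \<oplus>\<^bsub>A_E6 1 t\<^esub> class_E6 1 t G) = \<theta> (class_E6 1 t F) + \<theta> (class_E6 1 t G)"
    "\<theta> (c \<odot>\<^bsub>A_E6 1 t\<^esub> class_E6 1 t F) = c *s \<theta> (class_E6 1 t F)" for F G c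
    by (simp_all add: \<theta>) (simp_all add: vec_of_def vec_eq_iff del: coord_nth)
  ultimately have "\<theta> \<in> coordinates (A_E6 1 t)" unfolding coordinates_def by auto
  moreover have "\<theta> (psi_E6 t x a) = g_rep t x *v \<theta> a" if "a \<in> carrier (A_E6 1 t)" for x a
  proof -
    from that obtain F where "a = class_E6 1 t F" by auto
    then show ?thesis by (simp add: psi_class[OF t] \<theta> g_rep_vec_of vec_of_eq_iff del: coord_nth)
  qed
  ultimately show ?thesis unfolding is_natural_rep_def by blast
qed

lemma continuous_g_rep: "continuous_on T (\<lambda>t. g_rep t x)"
proof -
  have "continuous_on T (\<lambda>t. g_act t x u n)" if "n < 11" for u n
    using that by (rule less_11_induct) (simp_all only: g_act_nth, auto intro!: continuous_intros)
  then show ?thesis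
    unfolding g_rep_def using idx_less by (intro continuous_on_vec_lambda) auto
qed

text \<open>
  An intertwiner P commutes with the Euler derivation, so it maps the last coordinate, the part of degree
  three, to itself. The actions of the basis elements for w_1 and zeta_1 then show that P acts on the
  coordinates 7 and 1 by the same scalar as on coordinate 10. The entry - t / 2 of the action of w_1 from
  coordinate 1 to coordinate 7 is therefore the same for t and s.
\<close>

lemma g_rep_rigid:
  assumes "rep_equiv g_E6 (g_rep t) (g_rep s)"
  shows "s = t"
proof -
  obtain P where P: "invertible P" and comm: "\<And>x. x \<in> carrier g_E6 \<Longrightarrow> P ** g_rep t x = g_rep s x ** P"
    using assms by (auto simp: rep_equiv_def)
  have inj: "inj idx" using bij_idx by (simp add: bij_betw_def)
  define p where "p = (\<lambda>n k. P $ inv_into UNIV idx n $ inv_into UNIV idx k)"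
  have p: "P $ i $ j = p (idx i) (idx j)" for i j by (simp add: p_def inv_f_f[OF inj])
  have E: "(\<Sum>k<11. p n k * g_act t x (unit_seq m) k) = (\<Sum>k<11. g_act s x (unit_seq k) n * p k m)"
    if x: "x \<in> carrier g_E6" and nm: "n < 11" "m < 11" for x n m
  proof -
    obtain i j where ij: "idx i = n" "idx j = m" using idx_surj nm by metis
    have "(P ** g_rep t x) $ i $ j = (g_rep s x ** P) $ i $ j" using comm[OF x] by simp
    then have "(\<Sum>k\<in>UNIV. p n (idx k) * g_act t x (unit_seq m) (idx k)) =
        (\<Sum>k\<in>UNIV. g_act s x (unit_seq (idx k)) n * p (idx k) m)"
      by (simp add: matrix_matrix_mult_def g_rep_def p ij)
    then show ?thesis
      using sum_idx[of "\<lambda>k. p n k * g_act t x (unit_seq m) k"]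
        sum_idx[of "\<lambda>k. g_act s x (unit_seq k) n * p k m"] by simp
  qed
  have carrier: "unit_seq k \<in> carrier g_E6" if "k < 22" for k using that by (simp add: unit_seq_def)
  have row: "p 10 m = 0" if "m < 10" for m
  proof -
    have m: "m < 11" and "m \<noteq> 10" using that by auto
    from m have "(\<Sum>k<11. p 10 k * g_act t (unit_seq 0) (unit_seq m) k) =
        (\<Sum>k<11. g_act s (unit_seq 0) (unit_seq k) 10 * p k m) \<longrightarrow> m \<noteq> 10 \<longrightarrow> p 10 m = 0"
      by (rule less_11_induct) (simp_all only: sum_less_11 g_act_nth unit_seq_def, simp_all)
    with E[OF carrier, of 0 10 m] m \<open>m \<noteq> 10\<close> show ?thesis by simp
  qed
  have nz: "p 10 10 \<noteq> 0"
  proof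
    assume "p 10 10 = 0"
    then have zero: "p 10 m = 0" if "m < 11" for m using row[of m] that by (cases "m = 10") auto
    obtain i where i: "idx i = 10" using idx_surj[of 10] by auto
    obtain Q where "P ** Q = mat 1" using P by (auto simp: invertible_def)
    then have "(P ** Q) $ i $ i = 1" by (simp add: mat_def)
    moreover have "(P ** Q) $ i $ i = 0" using zero idx_less by (simp add: matrix_matrix_mult_def p i)
    ultimately show False by simp
  qed
  have "p 7 7 = p 10 10"
    using E[of "unit_seq 4" 10 7] carrier[of 4] by (simp only: sum_less_11 g_act_nth unit_seq_def) simp
  moreover have "p 1 1 = p 10 10"
    using E[of "unit_seq 19" 10 1] carrier[of 19] by (simp only: sum_less_11 g_act_nth unit_seq_def) simp
  moreover have "p 7 7 * t = s * p 1 1"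
    using E[of "unit_seq 4" 7 1] carrier[of 4] by (simp only: sum_less_11 g_act_nth unit_seq_def) simp
  ultimately show ?thesis using nz by simp
qed

context cube_root_of_unity
begin

lemma generic_parameter:
  assumes "s \<notin> {0, 6, 6 * \<rho>, 6 * \<rho>\<^sup>2}"
  shows "s \<noteq> 0" "s ^ 3 \<noteq> 216"
proof -
  show "s \<noteq> 0" using assms by simp
  show "s ^ 3 \<noteq> 216"
  proof
    assume "s ^ 3 = 216"
    then have "s ^ 3 = 6 ^ 3" by simp
    from cube_roots_scaled[OF this] assms show False by (auto simp: mult.commute)
  qed
qed

theorem groupoid_isos:
  "k \<in> {0, 1} \<Longrightarrow> groupoid_iso_over_objs (matrix_arrow k)
     (action_groupoid (G_E6 \<rho>) pi_map (objE6 - {0, 6, 6 * \<rho>, 6 * \<rho>\<^sup>2}))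
     (full_sub (Grp_E6 k) (objE6 - {0, 6, 6 * \<rho>, 6 * \<rho>\<^sup>2}))"
  "k \<ge> 2 \<Longrightarrow> groupoid_iso_over_objs (matrix_arrow k)
     (action_groupoid (G_E6 \<rho>) pi_map objE6) (Grp_E6 k)"
proof -
  let ?S = "objE6 - {0, 6, 6 * \<rho>, 6 * \<rho>\<^sup>2}"
  show "groupoid_iso_over_objs (matrix_arrow k) (action_groupoid (G_E6 \<rho>) pi_map ?S) (full_sub (Grp_E6 k) ?S)"
    if k: "k \<in> {0, 1}"
  proof (rule groupoid_iso)
    show "\<forall>t\<in>?S. \<forall>s\<in>?S. \<forall>A. admissible k t s A \<longleftrightarrow> invertible A \<and> cub_equiv A t s"
      using admissible_iff_01[OF k _ _ generic_parameter] by blast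
  qed blast
  have "full_sub (Grp_E6 k) objE6 = Grp_E6 k" by (simp add: full_sub_def Grp_E6_def)
  moreover have "groupoid_iso_over_objs (matrix_arrow k) (action_groupoid (G_E6 \<rho>) pi_map objE6)
      (full_sub (Grp_E6 k) objE6)" if k: "k \<ge> 2"
    by (rule groupoid_iso) (use admissible_iff_ge_2[OF k] in blast)+
  ultimately show "k \<ge> 2 \<Longrightarrow> groupoid_iso_over_objs (matrix_arrow k)
     (action_groupoid (G_E6 \<rho>) pi_map objE6) (Grp_E6 k)" by simp
qed

lemma pi_map_gens:
  "pi_map (proj_class (mat_A1 \<rho>)) = moeb_P \<rho>" "pi_map (proj_class (mat_A2 \<rho>)) = moeb_R"
  "pi_map (proj_class mat_A3) = \<one>\<^bsub>H_E6 \<rho>\<^esub>" "pi_map (proj_class mat_A4) = \<one>\<^bsub>H_E6 \<rho>\<^esub>"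
  by (simp_all add: pi_map_represents represents_gens)

end

theorem theoremA:
  fixes \<rho> :: complex
  assumes "\<rho> ^ 3 = 1" and "\<rho> \<noteq> 1"
  shows
    "(\<exists>\<pi> \<in> hom (G_E6 \<rho>) (H_E6 \<rho>).
        \<pi> (proj_class (mat_A1 \<rho>)) = moeb_P \<rho> \<and>
        \<pi> (proj_class (mat_A2 \<rho>)) = moeb_R \<and>
        \<pi> (proj_class mat_A3) = \<one>\<^bsub>H_E6 \<rho>\<^esub> \<and>
        \<pi> (proj_class mat_A4) = \<one>\<^bsub>H_E6 \<rho>\<^esub> \<and>
        (\<forall>k \<in> {0, 1}.
           groupoid_iso_over_objs (matrix_arrow k)
             (action_groupoid (G_E6 \<rho>) \<pi> (objE6 - {0, 6, 6 * \<rho>, 6 * \<rho>\<^sup>2}))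
             (full_sub (Grp_E6 k) (objE6 - {0, 6, 6 * \<rho>, 6 * \<rho>\<^sup>2}))) \<and>
        (\<forall>k \<ge> 2.
           groupoid_iso_over_objs (matrix_arrow k)
             (action_groupoid (G_E6 \<rho>) \<pi> objE6)
             (Grp_E6 k)))
     \<and>
     (let T = {t :: complex. t ^ 3 \<notin> {0, 216, -27}} in
      \<exists>(\<gg> :: (nat \<Rightarrow> complex) lie)
       (\<psi> :: complex \<Rightarrow> (nat \<Rightarrow> complex) \<Rightarrow> ps3 set \<Rightarrow> ps3 set)
       (r :: complex \<Rightarrow> (nat \<Rightarrow> complex) \<Rightarrow> complex ^ 11 ^ 11).
        lie_algebra \<gg> \<and> solvable_lie \<gg> \<and>
        (\<forall>t \<in> T. \<psi> t \<in> lie_iso \<gg> (L1_E6 t)) \<and>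
        (\<forall>t \<in> T. matrix_rep \<gg> (r t) \<and> is_natural_rep \<gg> (A_E6 1 t) (\<psi> t) (r t)) \<and>
        (\<forall>x \<in> carrier \<gg>. continuous_on T (\<lambda>t. r t x)) \<and>
        (\<forall>t \<in> T. finite {s \<in> T. rep_equiv \<gg> (r t) (r s)}))"
proof (rule conjI)
  interpret cube_root_of_unity \<rho> using assms by unfold_locales
  show "\<exists>\<pi> \<in> hom (G_E6 \<rho>) (H_E6 \<rho>).
        \<pi> (proj_class (mat_A1 \<rho>)) = moeb_P \<rho> \<and>
        \<pi> (proj_class (mat_A2 \<rho>)) = moeb_R \<and>
        \<pi> (proj_class mat_A3) = \<one>\<^bsub>H_E6 \<rho>\<^esub> \<and>
        \<pi> (proj_class mat_A4) = \<one>\<^bsub>H_E6 \<rho>\<^esub> \<and>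
        (\<forall>k \<in> {0, 1}.
           groupoid_iso_over_objs (matrix_arrow k)
             (action_groupoid (G_E6 \<rho>) \<pi> (objE6 - {0, 6, 6 * \<rho>, 6 * \<rho>\<^sup>2}))
             (full_sub (Grp_E6 k) (objE6 - {0, 6, 6 * \<rho>, 6 * \<rho>\<^sup>2}))) \<and>
        (\<forall>k \<ge> 2.
           groupoid_iso_over_objs (matrix_arrow k)
             (action_groupoid (G_E6 \<rho>) \<pi> objE6)
             (Grp_E6 k))"
    by (intro bexI[of _ pi_map] conjI ballI allI impI pi_map_hom pi_map_gens groupoid_isos)
next
  let ?T = "{t :: complex. t ^ 3 \<notin> {0, 216, -27}}"
  have T: "t \<in> objE6" "t \<noteq> 0" "t ^ 3 \<noteq> 216" if "t \<in> ?T" for t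
    using that by (auto simp: objE6_def)
  have "finite {s \<in> ?T. rep_equiv g_E6 (g_rep t) (g_rep s)}" for t
    by (rule finite_subset[of _ "{t}"]) (use g_rep_rigid in auto)
  then have "lie_algebra g_E6 \<and> solvable_lie g_E6 \<and>
      (\<forall>t\<in>?T. psi_E6 t \<in> lie_iso g_E6 (L1_E6 t)) \<and>
      (\<forall>t\<in>?T. matrix_rep g_E6 (g_rep t) \<and> is_natural_rep g_E6 (A_E6 1 t) (psi_E6 t) (g_rep t)) \<and>
      (\<forall>x\<in>carrier g_E6. continuous_on ?T (\<lambda>t. g_rep t x)) \<and>
      (\<forall>t\<in>?T. finite {s \<in> ?T. rep_equiv g_E6 (g_rep t) (g_rep s)})"
    using lie_algebra_g_E6 solvable_g_E6 psi_lie_iso T matrix_rep_g_rep natural_rep_g_rep continuous_g_rep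
    by blast
  then show "let T = {t :: complex. t ^ 3 \<notin> {0, 216, -27}} in
      \<exists>(\<gg> :: (nat \<Rightarrow> complex) lie)
       (\<psi> :: complex \<Rightarrow> (nat \<Rightarrow> complex) \<Rightarrow> ps3 set \<Rightarrow> ps3 set)
       (r :: complex \<Rightarrow> (nat \<Rightarrow> complex) \<Rightarrow> complex ^ 11 ^ 11).
        lie_algebra \<gg> \<and> solvable_lie \<gg> \<and>
        (\<forall>t \<in> T. \<psi> t \<in> lie_iso \<gg> (L1_E6 t)) \<and>
        (\<forall>t \<in> T. matrix_rep \<gg> (r t) \<and> is_natural_rep \<gg> (A_E6 1 t) (\<psi> t) (r t)) \<and>
        (\<forall>x \<in> carrier \<gg>. continuous_on T (\<lambda>t. r t x)) \<and>
        (\<forall>t \<in> T. finite {s \<in> T. rep_equiv \<gg> (r t) (r s)})"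
    unfolding Let_def by (intro exI[of _ g_E6] exI[of _ psi_E6] exI[of _ g_rep])
qed

end
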